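(* Let $\mathcal{H}_A$ and $\mathcal{H}_B$ be finite-dimensional Hilbert spaces and let $\rho_{AB}$ be a (normalized) bipartite state on $\mathcal{H}_A\otimes\mathcal{H}_B$. For $n\in\mathbb{N}$ let $\rho_{AB}^{\otimes n}$ be the corresponding i.i.d. state on $(\mathcal{H}_A\otimes\mathcal{H}_B)^{\otimes n}$, viewed as a bipartite state on $\mathcal{H}_A^{\otimes n}\otimes\mathcal{H}_B^{\otimes n}$ (systems $A^n$ and $B^n$). Then $$\lim_{\varepsilon\to 0}\lim_{n\to\infty}\frac1n H_{\min}^{\varepsilon}(A^n|B^n)_{\rho^{\otimes n}}=H(A|B)_\rho$$ and $$\lim_{\varepsilon\to 0}\lim_{n\to\infty}\frac1n H_{\max}^{\varepsilon}(A^n|B^n)_{\rho^{\otimes n}}=H(A|B)_\rho .$$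
   Context: All Hilbert spaces are finite-dimensional; $\log$ is the binary logarithm; $\varepsilon\to0$ means through $\varepsilon>0$. For a Hilbert space $\mathcal{H}$, $\mathcal{S}(\mathcal{H})$ denotes the positive semi-definite operators of trace $1$ and $\mathcal{S}_{\le}(\mathcal{H})$ those of trace at most $1$. Write $\mathcal{H}_{AB}=\mathcal{H}_A\otimes\mathcal{H}_B$; marginals are partial traces, e.g. $\rho_B=\mathrm{tr}_A(\rho_{AB})$. $\mathbb{1}$ denotes an identity operator. Conditional von Neumann entropy: for $\rho_{AB}\in\mathcal{S}(\mathcal{H}_{AB})$ and $\sigma_B\in\mathcal{S}(\mathcal{H}_B)$, $H(A|B)_{\rho|\sigma}:=\lim_{\xi\to0^+}\mathrm{tr}\big(\rho_{AB}(\mathbb{1}_A\otimes\log(\sigma_B+\xi\mathbb{1}_B)-\log\rho_{AB})\big)$ (with $0\log0=0$), and $H(A|B)_\rho:=\max_{\sigma_B\in\mathcal{S}(\mathcal{H}_B)}H(A|B)_{\rho|\sigma}=H(A|B)_{\rho|\rho}$, where $\rho|\rho$ means $\sigma_B=\rho_B$. Min-entropy: for $\rho_{AB}\in\mathcal{S}_\le(\mathcal{H}_{AB})$ and $\sigma_B\in\mathcal{S}(\mathcal{H}_B)$, $H_{\min}(A|B)_{\rho|\sigma}:=\sup\{\lambda\in\mathbb{R}:2^{-\lambda}\,\mathbb{1}_A\otimes\sigma_B\ge\rho_{AB}\}$ (equal to $-\infty$ if no such $\lambda$ exists), and $H_{\min}(A|B)_\rho:=\max_{\sigma_B\in\mathcal{S}(\mathcal{H}_B)}H_{\min}(A|B)_{\rho|\sigma}$.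 Max-entropy: for $\rho_{AB}\in\mathcal{S}_\le(\mathcal{H}_{AB})$ with purification $\rho_{ABC}$ (a rank-one operator on $\mathcal{H}_A\otimes\mathcal{H}_B\otimes\mathcal{H}_C$ with $\mathrm{tr}_C\rho_{ABC}=\rho_{AB}$), $H_{\max}(A|B)_\rho:=-H_{\min}(A|C)_\rho$, where the right-hand side is evaluated on $\rho_{AC}=\mathrm{tr}_B\rho_{ABC}$. Smoothing: for $\varepsilon>0$ and $\rho\in\mathcal{S}(\mathcal{H})$, $\mathcal{B}^\varepsilon(\rho):=\{\tilde\rho\in\mathcal{S}_\le(\mathcal{H}):C(\rho,\tilde\rho)\le\varepsilon\}$ with $C(\rho,\tilde\rho):=\sqrt{1-F^2(\rho,\tilde\rho)}$ and $F(\rho,\tilde\rho):=\mathrm{tr}|\sqrt\rho\sqrt{\tilde\rho}|$. Then $H_{\min}^\varepsilon(A|B)_\rho:=\max_{\tilde\rho_{AB}\in\mathcal{B}^\varepsilon(\rho_{AB})}H_{\min}(A|B)_{\tilde\rho}$ and $H_{\max}^\varepsilon(A|B)_\rho:=\min_{\tilde\rho_{AB}\in\mathcal{B}^\varepsilon(\rho_{AB})}H_{\max}(A|B)_{\tilde\rho}$. *)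

theory Defs
  imports "Jordan_Normal_Form.Schur_Decomposition" "HOL-Library.Extended_Real"
begin

text \<open>
  A finite-dimensional Hilbert space of dimension \<open>d\<close> is \<open>\<complex>\<^sup>d\<close> with the standard inner product;
  operators on it are the matrices in \<^term>\<open>carrier_mat d d\<close>. The product basis vector
  \<open>e\<^sub>a \<otimes> e\<^sub>b\<close> of \<open>\<complex>\<^sup>d \<otimes> \<complex>\<^sup>e\<close> has index \<open>a * e + b\<close> (left factor most significant), so that
  iterated tensor products are strictly associative.
\<close>

definition mat_trace :: "complex mat \<Rightarrow> complex" where
  "mat_trace M = (\<Sum>i<dim_row M. M $$ (i, i))"

definition kron :: "complex mat \<Rightarrow> complex mat \<Rightarrow> complex mat" where
  "kron M N = mat (dim_row M * dim_row N) (dim_col M * dim_col N)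
     (\<lambda>(i, j). M $$ (i div dim_row N, j div dim_col N) * N $$ (i mod dim_row N, j mod dim_col N))"

text \<open>
  Partial trace over the second factor of \<open>\<complex>\<^bsup>d1\<^esup> \<otimes> \<complex>\<^bsup>d2\<^esup> \<otimes> \<complex>\<^bsup>d3\<^esup>\<close>. The partial trace over the last
  factor is the case \<open>d3 = 1\<close>.
\<close>
definition ptrace_mid :: "nat \<Rightarrow> nat \<Rightarrow> nat \<Rightarrow> complex mat \<Rightarrow> complex mat" where
  "ptrace_mid d1 d2 d3 M = mat (d1 * d3) (d1 * d3)
     (\<lambda>(i, j). \<Sum>k<d2. M $$ (((i div d3) * d2 + k) * d3 + i mod d3,
                             ((j div d3) * d2 + k) * d3 + j mod d3))"

definition unitary_mat :: "nat \<Rightarrow> complex mat \<Rightarrow> bool" where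
  "unitary_mat d U \<longleftrightarrow>
     U \<in> carrier_mat d d \<and> mat_adjoint U * U = 1\<^sub>m d \<and> U * mat_adjoint U = 1\<^sub>m d"

definition psd_mat :: "nat \<Rightarrow> complex mat \<Rightarrow> bool" where
  "psd_mat d M \<longleftrightarrow> M \<in> carrier_mat d d \<and> mat_adjoint M = M \<and>
     (\<forall>v \<in> carrier_vec d. 0 \<le> Re ((M *\<^sub>v v) \<bullet>c v))"

text \<open>
  Functional calculus of a Hermitian matrix through a spectral decomposition
  \<open>M = U diag(x) U\<^sup>*\<close>; the result does not depend on the decomposition.
\<close>
definition mat_fun :: "(real \<Rightarrow> real) \<Rightarrow> complex mat \<Rightarrow> complex mat" where
  "mat_fun f M = (THE N. \<exists>U x. unitary_mat (dim_row M) U \<and>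
     M = U * mat_diag (dim_row M) (\<lambda>i. complex_of_real (x i)) * mat_adjoint U \<and>
     N = U * mat_diag (dim_row M) (\<lambda>i. complex_of_real (f (x i))) * mat_adjoint U)"

definition mat_sqrt :: "complex mat \<Rightarrow> complex mat" where
  "mat_sqrt = mat_fun sqrt"

definition mat_abs :: "complex mat \<Rightarrow> complex mat" where
  "mat_abs M = mat_sqrt (mat_adjoint M * M)"

text \<open>
  Binary logarithm, with the value 0 on the kernel: this implements \<open>0 log 0 = 0\<close> in
  \<open>tr (\<rho> log \<rho>)\<close>.
\<close>
definition mat_log :: "complex mat \<Rightarrow> complex mat" where
  "mat_log = mat_fun (\<lambda>x. if x > 0 then log 2 x else 0)"

definition states :: "nat \<Rightarrow> complex mat set" where
  "states d = {\<rho>. psd_mat d \<rho> \<and> mat_trace \<rho> = 1}"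

definition substates :: "nat \<Rightarrow> complex mat set" where
  "substates d = {\<rho>. psd_mat d \<rho> \<and> Re (mat_trace \<rho>) \<le> 1}"

text \<open>
  In the following, \<open>a\<close> and \<open>b\<close> are the dimensions of the two subsystems of a bipartite operator
  \<open>\<rho> \<in> carrier_mat (a * b) (a * b)\<close>. Entropies are extended reals, and a maximum (minimum) over a
  set of states is written as a supremum (infimum).
\<close>

text \<open>
  The traces below are real. As the logarithm is operator monotone, the limit exists, possibly
  \<open>-\<infinity>\<close>.
\<close>
definition cond_entropy_rel :: "nat \<Rightarrow> nat \<Rightarrow> complex mat \<Rightarrow> complex mat \<Rightarrow> ereal" where
  "cond_entropy_rel a b \<rho> \<sigma> = Lim (at_right 0) (\<lambda>\<xi>::real. ereal (Re (mat_trace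
     (\<rho> * (kron (1\<^sub>m a) (mat_log (\<sigma> + complex_of_real \<xi> \<cdot>\<^sub>m 1\<^sub>m b)) - mat_log \<rho>)))))"

definition cond_entropy :: "nat \<Rightarrow> nat \<Rightarrow> complex mat \<Rightarrow> ereal" where
  "cond_entropy a b \<rho> = (SUP \<sigma> \<in> states b. cond_entropy_rel a b \<rho> \<sigma>)"

definition min_entropy_rel :: "nat \<Rightarrow> nat \<Rightarrow> complex mat \<Rightarrow> complex mat \<Rightarrow> ereal" where
  "min_entropy_rel a b \<rho> \<sigma> = Sup (ereal `
     {l :: real. psd_mat (a * b) (complex_of_real (2 powr (- l)) \<cdot>\<^sub>m kron (1\<^sub>m a) \<sigma> - \<rho>)})"

definition min_entropy :: "nat \<Rightarrow> nat \<Rightarrow> complex mat \<Rightarrow> ereal" where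
  "min_entropy a b \<rho> = (SUP \<sigma> \<in> states b. min_entropy_rel a b \<rho> \<sigma>)"

definition ket_bra :: "complex vec \<Rightarrow> complex mat" where
  "ket_bra \<psi> = mat (dim_vec \<psi>) (dim_vec \<psi>) (\<lambda>(i, j). \<psi> $ i * cnj (\<psi> $ j))"

text \<open>
  \<open>|\<psi>\<rangle>\<langle>\<psi>|\<close> purifies \<open>\<rho>\<close> with a purifying system of dimension \<open>c\<close>. The vector \<open>\<psi> = 0\<close> is allowed, as
  the purification of \<open>\<rho> = 0\<close>.
\<close>
definition purifies :: "nat \<Rightarrow> nat \<Rightarrow> complex vec \<Rightarrow> complex mat \<Rightarrow> bool" where
  "purifies d c \<psi> \<rho> \<longleftrightarrow>
     c > 0 \<and> \<psi> \<in> carrier_vec (d * c) \<and> ptrace_mid d c 1 (ket_bra \<psi>) = \<rho>"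

text \<open>All purifications give the same value, which makes the definite description meaningful.\<close>
definition max_entropy :: "nat \<Rightarrow> nat \<Rightarrow> complex mat \<Rightarrow> ereal" where
  "max_entropy a b \<rho> = (THE h. \<exists>c \<psi>. purifies (a * b) c \<psi> \<rho> \<and>
     h = - min_entropy a c (ptrace_mid a b c (ket_bra \<psi>)))"

definition fidelity :: "complex mat \<Rightarrow> complex mat \<Rightarrow> real" where
  "fidelity \<rho> \<tau> = Re (mat_trace (mat_abs (mat_sqrt \<rho> * mat_sqrt \<tau>)))"

definition C_dist :: "complex mat \<Rightarrow> complex mat \<Rightarrow> real" where
  "C_dist \<rho> \<tau> = sqrt (1 - (fidelity \<rho> \<tau>)\<^sup>2)"

definition eps_ball :: "nat \<Rightarrow> real \<Rightarrow> complex mat \<Rightarrow> complex mat set" where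
  "eps_ball d \<epsilon> \<rho> = {\<tau> \<in> substates d. C_dist \<rho> \<tau> \<le> \<epsilon>}"

definition smooth_min_entropy :: "nat \<Rightarrow> nat \<Rightarrow> real \<Rightarrow> complex mat \<Rightarrow> ereal" where
  "smooth_min_entropy a b \<epsilon> \<rho> = (SUP \<tau> \<in> eps_ball (a * b) \<epsilon> \<rho>. min_entropy a b \<tau>)"

definition smooth_max_entropy :: "nat \<Rightarrow> nat \<Rightarrow> real \<Rightarrow> complex mat \<Rightarrow> ereal" where
  "smooth_max_entropy a b \<epsilon> \<rho> = (INF \<tau> \<in> eps_ball (a * b) \<epsilon> \<rho>. max_entropy a b \<tau>)"

text \<open>
  Reordering of tensor factors \<open>(A \<otimes> B) \<otimes> (A' \<otimes> B') \<rightarrow> (A \<otimes> A') \<otimes> (B \<otimes> B')\<close>, where the four factors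
  have dimensions \<open>a, b, a', b'\<close>: \<open>regroup_index\<close> sends the index of a product basis vector in the
  new order to its index in the old order.
\<close>
definition regroup_index :: "nat \<Rightarrow> nat \<Rightarrow> nat \<Rightarrow> nat \<Rightarrow> nat" where
  "regroup_index b a' b' i =
     (let k = i div (b * b'); l = i mod (b * b')
      in ((k div a') * b + l div b') * (a' * b') + ((k mod a') * b' + l mod b'))"

definition regroup :: "nat \<Rightarrow> nat \<Rightarrow> nat \<Rightarrow> nat \<Rightarrow> complex mat \<Rightarrow> complex mat" where
  "regroup a b a' b' M = mat (a * a' * (b * b')) (a * a' * (b * b'))
     (\<lambda>(i, j). M $$ (regroup_index b a' b' i, regroup_index b a' b' j))"

text \<open>\<open>\<rho>\<^bsup>\<otimes>n\<^esup>\<close> as a bipartite operator on \<open>A\<^bsup>\<otimes>n\<^esup> \<otimes> B\<^bsup>\<otimes>n\<^esup>\<close>, of subsystem dimensions \<open>a\<^sup>n\<close> and \<open>b\<^sup>n\<close>.\<close>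
fun iid_state :: "nat \<Rightarrow> nat \<Rightarrow> complex mat \<Rightarrow> nat \<Rightarrow> complex mat" where
  "iid_state a b \<rho> 0 = 1\<^sub>m 1"
| "iid_state a b \<rho> (Suc n) = regroup a b (a ^ n) (b ^ n) (kron \<rho> (iid_state a b \<rho> n))"

end

theory Submission
  imports Defs "HOL-Analysis.L2_Norm"
begin

text \<open>
  Diagonalize \<open>\<rho>\<close> and \<open>\<beta> = \<rho>\<^sub>B\<close>; let \<open>P\<close> and \<open>Q\<close> be the spectral projections of the \<open>n\<close>-fold states onto their
  typical eigenvalues, \<open>2\<close> to the power \<open>-n (H(AB) \<plusminus> \<delta>)\<close> and \<open>-n (H(B) \<plusminus> \<delta>)\<close>, and put \<open>R = \<one> \<otimes> Q\<close>.
  By Chebyshev's inequality \<open>\<surd>\<rho> P R\<close> is close to \<open>\<surd>\<rho>\<close> in Hilbert--Schmidt norm.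
  The single operator \<open>\<tau> = R P \<rho> P R\<close> achieves both entropies: \<open>\<tau>\<close> is at most
  (largest typical eigenvalue of \<open>\<rho>\<close>) \<open>R\<close>, hence at most a multiple of \<open>\<one> \<otimes> \<beta>\<close>; and in the Schmidt
  basis \<open>P\<close> becomes a projection on the purifying system \<open>C\<close> while \<open>Q\<close> bounds the norm of \<open>\<tau>\<^sub>A\<^sub>C\<close>, so \<open>\<tau>\<^sub>A\<^sub>C\<close> is at most a
  multiple of \<open>\<one> \<otimes> \<rho>\<^sub>C\<close>. Conversely, every \<open>\<tau>\<close> in the ball satisfies
  \<open>\<surd>(1 - \<epsilon>\<^sup>2) \<le> F(\<rho>, \<tau>) \<le> 2 \<surd>\<eta> + \<bar>tr (W \<surd>\<rho> P R \<surd>\<tau>)\<bar>\<close> with a contraction \<open>W\<close>, and the last trace is bounded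
  by the Cauchy--Schwarz inequality through \<open>\<tau> \<le> s \<one> \<otimes> \<omega>\<close>, respectively \<open>\<tau>\<^sub>A\<^sub>C \<le> s \<one> \<otimes> \<sigma>\<close>.
  This gives the same limit for every fixed \<open>\<epsilon> < 1\<close>.
\<close>

subsection \<open>Matrix algebra, trace and Hilbert--Schmidt norm\<close>

text \<open>The projections \<open>P\<close> and \<open>R\<close> need not commute, which fixes the
  order of the factors in \<tau>: \<open>P\<close> stands next to \<rho>, since it has to commute
  with the square root of \<rho> in order to be moved to the purifying system, and \<open>R\<close>
  stands outside, so that bounding \<open>P * \<rho> * P\<close> by a scalar leaves a multiple of
  \<open>R\<close>, which is comparable with the marginal. Each bound costs only a ratio of opposite
  window edges, one for \<rho> and one for its marginal on B, so its exponent is n times a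
  difference of entropies up to 2 n \<delta>. In the converse the overlap left after smoothing is a
  constant factor, whose logarithm disappears after division by n; hence every fixed \<epsilon> < 1
  works. Typicality is carried by two numbers only, the mean and the variance of the logarithm of an
  eigenvalue. Both add up under tensor products, so the n-fold spectrum never has to be described.
  The rate appears as H(AB) - H(B). Matching it with the conditional entropy, which is defined as a
  supremum of limits, is a separate task, solved by Klein's inequality.\<close>

abbreviation adj :: "complex mat \<Rightarrow> complex mat" where "adj \<equiv> mat_adjoint"

text \<open>The square of the Hilbert--Schmidt norm; keeping the square makes it equal to a trace
  without roots.\<close>

definition fro :: "complex mat \<Rightarrow> real" where
  "fro A = (\<Sum>i<dim_row A. \<Sum>j<dim_col A. (cmod (A $$ (i, j)))\<^sup>2)"

lemma adj_dim [simp]: "dim_row (adj A) = dim_col A" "dim_col (adj A) = dim_row A"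
  by (auto simp: mat_adjoint_def)

lemma adj_carrier [simp]: "A \<in> carrier_mat m k \<Longrightarrow> adj A \<in> carrier_mat k m"
  by (auto intro!: carrier_matI)

lemma adj_index [simp]:
  "i < dim_col A \<Longrightarrow> j < dim_row A \<Longrightarrow> adj A $$ (i, j) = cnj (A $$ (j, i))"
  by (simp add: mat_adjoint_def mat_of_rows_index)

lemma adj_adj [simp]: "adj (adj A) = A"
  by (rule eq_matI) auto

lemma mult_index:
  "i < dim_row A \<Longrightarrow> j < dim_col B \<Longrightarrow> dim_col A = dim_row B \<Longrightarrow>
    (A * B) $$ (i, j) = (\<Sum>k<dim_row B. A $$ (i, k) * B $$ (k, j))"
  by (auto simp: scalar_prod_def lessThan_atLeast0 intro!: sum.cong)

lemma adj_mult: "dim_col A = dim_row B \<Longrightarrow> adj (A * B) = adj B * adj A"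
  by (rule eq_matI) (auto simp: mult_index mult.commute simp del: index_mult_mat(1))

lemma adj_minus: "dim_row A = dim_row B \<Longrightarrow> dim_col A = dim_col B \<Longrightarrow> adj (A - B) = adj A - adj B"
  by (rule eq_matI) auto

lemma adj_add: "dim_row A = dim_row B \<Longrightarrow> dim_col A = dim_col B \<Longrightarrow> adj (A + B) = adj A + adj B"
  by (rule eq_matI) auto

lemma adj_smult: "adj (c \<cdot>\<^sub>m A) = cnj c \<cdot>\<^sub>m adj A"
  by (rule eq_matI) auto

lemma adj_one [simp]: "adj (1\<^sub>m n) = 1\<^sub>m n"
  by (rule eq_matI) auto

lemma mat_diag_dims [simp]: "dim_row (mat_diag n f) = n" "dim_col (mat_diag n f) = n"
  by (auto simp: mat_diag_def)

lemma mat_diag_index: "i < n \<Longrightarrow> j < n \<Longrightarrow> mat_diag n f $$ (i, j) = (if i = j then f j else 0)"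
  by (auto simp: mat_diag_def)

lemma adj_mat_diag [simp]: "adj (mat_diag n (\<lambda>i. complex_of_real (f i))) = mat_diag n (\<lambda>i. complex_of_real (f i))"
  by (rule eq_matI) (auto simp: mat_diag_index)

lemma mm_assoc: "dim_col A = dim_row B \<Longrightarrow> dim_col B = dim_row C \<Longrightarrow> (A * B) * C = A * (B * (C :: complex mat))"
  by (rule assoc_mult_mat) auto

lemma mm_minus_left:
  "dim_row A = dim_row B \<Longrightarrow> dim_col A = dim_col B \<Longrightarrow> dim_col B = dim_row C \<Longrightarrow>
    (A - B) * C = A * C - B * (C :: complex mat)"
  by (rule minus_mult_distrib_mat) auto

lemma mm_minus_right:
  "dim_row A = dim_row B \<Longrightarrow> dim_col A = dim_col B \<Longrightarrow> dim_col C = dim_row B \<Longrightarrow>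
    C * (A - B) = C * A - C * (B :: complex mat)"
  by (rule mult_minus_distrib_mat) auto

lemma mm_add_left:
  "dim_row A = dim_row B \<Longrightarrow> dim_col A = dim_col B \<Longrightarrow> dim_col B = dim_row C \<Longrightarrow>
    (A + B) * C = A * C + B * (C :: complex mat)"
  by (rule add_mult_distrib_mat) auto

lemma mm_add_right:
  "dim_row A = dim_row B \<Longrightarrow> dim_col A = dim_col B \<Longrightarrow> dim_col C = dim_row B \<Longrightarrow>
    C * (A + B) = C * A + C * (B :: complex mat)"
  by (rule mult_add_distrib_mat) auto

lemma mm_smult_left: "dim_col A = dim_row B \<Longrightarrow> (c \<cdot>\<^sub>m A) * B = c \<cdot>\<^sub>m (A * (B :: complex mat))"
  by (rule mult_smult_assoc_mat) auto

lemma mm_smult_right: "dim_col A = dim_row B \<Longrightarrow> A * (c \<cdot>\<^sub>m B) = c \<cdot>\<^sub>m (A * (B :: complex mat))"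
  by (rule mult_smult_distrib) auto

lemma mm_one_left: "dim_row A = n \<Longrightarrow> 1\<^sub>m n * A = (A :: complex mat)"
  by (rule left_mult_one_mat) auto

lemma mm_one_right: "dim_col A = n \<Longrightarrow> A * 1\<^sub>m n = (A :: complex mat)"
  by (rule right_mult_one_mat) auto

lemmas mat_alg = mm_assoc mm_minus_left mm_minus_right mm_add_left mm_add_right
  mm_smult_left mm_smult_right mm_one_left mm_one_right adj_mult adj_minus adj_add adj_smult

lemma tr_mult:
  "dim_col A = dim_row B \<Longrightarrow> dim_row A = dim_col B \<Longrightarrow>
    mat_trace (A * B) = (\<Sum>i<dim_row A. \<Sum>k<dim_row B. A $$ (i, k) * B $$ (k, i))"
  unfolding mat_trace_def by (auto simp: mult_index simp del: index_mult_mat(1) intro!: sum.cong)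

lemma tr_comm:
  assumes "dim_col A = dim_row B" "dim_row A = dim_col B"
  shows "mat_trace (A * B) = mat_trace (B * A)"
  unfolding tr_mult[OF assms] tr_mult[OF assms(2)[symmetric] assms(1)[symmetric]]
  by (subst sum.swap) (simp add: assms mult.commute)

lemma tr_minus:
  "dim_row A = dim_row B \<Longrightarrow> dim_col A = dim_col B \<Longrightarrow> dim_row B = dim_col B \<Longrightarrow>
    mat_trace (A - B) = mat_trace A - mat_trace B"
  by (auto simp: mat_trace_def sum_subtractf)

lemma tr_add:
  "dim_row A = dim_row B \<Longrightarrow> dim_col A = dim_col B \<Longrightarrow> dim_row B = dim_col B \<Longrightarrow>
    mat_trace (A + B) = mat_trace A + mat_trace B"
  by (auto simp: mat_trace_def sum.distrib)

lemma tr_smult: "dim_row A = dim_col A \<Longrightarrow> mat_trace (c \<cdot>\<^sub>m A) = c * mat_trace A"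
  by (auto simp: mat_trace_def sum_distrib_left)

lemma tr_adj: "dim_row A = dim_col A \<Longrightarrow> mat_trace (adj A) = cnj (mat_trace A)"
  by (auto simp: mat_trace_def)

lemma fro_nonneg [simp]: "0 \<le> fro A"
  by (auto simp: fro_def intro!: sum_nonneg)

lemma fro_adj [simp]: "fro (adj A) = fro A"
  unfolding fro_def by (subst sum.swap) auto

lemma tr_adj_mult_self: "mat_trace (adj A * A) = complex_of_real (fro A)"
  by (subst tr_mult)
     (auto simp: fro_def complex_norm_square mult.commute sum.swap[of _ "{..<dim_col A}"]
       simp del: of_real_power)

lemma tr_mult_adj_self: "mat_trace (A * adj A) = complex_of_real (fro A)"
  using tr_adj_mult_self[of "adj A"] by simp


text \<open>The trace is the inner product of the two coefficient families over index pairs, so this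
  is Cauchy--Schwarz for \<open>L2_set\<close>.\<close>

lemma tr_cauchy_schwarz:
  assumes "dim_row A = dim_row B" "dim_col A = dim_col B"
  shows "(cmod (mat_trace (adj A * B)))\<^sup>2 \<le> fro A * fro B"
proof -
  let ?I = "{..<dim_row A} \<times> {..<dim_col A}"
  have "mat_trace (adj A * B) = (\<Sum>(i,j)\<in>?I. cnj (A $$ (i, j)) * B $$ (i, j))"
  proof -
    have "mat_trace (adj A * B) = (\<Sum>i<dim_col A. \<Sum>k<dim_row A. cnj (A $$ (k, i)) * B $$ (k, i))"
      using assms by (subst tr_mult) auto
    also have "\<dots> = (\<Sum>k<dim_row A. \<Sum>i<dim_col A. cnj (A $$ (k, i)) * B $$ (k, i))"
      by (rule sum.swap)
    finally show ?thesis by (simp add: sum.cartesian_product)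
  qed
  also have "cmod \<dots> \<le> (\<Sum>(i,j)\<in>?I. cmod (A $$ (i, j)) * cmod (B $$ (i, j)))"
    by (rule order.trans[OF norm_sum]) (auto simp: norm_mult intro!: sum_mono)
  finally have "(cmod (mat_trace (adj A * B)))\<^sup>2 \<le> (\<Sum>(i,j)\<in>?I. cmod (A $$ (i, j)) * cmod (B $$ (i, j)))\<^sup>2"
    by (rule power_mono) simp
  also have "\<dots> = (\<Sum>p\<in>?I. cmod (A $$ p) * cmod (B $$ p))\<^sup>2"
    by (simp add: case_prod_beta)
  also have "\<dots> \<le> (\<Sum>p\<in>?I. (cmod (A $$ p))\<^sup>2) * (\<Sum>p\<in>?I. (cmod (B $$ p))\<^sup>2)"
  proof -
    have "(\<Sum>p\<in>?I. cmod (A $$ p) * cmod (B $$ p)) \<le> L2_set (\<lambda>p. cmod (A $$ p)) ?I * L2_set (\<lambda>p. cmod (B $$ p)) ?I"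
      using L2_set_mult_ineq[of "\<lambda>p. cmod (A $$ p)" "\<lambda>p. cmod (B $$ p)" ?I] by simp
    then have "(\<Sum>p\<in>?I. cmod (A $$ p) * cmod (B $$ p))\<^sup>2 \<le> (L2_set (\<lambda>p. cmod (A $$ p)) ?I * L2_set (\<lambda>p. cmod (B $$ p)) ?I)\<^sup>2"
      by (intro power_mono sum_nonneg) auto
    then show ?thesis by (simp add: power_mult_distrib L2_set_def sum_nonneg)
  qed
  also have "\<dots> = fro A * fro B"
    by (simp add: fro_def sum.cartesian_product assms case_prod_beta)
  finally show ?thesis .
qed

lemma tr_cauchy_schwarz':
  assumes "dim_row A = dim_col B" "dim_col A = dim_row B"
  shows "cmod (mat_trace (A * B)) \<le> sqrt (fro A) * sqrt (fro B)"
proof -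
  have "(cmod (mat_trace (adj (adj A) * B)))\<^sup>2 \<le> fro (adj A) * fro B"
    by (rule tr_cauchy_schwarz) (auto simp: assms)
  then show ?thesis
    by (simp add: real_sqrt_mult[symmetric] real_le_rsqrt)
qed

lemma fro_trace: "fro A = Re (mat_trace (adj A * A))" "fro A = Re (mat_trace (A * adj A))"
  by (simp_all add: tr_adj_mult_self tr_mult_adj_self)

lemma fro_triangle:
  assumes "dim_row A = dim_row B" "dim_col A = dim_col B"
  shows "sqrt (fro (A + B)) \<le> sqrt (fro A) + sqrt (fro B)"
proof -
  have c: "cmod (mat_trace (adj A * B)) \<le> sqrt (fro A) * sqrt (fro B)"
    using tr_cauchy_schwarz'[of "adj A" B] assms by simp
  have d: "mat_trace (adj B * A) = cnj (mat_trace (adj A * B))"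
    using tr_adj[of "adj A * B"] assms by (simp add: adj_mult)
  have "fro (A + B) = fro A + fro B + 2 * Re (mat_trace (adj A * B))"
    by (subst fro_trace) (simp add: assms mat_alg tr_add tr_adj_mult_self d)
  also have "\<dots> \<le> fro A + fro B + 2 * (sqrt (fro A) * sqrt (fro B))"
    using c complex_Re_le_cmod[of "mat_trace (adj A * B)"] by linarith
  also have "\<dots> = (sqrt (fro A) + sqrt (fro B))\<^sup>2"
    by (simp add: power2_sum)
  finally show ?thesis by (simp add: real_le_lsqrt)
qed

subsection \<open>Positive semidefinite matrices\<close>

text \<open>Turns quadratic forms into traces. Positivity can then be tested on a whole matrix
  \<open>V\<close> of columns at once, and all later order arguments stay inside matrix
  algebra.\<close>

lemma qf_trace:
  assumes "M \<in> carrier_mat d d" "V \<in> carrier_mat d k"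
  shows "mat_trace (adj V * M * V) = (\<Sum>j<k. (M *\<^sub>v col V j) \<bullet>c col V j)"
proof -
  have "mat_trace (adj V * M * V) = mat_trace (adj V * (M * V))"
    using assms by (simp add: mm_assoc)
  also have "\<dots> = (\<Sum>j<k. \<Sum>i<d. cnj (V $$ (i, j)) * (M * V) $$ (i, j))"
    using assms by (subst tr_mult) (auto intro!: sum.cong simp del: index_mult_mat(1))
  also have "\<dots> = (\<Sum>j<k. (M *\<^sub>v col V j) \<bullet>c col V j)"
    using assms by (auto simp: scalar_prod_def lessThan_atLeast0 mult.commute intro!: sum.cong)
  finally show ?thesis .
qed

lemma psd_matD:
  assumes "psd_mat d M" "V \<in> carrier_mat d k"
  shows "0 \<le> Re (mat_trace (adj V * M * V))"
  using assms by (subst qf_trace[of _ d _ k]) (auto simp: psd_mat_def intro!: sum_nonneg)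

lemma psd_matI:
  assumes "M \<in> carrier_mat d d" "adj M = M"
    "\<And>V. V \<in> carrier_mat d 1 \<Longrightarrow> 0 \<le> Re (mat_trace (adj V * M * V))"
  shows "psd_mat d M"
  unfolding psd_mat_def
proof (intro conjI ballI)
  fix v :: "complex vec" assume v: "v \<in> carrier_vec d"
  have V: "mat_of_cols d [v] \<in> carrier_mat d 1" by (auto simp: mat_of_cols_def)
  have "col (mat_of_cols d [v]) 0 = v" using v by (auto simp: mat_of_cols_def)
  then show "0 \<le> Re ((M *\<^sub>v v) \<bullet>c v)"
    using assms(3)[OF V] unfolding qf_trace[OF assms(1) V] by simp
qed (use assms in auto)

lemma psd_carrier: "psd_mat d M \<Longrightarrow> M \<in> carrier_mat d d"
  and psd_dims: "psd_mat d M \<Longrightarrow> dim_row M = d" "psd_mat d M \<Longrightarrow> dim_col M = d"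
  and psd_adj: "psd_mat d M \<Longrightarrow> adj M = M"
  by (auto simp: psd_mat_def)

lemma psd_mult_adj:
  assumes "X \<in> carrier_mat d k" shows "psd_mat d (X * adj X)"
proof (rule psd_matI)
  fix V :: "complex mat" assume V: "V \<in> carrier_mat d 1"
  have "adj V * (X * adj X) * V = adj (adj X * V) * (adj X * V)"
    using V assms by (simp add: mat_alg)
  then show "0 \<le> Re (mat_trace (adj V * (X * adj X) * V))"
    by (simp add: tr_adj_mult_self)
qed (use assms in \<open>auto simp: mat_alg\<close>)

lemma psd_adj_mult: "X \<in> carrier_mat k d \<Longrightarrow> psd_mat d (adj X * X)"
  using psd_mult_adj[of "adj X" d k] by simp

lemma psd_conj:
  assumes "psd_mat d A" "X \<in> carrier_mat m d" shows "psd_mat m (X * A * adj X)"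
proof (rule psd_matI)
  note [simp] = psd_dims[OF assms(1)] psd_adj[OF assms(1)]
  show "X * A * adj X \<in> carrier_mat m m" "adj (X * A * adj X) = X * A * adj X"
    using assms(2) by (auto simp: mat_alg)
  fix V :: "complex mat" assume V: "V \<in> carrier_mat m 1"
  have "adj V * (X * A * adj X) * V = adj (adj X * V) * A * (adj X * V)"
    using V assms(2) by (simp add: mat_alg)
  then show "0 \<le> Re (mat_trace (adj V * (X * A * adj X) * V))"
    using psd_matD[OF assms(1) mult_carrier_mat[OF adj_carrier[OF assms(2)] V]] by simp
qed

lemma psd_add: "psd_mat d A \<Longrightarrow> psd_mat d B \<Longrightarrow> psd_mat d (A + B)"
proof (rule psd_matI)
  assume A: "psd_mat d A" and B: "psd_mat d B"
  note [simp] = psd_dims[OF A] psd_adj[OF A] psd_dims[OF B] psd_adj[OF B]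
  show "A + B \<in> carrier_mat d d" "adj (A + B) = A + B" by (auto simp: mat_alg)
  fix V :: "complex mat" assume V: "V \<in> carrier_mat d 1"
  show "0 \<le> Re (mat_trace (adj V * (A + B) * V))"
    using psd_matD[OF A V] psd_matD[OF B V] V by (simp add: mat_alg tr_add)
qed

lemma psd_smult: "psd_mat d A \<Longrightarrow> 0 \<le> r \<Longrightarrow> psd_mat d (complex_of_real r \<cdot>\<^sub>m A)"
proof (rule psd_matI)
  assume A: "psd_mat d A" and r: "0 \<le> r"
  note [simp] = psd_dims[OF A] psd_adj[OF A]
  show "complex_of_real r \<cdot>\<^sub>m A \<in> carrier_mat d d"
    "adj (complex_of_real r \<cdot>\<^sub>m A) = complex_of_real r \<cdot>\<^sub>m A" by (auto simp: mat_alg)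
  fix V :: "complex mat" assume V: "V \<in> carrier_mat d 1"
  show "0 \<le> Re (mat_trace (adj V * (complex_of_real r \<cdot>\<^sub>m A) * V))"
    using psd_matD[OF A V] V r by (simp add: mat_alg tr_smult)
qed

lemma psd_diag: "(\<And>i. i < n \<Longrightarrow> 0 \<le> f i) \<Longrightarrow> psd_mat n (mat_diag n (\<lambda>i. complex_of_real (f i)))"
proof -
  assume f: "\<And>i. i < n \<Longrightarrow> 0 \<le> f i"
  let ?D = "mat_diag n (\<lambda>i. complex_of_real (sqrt (f i)))"
  have "mat_diag n (\<lambda>i. complex_of_real (f i)) = ?D * adj ?D"
    by (rule eq_matI)
      (auto simp: mat_diag_index f simp flip: of_real_mult)
  then show ?thesis using psd_mult_adj[of ?D n n] by simp
qed

lemma psd_one: "psd_mat n (1\<^sub>m n)"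
  using psd_diag[of n "\<lambda>_. 1"] by simp


section \<open>Contractions\<close>

definition contr :: "nat \<Rightarrow> nat \<Rightarrow> complex mat \<Rightarrow> bool" where
  "contr m k X \<longleftrightarrow> X \<in> carrier_mat m k \<and> psd_mat k (1\<^sub>m k - adj X * X)"

text \<open>With \<open>W = adj G * V\<close>, Cauchy--Schwarz bounds the squared norm of
  \<open>W\<close> by the norms of \<open>V\<close> and \<open>G * W\<close>, and the hypothesis
  bounds the latter by that of \<open>W\<close>; one factor cancels. Besides adjoints of
  contractions, this later carries a bound from the system B over to its complement AC.\<close>

lemma psd_flip:
  assumes G: "G \<in> carrier_mat m k" and q: "0 \<le> q"
    and p: "psd_mat k (complex_of_real q \<cdot>\<^sub>m 1\<^sub>m k - adj G * G)"
  shows "psd_mat m (complex_of_real q \<cdot>\<^sub>m 1\<^sub>m m - G * adj G)"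
proof (rule psd_matI)
  show "complex_of_real q \<cdot>\<^sub>m 1\<^sub>m m - G * adj G \<in> carrier_mat m m"
    "adj (complex_of_real q \<cdot>\<^sub>m 1\<^sub>m m - G * adj G) = complex_of_real q \<cdot>\<^sub>m 1\<^sub>m m - G * adj G"
    using G by (auto simp: mat_alg)
  fix V :: "complex mat" assume V: "V \<in> carrier_mat m 1"
  let ?W = "adj G * V"
  have W: "?W \<in> carrier_mat k 1" using G V by auto
  have 1: "adj ?W * (complex_of_real q \<cdot>\<^sub>m 1\<^sub>m k - adj G * G) * ?W
      = complex_of_real q \<cdot>\<^sub>m (adj ?W * ?W) - adj (G * ?W) * (G * ?W)"
    using G V by (simp add: mat_alg)
  have 2: "fro (G * ?W) \<le> q * fro ?W"
    using psd_matD[OF p W] unfolding 1 using G V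
    by (simp add: tr_minus tr_smult tr_adj_mult_self)
  have "mat_trace (adj V * (G * ?W)) = mat_trace (adj ?W * ?W)"
    using G V by (simp add: mat_alg)
  then have "(fro ?W)\<^sup>2 \<le> fro V * fro (G * ?W)"
    using tr_cauchy_schwarz[of V "G * ?W"] G V by (simp add: tr_adj_mult_self)
  also have "\<dots> \<le> fro V * (q * fro ?W)" using 2 by (intro mult_left_mono) auto
  finally have "fro ?W * fro ?W \<le> (q * fro V) * fro ?W" by (simp add: power2_eq_square mult_ac)
  then have 3: "fro ?W \<le> q * fro V"
  proof (cases "fro ?W = 0")
    case False
    then have "0 < fro ?W" using fro_nonneg[of ?W] by linarith
    then show ?thesis using \<open>fro ?W * fro ?W \<le> _\<close> by (simp only: mult_le_cancel_right_pos)
  qed (use q in simp)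
  have "adj V * (complex_of_real q \<cdot>\<^sub>m 1\<^sub>m m - G * adj G) * V = complex_of_real q \<cdot>\<^sub>m (adj V * V) - adj ?W * ?W"
    using G V by (simp add: mat_alg)
  then show "0 \<le> Re (mat_trace (adj V * (complex_of_real q \<cdot>\<^sub>m 1\<^sub>m m - G * adj G) * V))"
    using 3 G V by (simp add: tr_minus tr_smult tr_adj_mult_self)
qed

lemma smult_one: "1 \<cdot>\<^sub>m A = (A :: complex mat)" by (rule eq_matI) auto

lemma contr_adj: "contr m k X \<Longrightarrow> contr k m (adj X)"
  using psd_flip[of X m k 1] by (auto simp: contr_def smult_one)

lemma contr_fro:
  assumes "contr m k X" "B \<in> carrier_mat k l" shows "fro (X * B) \<le> fro B"
proof -
  have X: "X \<in> carrier_mat m k" using assms by (simp add: contr_def)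
  have "adj B * (1\<^sub>m k - adj X * X) * B = adj B * B - adj (X * B) * (X * B)"
    using X assms(2) by (simp add: mat_alg)
  then show ?thesis using psd_matD[of k "1\<^sub>m k - adj X * X" B l] assms X
    by (simp add: contr_def tr_minus tr_adj_mult_self)
qed

lemma contr_fro_right:
  assumes "contr m k X" "B \<in> carrier_mat l m" shows "fro (B * X) \<le> fro B"
proof -
  have "fro (adj X * adj B) \<le> fro (adj B)"
    using assms by (intro contr_fro[of k m _ _ l] contr_adj) auto
  moreover have "adj X * adj B = adj (B * X)" using assms by (auto simp: adj_mult contr_def)
  ultimately show ?thesis by simp
qed

lemma contr_mult:
  assumes "contr m k X" "contr k l Y" shows "contr m l (X * Y)"
  unfolding contr_def
proof (intro conjI psd_matI)
  have [simp]: "X \<in> carrier_mat m k" "Y \<in> carrier_mat k l" using assms by (auto simp: contr_def)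
  note [simp] = carrier_matD[OF \<open>X \<in> carrier_mat m k\<close>] carrier_matD[OF \<open>Y \<in> carrier_mat k l\<close>]
  show "X * Y \<in> carrier_mat m l" "1\<^sub>m l - adj (X * Y) * (X * Y) \<in> carrier_mat l l"
    "adj (1\<^sub>m l - adj (X * Y) * (X * Y)) = 1\<^sub>m l - adj (X * Y) * (X * Y)" by (auto simp: mat_alg)
  fix V :: "complex mat" assume V: "V \<in> carrier_mat l 1"
  have "fro (X * (Y * V)) \<le> fro (Y * V)" "fro (Y * V) \<le> fro V"
    using contr_fro[OF assms(1) mult_carrier_mat[OF _ V]] contr_fro[OF assms(2) V] by auto
  moreover have "adj V * (1\<^sub>m l - adj (X * Y) * (X * Y)) * V = adj V * V - adj (X * (Y * V)) * (X * (Y * V))"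
    using V by (simp add: mat_alg)
  ultimately show "0 \<le> Re (mat_trace (adj V * (1\<^sub>m l - adj (X * Y) * (X * Y)) * V))"
    using V by (simp add: tr_minus tr_adj_mult_self)
qed

text \<open>Such an \<open>X\<close> is a partial isometry: the complement of the projection
  \<open>X * adj X\<close> is a projection as well, hence positive, so \<open>adj X\<close> is a
  contraction.\<close>

lemma contr_projection:
  assumes "X \<in> carrier_mat m k" "X * adj X * (X * adj X) = X * adj X"
  shows "contr m k X"
proof -
  let ?Q = "1\<^sub>m m - X * adj X"
  have a: "dim_row X = m" "dim_col X = k" using assms(1) by auto
  have b: "X * (adj X * (X * adj X)) = X * adj X"
    using assms(2) a by (simp add: mm_assoc)
  have "?Q = ?Q * adj ?Q" using a
    by (simp add: mat_alg b) (rule eq_matI, auto)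
  then have "psd_mat m ?Q" using psd_mult_adj[of ?Q m m] a by (metis adj_dim carrier_matI index_minus_mat(2,3) index_mult_mat(2,3))
  then have "contr k m (adj X)" using assms(1) by (simp add: contr_def)
  then show ?thesis using contr_adj by fastforce
qed

subsection \<open>Spectral theorem, polar decomposition and fidelity\<close>

lemma unitary_matD:
  assumes "unitary_mat n U"
  shows "U \<in> carrier_mat n n" "dim_row U = n" "dim_col U = n" "adj U * U = 1\<^sub>m n" "U * adj U = 1\<^sub>m n"
  using assms by (auto simp: unitary_mat_def)

lemma unitary_mult_cancel:
  assumes "unitary_mat n U" "dim_row A = n"
  shows "U * (adj U * A) = A" "adj U * (U * A) = A"
proof -
  note u = unitary_matD[OF assms(1)]
  have "U * (adj U * A) = (U * adj U) * A" using u(2,3) assms(2) by (simp only: mm_assoc adj_dim)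
  then show "U * (adj U * A) = A" using u(5) assms(2) by (simp add: mm_one_left)
  have "adj U * (U * A) = (adj U * U) * A" using u(2,3) assms(2) by (simp only: mm_assoc adj_dim)
  then show "adj U * (U * A) = A" using u(4) assms(2) by (simp add: mm_one_left)
qed

lemma unitary_mult:
  assumes "unitary_mat n U" "unitary_mat n V" shows "unitary_mat n (U * V)"
proof -
  note u = unitary_matD[OF assms(1)] and v = unitary_matD[OF assms(2)]
  have "adj (U * V) * (U * V) = adj V * (adj U * (U * V))" "U * V * adj (U * V) = U * (V * (adj V * adj U))"
    using u(2,3) v(2,3) by (simp_all only: adj_mult mm_assoc adj_dim index_mult_mat)
  moreover have "adj U * (U * V) = V" "V * (adj V * adj U) = adj U"
    using u(2,3) v(2,3) by (simp_all add: unitary_mult_cancel[OF assms(1)] unitary_mult_cancel[OF assms(2)])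
  ultimately show ?thesis using u v by (auto simp: unitary_mat_def)
qed

lemma adj_four_block:
  assumes "A \<in> carrier_mat p q" "B \<in> carrier_mat p r" "C \<in> carrier_mat s q" "D \<in> carrier_mat s r"
  shows "adj (four_block_mat A B C D) = four_block_mat (adj A) (adj C) (adj B) (adj D)"
  using assms by (intro eq_matI) (auto simp: carrier_matD)

text \<open>The characteristic polynomial has a root over the complex numbers; an eigenvector is
  completed to a basis and orthogonalized by Gram--Schmidt, which keeps the first vector.\<close>

lemma unitary_with_eigenvector:
  assumes A: "A \<in> carrier_mat (Suc n) (Suc n)"
  obtains U e where "unitary_mat (Suc n) U" "\<And>i. i < Suc n \<Longrightarrow> (A * U) $$ (i, 0) = e * U $$ (i, 0)"
proof -
  let ?N = "Suc n"
  obtain as where as: "char_poly A = (\<Prod>a\<leftarrow>as. [:- a, 1:])" "length as = ?N"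
    using char_poly_factorized[OF A] by auto
  then obtain e es where "as = e # es" by (cases as) auto
  then have "poly (char_poly A) e = 0" using as by simp
  then have "eigenvalue A e" using eigenvalue_root_char_poly[OF A] by simp
  then obtain v where "eigenvector A v e" by (auto simp: eigenvalue_def)
  then have v: "v \<in> carrier_vec ?N" "v \<noteq> 0\<^sub>v ?N" and Av: "A *\<^sub>v v = e \<cdot>\<^sub>v v"
    using A by (auto simp: eigenvector_def)
  interpret cof_vec_space ?N "TYPE(complex)" .
  define b where "b = basis_completion v"
  define ws where "ws = gram_schmidt ?N b"
  define W where "W = mat_of_cols ?N ws"
  note bc = basis_completion[OF v, folded b_def]
  obtain vs where bv: "b = v # vs" using bc(6,7) by (cases b) auto
  have ws: "set ws \<subseteq> carrier_vec ?N" "corthogonal ws" "length ws = ?N"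
    using gram_schmidt_result[OF bc(2) bc(4) bc(5) refl, folded ws_def] bc(6) by auto
  have hdws: "hd ws = v" using gram_schmidt_hd[OF v(1), of vs, folded bv] by (simp add: ws_def)
  have W: "W \<in> carrier_mat ?N ?N" using ws(3) mat_of_cols_carrier(1)[of ?N ws] by (simp only: W_def)
  have "corthogonal_mat W" unfolding W_def by (rule orthogonal_mat_of_cols[OF ws])
  then have dg: "diagonal_mat (adj W * W)" and nz: "\<And>i. i < ?N \<Longrightarrow> (adj W * W) $$ (i, i) \<noteq> 0"
    using W by (auto simp: corthogonal_mat_def Let_def)
  define g where "g i = (\<Sum>k<?N. (cmod (W $$ (k, i)))\<^sup>2)" for i
  have gW: "(adj W * W) $$ (i, i) = complex_of_real (g i)" if "i < ?N" for i
    using W that by (subst mult_index) (auto simp: g_def complex_norm_square mult.commute simp del: of_real_power intro!: sum.cong)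
  have gpos: "0 < g i" if "i < ?N" for i
  proof -
    have "0 \<le> g i" unfolding g_def by (intro sum_nonneg) simp
    moreover have "g i \<noteq> 0" using nz[OF that] gW[OF that] by auto
    ultimately show ?thesis by simp
  qed
  \<comment> \<open>Gram--Schmidt gives orthogonal columns that are not normalized;
    \<open>?D\<close> divides each by its length.\<close>
  let ?D = "mat_diag ?N (\<lambda>i. complex_of_real (1 / sqrt (g i)))"
  define U where "U = W * ?D"
  have U: "U \<in> carrier_mat ?N ?N" using W by (simp add: U_def)
  have WW: "adj W * W = mat_diag ?N (\<lambda>i. complex_of_real (g i))"
    using dg gW W by (intro eq_matI) (auto simp: mat_diag_index diagonal_mat_def simp del: index_mult_mat(1))
  have "adj U * U = ?D * (adj W * W) * ?D"
    using W unfolding U_def by (simp only: adj_mult mm_assoc adj_mat_diag adj_dim mat_diag_dims carrier_matD index_mult_mat)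
  also have "\<dots> = 1\<^sub>m ?N"
    unfolding WW mat_diag_diag
    by (rule eq_matI) (auto simp: mat_diag_index less_imp_le simp flip: of_real_mult dest: gpos)
  finally have UU: "adj U * U = 1\<^sub>m ?N" .
  have un: "unitary_mat ?N U"
    using mat_mult_left_right_inverse[OF _ U UU] UU U by (auto simp: unitary_mat_def)
  have W0: "W $$ (i, 0) = v $ i" if "i < ?N" for i
    using that ws hdws by (cases ws) (auto simp: W_def mat_of_cols_index)
  have U0: "U $$ (i, 0) = v $ i * complex_of_real (1 / sqrt (g 0))" if "i < ?N" for i
    using that W W0 unfolding U_def by (subst mat_diag_mult_right) auto
  have "(A * U) $$ (i, 0) = e * U $$ (i, 0)" if i: "i < ?N" for i
  proof -
    have "(A * U) $$ (i, 0) = (\<Sum>k<?N. A $$ (i, k) * v $ k) * complex_of_real (1 / sqrt (g 0))"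
      using i A U by (subst mult_index) (auto simp: U0 sum_divide_distrib simp del: sum.lessThan_Suc intro!: sum.cong)
    also have "(\<Sum>k<?N. A $$ (i, k) * v $ k) = (A *\<^sub>v v) $ i"
      using i A v by (auto simp: scalar_prod_def lessThan_atLeast0 intro!: sum.cong)
    also have "\<dots> = e * v $ i" using Av i v by simp
    finally show ?thesis using U0[OF i] by simp
  qed
  then show ?thesis using that un by blast
qed

text \<open>Deflation: in a basis starting with an eigenvector the first column is a multiple of the
  first unit vector, by Hermiticity so is the first row, and the induction hypothesis diagonalizes
  the remaining block.\<close>

theorem hermitian_spectral:
  assumes "A \<in> carrier_mat n n" "adj A = A"
  shows "\<exists>U x. unitary_mat n U \<and> A = U * mat_diag n (\<lambda>i. complex_of_real (x i)) * adj U"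
  using assms
proof (induction n arbitrary: A)
  case 0
  then show ?case by (intro exI[of _ "1\<^sub>m 0"] exI[of _ "\<lambda>_. 0"]) (auto simp: unitary_mat_def intro!: eq_matI)
next
  case (Suc n)
  obtain U e where U: "unitary_mat (Suc n) U"
    and Ue: "\<And>i. i < Suc n \<Longrightarrow> (A * U) $$ (i, 0) = e * U $$ (i, 0)"
    using unitary_with_eigenvector[OF Suc.prems(1)] by blast
  note u = unitary_matD[OF U]
  note [simp] = carrier_matD[OF Suc.prems(1)] u(2,3)
  define B where "B = adj U * (A * U)"
  have B[simp]: "B \<in> carrier_mat (Suc n) (Suc n)" "dim_row B = Suc n" "dim_col B = Suc n"
    by (auto simp: B_def)
  have adjB: "adj B = B" by (simp add: B_def mat_alg Suc.prems)
  have B0: "B $$ (i, 0) = (if i = 0 then e else 0)" if i: "i < Suc n" for i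
  proof -
    have "B $$ (i, 0) = (\<Sum>k<Suc n. adj U $$ (i, k) * (e * U $$ (k, 0)))"
      using i unfolding B_def
      by (subst mult_index) (auto simp: Ue simp del: index_mult_mat(1) sum.lessThan_Suc intro!: sum.cong)
    also have "\<dots> = e * (adj U * U) $$ (i, 0)"
      using i by (subst mult_index) (auto simp: sum_distrib_left mult_ac simp del: index_mult_mat(1) sum.lessThan_Suc intro!: sum.cong)
    finally show ?thesis using i by (simp add: u(4))
  qed
  have cB: "B $$ (j, i) = cnj (B $$ (i, j))" if "i < Suc n" "j < Suc n" for i j
    using adj_index[of j B i] that adjB by simp
  \<comment> \<open>The eigenvalue is a diagonal entry of a Hermitian matrix, hence real.\<close>
  have e: "e = complex_of_real (Re e)"
    using cB[of 0 0] B0[of 0] by (simp add: complex_eq_iff)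
  define A3 where "A3 = mat n n (\<lambda>(i,j). B $$ (Suc i, Suc j))"
  have A3: "A3 \<in> carrier_mat n n" by (simp add: A3_def)
  have "adj A3 = A3" by (rule eq_matI) (auto simp: A3_def cB[symmetric])
  then obtain V x where V: "unitary_mat n V"
    and A3V: "A3 = V * mat_diag n (\<lambda>i. complex_of_real (x i)) * adj V"
    using Suc.IH[OF A3] by blast
  note v = unitary_matD[OF V]
  define y where "y i = (case i of 0 \<Rightarrow> Re e | Suc j \<Rightarrow> x j)" for i
  define V' where "V' = four_block_mat (1\<^sub>m 1) (0\<^sub>m 1 n) (0\<^sub>m n 1) V"
  let ?D = "\<lambda>n x. mat_diag n (\<lambda>i. complex_of_real (x i))"
  have adjV': "adj V' = four_block_mat (1\<^sub>m 1) (0\<^sub>m 1 n) (0\<^sub>m n 1) (adj V)"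
    unfolding V'_def using v by (subst adj_four_block) (auto intro!: cong_four_block_mat eq_matI)
  have D: "?D (Suc n) y = four_block_mat (?D 1 (\<lambda>_. Re e)) (0\<^sub>m 1 n) (0\<^sub>m n 1) (?D n x)"
    by (rule eq_matI) (auto simp: mat_diag_index y_def split: nat.splits)
  have "B = four_block_mat (?D 1 (\<lambda>_. Re e)) (0\<^sub>m 1 n) (0\<^sub>m n 1) A3"
  proof (rule eq_matI)
    fix i j assume "i < dim_row (four_block_mat (?D 1 (\<lambda>_. Re e)) (0\<^sub>m 1 n) (0\<^sub>m n 1) A3)"
      "j < dim_col (four_block_mat (?D 1 (\<lambda>_. Re e)) (0\<^sub>m 1 n) (0\<^sub>m n 1) A3)"
    then have i: "i < Suc n" and j: "j < Suc n" by (auto simp: A3_def)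
    show "B $$ (i, j) = four_block_mat (?D 1 (\<lambda>_. Re e)) (0\<^sub>m 1 n) (0\<^sub>m n 1) A3 $$ (i, j)"
      using i j B0[OF i] B0[OF j] cB[OF j, of 0] e
      by (cases i; cases j) (auto simp: A3_def mat_diag_index)
  qed (auto simp: A3_def)
  also have "\<dots> = V' * ?D (Suc n) y * adj V'"
    unfolding D adjV' unfolding V'_def A3V using v
    by (subst mult_four_block_mat[of _ 1 1 _ n _ n _ _ 1 _ n], auto)+
  finally have BV: "B = V' * ?D (Suc n) y * adj V'" .
  have V'u: "unitary_mat (Suc n) V'"
    unfolding unitary_mat_def adjV'
  proof (intro conjI)
    show "V' \<in> carrier_mat (Suc n) (Suc n)"
      using four_block_carrier_mat[of "1\<^sub>m 1" 1 1 V n n] v by (simp add: V'_def)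
    show "four_block_mat (1\<^sub>m 1) (0\<^sub>m 1 n) (0\<^sub>m n 1) (adj V) * V' = 1\<^sub>m (Suc n)"
      unfolding V'_def using v by (subst mult_four_block_mat[of _ 1 1 _ n _ n _ _ 1 _ n]) auto
    show "V' * four_block_mat (1\<^sub>m 1) (0\<^sub>m 1 n) (0\<^sub>m n 1) (adj V) = 1\<^sub>m (Suc n)"
      unfolding V'_def using v by (subst mult_four_block_mat[of _ 1 1 _ n _ n _ _ 1 _ n]) auto
  qed
  have "A = U * (B * adj U)"
    using u by (simp add: B_def mm_assoc unitary_mult_cancel[OF U] mm_one_right)
  also have "\<dots> = (U * V') * ?D (Suc n) y * adj (U * V')"
    using unitary_matD[OF V'u] unfolding BV by (simp add: mat_alg)
  finally show ?case using unitary_mult[OF U V'u] by blast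
qed

text \<open>A real function on the indices of a fixed eigenbasis. Products, differences and order of
  operators diagonal in the same basis become pointwise statements about reals.\<close>

definition spec :: "nat \<Rightarrow> complex mat \<Rightarrow> (nat \<Rightarrow> real) \<Rightarrow> complex mat" where
  "spec n U x = U * mat_diag n (\<lambda>i. complex_of_real (x i)) * adj U"

lemma spec_carrier: "unitary_mat n U \<Longrightarrow> spec n U x \<in> carrier_mat n n"
  by (auto simp: spec_def unitary_matD)

lemma spec_dims [simp]: "unitary_mat n U \<Longrightarrow> dim_row (spec n U x) = n" "unitary_mat n U \<Longrightarrow> dim_col (spec n U x) = n"
  by (auto simp: spec_def unitary_matD)


lemma spec_mult:
  assumes "unitary_mat n U" shows "spec n U x * spec n U y = spec n U (\<lambda>i. x i * y i)"
proof -
  let ?D = "\<lambda>x. mat_diag n (\<lambda>i. complex_of_real (x i))"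
  note u = unitary_matD[OF assms]
  have "spec n U x * spec n U y = U * (?D x * (adj U * (U * (?D y * adj U))))"
    using u(2,3) by (simp only: spec_def mm_assoc adj_dim index_mult_mat mat_diag_dims)
  also have "\<dots> = U * (?D x * ?D y * adj U)"
    using u(2,3) by (simp only: unitary_mult_cancel[OF assms] mm_assoc adj_dim index_mult_mat mat_diag_dims)
  finally show ?thesis using u(2,3) by (simp add: spec_def mm_assoc)
qed

lemma spec_adj [simp]: "unitary_mat n U \<Longrightarrow> adj (spec n U x) = spec n U x"
  by (simp add: spec_def mat_alg unitary_matD)

lemma spec_cong: "(\<And>i. i < n \<Longrightarrow> x i = y i) \<Longrightarrow> spec n U x = spec n U y"
proof -
  assume "\<And>i. i < n \<Longrightarrow> x i = y i"
  then have "mat_diag n (\<lambda>i. complex_of_real (x i)) = mat_diag n (\<lambda>i. complex_of_real (y i))"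
    by (intro eq_matI) (auto simp: mat_diag_index)
  then show ?thesis by (simp add: spec_def)
qed

lemma spec_minus:
  assumes "unitary_mat n U" shows "spec n U x - spec n U y = spec n U (\<lambda>i. x i - y i)"
proof -
  have "mat_diag n (\<lambda>i. complex_of_real (x i - y i)) =
      mat_diag n (\<lambda>i. complex_of_real (x i)) - mat_diag n (\<lambda>i. complex_of_real (y i))"
    by (rule eq_matI) (auto simp: mat_diag_index)
  then show ?thesis using unitary_matD[OF assms] by (simp add: spec_def mat_alg)
qed

lemma spec_smult:
  assumes "unitary_mat n U" shows "complex_of_real r \<cdot>\<^sub>m spec n U x = spec n U (\<lambda>i. r * x i)"
proof -
  have "mat_diag n (\<lambda>i. complex_of_real (r * x i)) = complex_of_real r \<cdot>\<^sub>m mat_diag n (\<lambda>i. complex_of_real (x i))"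
    by (rule eq_matI) (auto simp: mat_diag_index)
  then show ?thesis using unitary_matD[OF assms] by (simp add: spec_def mat_alg)
qed

lemma spec_one: "unitary_mat n U \<Longrightarrow> spec n U (\<lambda>_. 1) = 1\<^sub>m n"
  by (simp add: spec_def mat_alg unitary_matD)

lemma tr_spec: 
  assumes "unitary_mat n U" shows "mat_trace (spec n U x) = complex_of_real (\<Sum>i<n. x i)"
proof -
  have "mat_trace (spec n U x) = mat_trace (adj U * (U * mat_diag n (\<lambda>i. complex_of_real (x i))))"
    unfolding spec_def using unitary_matD[OF assms] by (intro tr_comm) auto
  also have "\<dots> = mat_trace (mat_diag n (\<lambda>i. complex_of_real (x i)))"
    by (simp add: unitary_mult_cancel[OF assms])
  finally show ?thesis by (simp add: mat_trace_def mat_diag_index)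
qed

lemma psd_spec: "unitary_mat n U \<Longrightarrow> (\<And>i. i < n \<Longrightarrow> 0 \<le> x i) \<Longrightarrow> psd_mat n (spec n U x)"
  unfolding spec_def by (rule psd_conj[OF psd_diag]) (auto simp: unitary_matD)

lemma psd_diag_entry:
  assumes "psd_mat n M" "i < n" shows "0 \<le> Re (M $$ (i, i))"
proof -
  have M: "M \<in> carrier_mat n n" using assms(1) by (simp add: psd_mat_def)
  have c: "conjugate (unit_vec n i) = (unit_vec n i :: complex vec)"
    by (rule eq_vecI) (auto simp: unit_vec_def)
  have "(M *\<^sub>v unit_vec n i) \<bullet>c unit_vec n i = M $$ (i, i)"
    using M assms(2) by (simp add: c scalar_prod_right_unit[of _ n])
  moreover have "0 \<le> Re ((M *\<^sub>v unit_vec n i) \<bullet>c unit_vec n i)"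
    using assms(1) by (auto simp: psd_mat_def)
  ultimately show ?thesis by simp
qed

lemma psd_spec_nonneg:
  assumes "psd_mat n (spec n U x)" "unitary_mat n U" "i < n" shows "0 \<le> x i"
proof -
  note u = unitary_matD[OF assms(2)]
  have "psd_mat n (adj U * spec n U x * adj (adj U))"
    using assms u by (intro psd_conj) auto
  also have "adj U * spec n U x * adj (adj U) = mat_diag n (\<lambda>i. complex_of_real (x i))"
    using u by (simp add: spec_def mm_assoc unitary_mult_cancel[OF assms(2)] mm_one_right)
  finally show ?thesis using psd_diag_entry[OF _ assms(3)] assms(3) by (fastforce simp: mat_diag_index)
qed

lemma psd_spectral:
  assumes "psd_mat n M"
  obtains U x where "unitary_mat n U" "M = spec n U x" "\<And>i. i < n \<Longrightarrow> 0 \<le> x i"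
proof -
  obtain U x where "unitary_mat n U" "M = spec n U x"
    using hermitian_spectral[of M n] psd_carrier[OF assms] psd_adj[OF assms] by (auto simp: spec_def)
  then show ?thesis using that psd_spec_nonneg assms by blast
qed

text \<open>The change of basis \<open>W = adj V * U\<close> intertwines the two diagonals, so
  \<open>x j = y i\<close> wherever its entry at \<open>(i, j)\<close> is nonzero. Then
  \<open>W\<close> intertwines \<open>f\<close> of them too. This justifies the definite description
  in \<open>mat_fun\<close>.\<close>

lemma spec_fun_unique:
  assumes "unitary_mat n U" "unitary_mat n V" "spec n U x = spec n V y"
  shows "spec n U (\<lambda>i. f (x i)) = spec n V (\<lambda>i. f (y i))"
proof -
  note u = unitary_matD[OF assms(1)] note v = unitary_matD[OF assms(2)]
  let ?D = "\<lambda>x. mat_diag n (\<lambda>i. complex_of_real (x i))"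
  define W where "W = adj V * U"
  have W: "W \<in> carrier_mat n n" using u v by (auto simp: W_def)
  have "adj V * spec n U x * U = W * ?D x" "adj V * spec n V y * U = ?D y * W"
    using u v by (auto simp: spec_def W_def mm_assoc unitary_mult_cancel[OF assms(2)] mm_one_right)
  then have "W * ?D x = ?D y * W" using assms(3) by simp
  then have eq: "W $$ (i, j) * complex_of_real (x j) = complex_of_real (y i) * W $$ (i, j)" if "i < n" "j < n" for i j
    using that mat_diag_mult_left[OF W, of "\<lambda>i. complex_of_real (y i)"]
      mat_diag_mult_right[OF W, of "\<lambda>i. complex_of_real (x i)"]
    by (metis (no_types, lifting) index_mat(1) old.prod.case)
  have "W $$ (i, j) * complex_of_real (f (x j)) = complex_of_real (f (y i)) * W $$ (i, j)" if "i < n" "j < n" for i j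
    using eq[OF that] by (cases "W $$ (i, j) = 0") auto
  then have fW: "W * ?D (\<lambda>i. f (x i)) = ?D (\<lambda>i. f (y i)) * W"
    unfolding mat_diag_mult_left[OF W] mat_diag_mult_right[OF W] by (intro eq_matI) auto
  have "spec n V (\<lambda>i. f (y i)) = V * (?D (\<lambda>i. f (y i)) * W) * adj U"
    using u v by (simp add: spec_def W_def mm_assoc mm_one_right)
  also have "\<dots> = spec n U (\<lambda>i. f (x i))"
    unfolding fW[symmetric] using u v by (simp add: spec_def W_def mm_assoc unitary_mult_cancel[OF assms(2)])
  finally show ?thesis by simp
qed

lemma mat_fun_spec:
  assumes "unitary_mat n U" shows "mat_fun f (spec n U x) = spec n U (\<lambda>i. f (x i))"
  unfolding mat_fun_def
proof (rule the_equality)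
  show "\<exists>V y. unitary_mat (dim_row (spec n U x)) V \<and>
     spec n U x = V * mat_diag (dim_row (spec n U x)) (\<lambda>i. complex_of_real (y i)) * adj V \<and>
     spec n U (\<lambda>i. f (x i)) = V * mat_diag (dim_row (spec n U x)) (\<lambda>i. complex_of_real (f (y i))) * adj V"
    using assms by (auto simp: spec_def[symmetric])
next
  fix N assume "\<exists>V y. unitary_mat (dim_row (spec n U x)) V \<and>
     spec n U x = V * mat_diag (dim_row (spec n U x)) (\<lambda>i. complex_of_real (y i)) * adj V \<and>
     N = V * mat_diag (dim_row (spec n U x)) (\<lambda>i. complex_of_real (f (y i))) * adj V"
  then obtain V y where "unitary_mat n V" "spec n U x = spec n V y" "N = spec n V (\<lambda>i. f (y i))"
    using assms by (auto simp: spec_def[symmetric])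
  then show "N = spec n U (\<lambda>i. f (x i))" using spec_fun_unique[OF assms] by metis
qed

lemma mat_sqrt_spec: "unitary_mat n U \<Longrightarrow> mat_sqrt (spec n U x) = spec n U (\<lambda>i. sqrt (x i))"
  by (simp add: mat_sqrt_def mat_fun_spec)

lemma psd_mat_sqrt:
  assumes "psd_mat n M" shows "psd_mat n (mat_sqrt M)" "mat_sqrt M * mat_sqrt M = M"
proof -
  obtain U x where U: "unitary_mat n U" "M = spec n U x" "\<And>i. i < n \<Longrightarrow> 0 \<le> x i"
    using psd_spectral[OF assms] by blast
  then show "psd_mat n (mat_sqrt M)" by (auto simp: mat_sqrt_spec intro!: psd_spec)
  show "mat_sqrt M * mat_sqrt M = M"
    using U by (auto simp: mat_sqrt_spec spec_mult intro!: spec_cong)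
qed

text \<open>By cyclicity the trace equals that of \<open>A\<close> conjugated by the square root of
  \<open>B\<close>.\<close>

lemma psd_tr_mult:
  assumes "psd_mat n A" "psd_mat n B" shows "0 \<le> Re (mat_trace (A * B))"
proof -
  let ?S = "mat_sqrt B"
  note S = psd_mat_sqrt[OF assms(2)]
  note [simp] = psd_dims[OF assms(1)] psd_dims[OF assms(2)] psd_dims[OF S(1)] psd_adj[OF S(1)]
  have "mat_trace (A * B) = mat_trace (A * (?S * ?S))" by (simp add: S)
  also have "\<dots> = mat_trace ((A * ?S) * ?S)" by (simp add: mm_assoc)
  also have "\<dots> = mat_trace (adj ?S * A * ?S)" by (subst tr_comm) (auto simp: mm_assoc)
  finally show ?thesis using psd_matD[OF assms(1) psd_carrier[OF S(1)]] by simp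
qed

lemma tr_mono:
  assumes "psd_mat n (B - A)" "psd_mat n C" "A \<in> carrier_mat n n" "B \<in> carrier_mat n n"
  shows "Re (mat_trace (C * A)) \<le> Re (mat_trace (C * B))"
proof -
  have "C * (B - A) = C * B - C * A"
    using psd_dims[OF assms(2)] assms(3,4) by (intro mm_minus_right) auto
  moreover have "mat_trace (C * B - C * A) = mat_trace (C * B) - mat_trace (C * A)"
    using psd_dims[OF assms(2)] assms(3,4) by (intro tr_minus) auto
  ultimately show ?thesis using psd_tr_mult[OF assms(2,1)] by simp
qed

lemma fro_eq_0:
  assumes "fro A = 0" shows "A = 0\<^sub>m (dim_row A) (dim_col A)"
proof (rule eq_matI)
  fix i j assume "i < dim_row (0\<^sub>m (dim_row A) (dim_col A))" "j < dim_col (0\<^sub>m (dim_row A) (dim_col A))"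
  then have ij: "i < dim_row A" "j < dim_col A" by auto
  have "(\<Sum>j<dim_col A. (cmod (A $$ (i, j)))\<^sup>2) = 0"
    using assms ij unfolding fro_def by (subst (asm) sum_nonneg_eq_0_iff) (auto intro!: sum_nonneg)
  then have "(cmod (A $$ (i, j)))\<^sup>2 = 0"
    using ij by (subst (asm) sum_nonneg_eq_0_iff) auto
  then show "A $$ (i, j) = 0\<^sub>m (dim_row A) (dim_col A) $$ (i, j)" using ij by simp
qed auto

text \<open>The polar factor is a partial isometry, which suits rectangular and singular
  \<open>M\<close>. The third equation, recovering the square root from \<open>M\<close>, is what
  later lets two factorizations of one operator be compared.\<close>

lemma polar:
  assumes M: "M \<in> carrier_mat m k"
  obtains X where "contr m k X" "M = mat_sqrt (M * adj M) * X" "mat_sqrt (M * adj M) = M * adj X"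
proof -
  obtain U x where U: "unitary_mat m U" and Mx: "M * adj M = spec m U x" and x: "\<And>i. i < m \<Longrightarrow> 0 \<le> x i"
    using psd_spectral[OF psd_mult_adj[OF M]] by blast
  define S where "S = spec m U (\<lambda>i. sqrt (x i))"
  \<comment> \<open>Since \<open>1 / 0 = 0\<close>, this is the pseudo-inverse of \<open>S\<close>,
    and \<open>S * J\<close> is the support projection \<open>Q\<close>.\<close>
  define J where "J = spec m U (\<lambda>i. 1 / sqrt (x i))"
  define Q where "Q = spec m U (\<lambda>i. if x i = 0 then 0 else 1)"
  note [simp] = carrier_matD[OF M]
  have d [simp]: "dim_row S = m" "dim_col S = m" "dim_row J = m" "dim_col J = m" "dim_row Q = m" "dim_col Q = m"
    "adj J = J" "adj Q = Q"
    using U by (auto simp: S_def J_def Q_def)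
  have S: "mat_sqrt (M * adj M) = S" using U by (simp add: Mx mat_sqrt_spec S_def)
  have SJ: "S * J = Q" using U x unfolding S_def J_def Q_def spec_mult[OF U] by (intro spec_cong) auto
  have MJ: "(M * adj M) * J = S" using U x unfolding Mx S_def J_def spec_mult[OF U]
    by (intro spec_cong) (auto simp: real_div_sqrt)
  have JS: "J * S = Q" using U x unfolding S_def J_def Q_def spec_mult[OF U] by (intro spec_cong) auto
  have QQ: "Q * Q = Q" using U unfolding Q_def spec_mult[OF U] by (intro spec_cong) auto
  let ?Z = "(1\<^sub>m m - Q)"
  have Z: "?Z = spec m U (\<lambda>i. if x i = 0 then 1 else 0)"
    unfolding Q_def spec_one[OF U, symmetric] spec_minus[OF U] by (intro spec_cong) auto
  have ZM: "?Z * (M * adj M) = spec m U (\<lambda>_. 0)"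
    unfolding Z Mx spec_mult[OF U] by (intro spec_cong) auto
  \<comment> \<open>\<open>M\<close> has its range inside the support of \<open>M * adj M\<close>:
    the part cut off by \<open>?Z\<close> has norm zero.\<close>
  have "complex_of_real (fro (?Z * M)) = mat_trace (?Z * M * adj (?Z * M))" by (simp add: tr_mult_adj_self)
  also have "?Z * M * adj (?Z * M) = ?Z * (M * adj M) * ?Z"
    by (simp only: adj_mult adj_minus mm_assoc adj_dim d carrier_matD[OF M] index_mult_mat index_minus_mat adj_one index_one_mat)
  also have "\<dots> = spec m U (\<lambda>_. 0)" unfolding ZM unfolding Z spec_mult[OF U] by (intro spec_cong) auto
  finally have "fro (?Z * M) = 0" using tr_spec[OF U] by simp
  then have "M - Q * M = 0\<^sub>m m k" using fro_eq_0[of "?Z * M"] by (simp add: mat_alg)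
  then have *: "M - Q * M = 0\<^sub>m m k" .
  have QM: "Q * M = M"
  proof (rule eq_matI)
    fix i j assume "i < dim_row M" "j < dim_col M"
    then show "(Q * M) $$ (i, j) = M $$ (i, j)"
      using arg_cong[OF *, of "\<lambda>A. A $$ (i, j)"] by (simp del: index_mult_mat(1))
  qed auto
  define X where "X = J * M"
  have X [simp]: "X \<in> carrier_mat m k" "dim_row X = m" "dim_col X = k" by (auto simp: X_def)
  have MX: "M * adj X = S" using MJ by (simp add: X_def mat_alg)
  have "X * adj X = J * (M * adj X)" by (simp add: X_def mat_alg)
  then have XX: "X * adj X = Q" by (simp add: MX JS)
  have "S * X = M" using SJ QM by (simp add: X_def mm_assoc[symmetric])
  moreover have "contr m k X" by (rule contr_projection) (auto simp: XX QQ)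
  ultimately show ?thesis using that S MX by metis
qed

lemma polar_abs:
  assumes Z: "Z \<in> carrier_mat m k"
  obtains X where "contr k m X" "mat_abs Z = X * Z" "Z = adj X * mat_abs Z" "psd_mat k (mat_abs Z)"
proof -
  obtain X where X: "contr k m X" "adj Z = mat_sqrt (adj Z * adj (adj Z)) * X" "mat_sqrt (adj Z * adj (adj Z)) = adj Z * adj X"
    using polar[of "adj Z" k m] Z by auto
  have p: "psd_mat k (mat_abs Z)" unfolding mat_abs_def by (rule psd_mat_sqrt(1)[OF psd_adj_mult[OF Z]])
  have c: "X \<in> carrier_mat k m" using X by (simp add: contr_def)
  have 1: "adj Z = mat_abs Z * X" "mat_abs Z = adj Z * adj X" using X by (auto simp: mat_abs_def)
  have "mat_abs Z = X * Z" using arg_cong[OF 1(2), of adj] c Z p by (simp add: adj_mult psd_adj[OF p])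
  moreover have "Z = adj X * mat_abs Z"
    using arg_cong[OF 1(1), of adj] c Z p by (simp add: adj_mult psd_adj[OF p] psd_dims[OF p])
  ultimately show ?thesis using that X p by blast
qed

lemma psd_trace_real: "psd_mat n A \<Longrightarrow> mat_trace A = complex_of_real (Re (mat_trace A))"
  using tr_adj[of A] by (simp add: psd_dims psd_adj complex_eq_iff)

lemma psd_trace_nonneg: "psd_mat n A \<Longrightarrow> 0 \<le> Re (mat_trace A)"
  using psd_tr_mult[OF _ psd_one, of n A] by (simp add: mm_one_right psd_dims)

text \<open>The contraction is the polar factor that turns the product of square roots into its
  modulus. It makes the fidelity a linear expression, to which Cauchy--Schwarz applies in the
  converse bounds.\<close>

lemma fidelity_attained:
  assumes "psd_mat d \<rho>" "psd_mat d \<tau>"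
  obtains W where "contr d d W" "complex_of_real (fidelity \<rho> \<tau>) = mat_trace (W * mat_sqrt \<rho> * mat_sqrt \<tau>)"
proof -
  note s = psd_mat_sqrt(1)[OF assms(1)] psd_mat_sqrt(1)[OF assms(2)]
  have Z: "mat_sqrt \<rho> * mat_sqrt \<tau> \<in> carrier_mat d d"
    using psd_carrier[OF s(1)] psd_carrier[OF s(2)] by auto
  obtain X where "contr d d X" "mat_abs (mat_sqrt \<rho> * mat_sqrt \<tau>) = X * (mat_sqrt \<rho> * mat_sqrt \<tau>)"
    "psd_mat d (mat_abs (mat_sqrt \<rho> * mat_sqrt \<tau>))"
    using polar_abs[OF Z] by blast
  then have X: "contr d d X" "complex_of_real (fidelity \<rho> \<tau>) = mat_trace (X * (mat_sqrt \<rho> * mat_sqrt \<tau>))"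
    using psd_trace_real[of d "mat_abs (mat_sqrt \<rho> * mat_sqrt \<tau>)"] by (auto simp: fidelity_def)
  moreover have "X * (mat_sqrt \<rho> * mat_sqrt \<tau>) = X * mat_sqrt \<rho> * mat_sqrt \<tau>"
    using X(1) by (subst mm_assoc) (auto simp: contr_def psd_dims[OF s(1)] psd_dims[OF s(2)])
  ultimately show ?thesis using that by metis
qed

text \<open>The easy half of Uhlmann's theorem: the overlap of any two purifications, here written
  as factors \<open>M\<close> and \<open>N\<close>, is at most the fidelity. Polar decompositions
  reduce it to the trace of a modulus times a contraction.\<close>

lemma fidelity_ge:
  assumes M: "M \<in> carrier_mat d k" and N: "N \<in> carrier_mat d k"
  shows "cmod (mat_trace (adj M * N)) \<le> fidelity (M * adj M) (N * adj N)"
proof -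
  obtain X where X: "contr d k X" "M = mat_sqrt (M * adj M) * X" using polar[OF M] by blast
  obtain Y where Y: "contr d k Y" "N = mat_sqrt (N * adj N) * Y" using polar[OF N] by blast
  define R where "R = mat_sqrt (M * adj M)"
  define T where "T = mat_sqrt (N * adj N)"
  have R: "psd_mat d R" and T: "psd_mat d T"
    using psd_mat_sqrt(1)[OF psd_mult_adj[OF M]] psd_mat_sqrt(1)[OF psd_mult_adj[OF N]] by (auto simp: R_def T_def)
  note [simp] = psd_dims[OF R] psd_dims[OF T] psd_adj[OF R] psd_adj[OF T]
  have [simp]: "dim_row X = d" "dim_col X = k" "dim_row Y = d" "dim_col Y = k"
    using X Y by (auto simp: contr_def)
  have "R * T \<in> carrier_mat d d" by (intro carrier_matI) auto
  then obtain V where V: "contr d d V" "R * T = adj V * mat_abs (R * T)" "psd_mat d (mat_abs (R * T))"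
    using polar_abs by metis
  \<comment> \<open>Half of the modulus goes to each side of Cauchy--Schwarz; \<open>fro Q\<close>
    is then the trace of the modulus, which is the fidelity.\<close>
  define Q where "Q = mat_sqrt (mat_abs (R * T))"
  have Q: "psd_mat d Q" "Q * Q = mat_abs (R * T)" using psd_mat_sqrt[OF V(3)] by (auto simp: Q_def)
  note [simp] = psd_adj[OF Q(1)]
  have [simp]: "dim_row Q = d" "dim_col Q = d" using psd_dims[OF Q(1)] by auto
  have [simp]: "dim_row V = d" "dim_col V = d" using V by (auto simp: contr_def)
  define C where "C = Y * adj X * adj V"
  have C: "contr d d C" unfolding C_def
    using X Y V by (intro contr_mult[of d d _ d] contr_mult[of d k _ d] contr_adj)
  then have [simp]: "dim_row C = d" "dim_col C = d" by (auto simp: contr_def)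
  have RT: "R * T = adj V * (Q * Q)" unfolding Q(2) by (rule V(2))
  have "mat_trace (adj M * N) = mat_trace (adj X * (R * T * Y))"
    by (subst X(2), subst Y(2)) (simp add: mat_alg flip: R_def T_def)
  also have "\<dots> = mat_trace (R * T * (Y * adj X))"
    by (subst tr_comm) (auto simp: mm_assoc)
  also have "\<dots> = mat_trace (adj V * (Q * Q * (Y * adj X)))"
    unfolding RT by (simp add: mm_assoc)
  also have "\<dots> = mat_trace (Q * (Q * C))"
  proof -
    have "mat_trace (adj V * (Q * Q * (Y * adj X))) = mat_trace (Q * Q * (Y * adj X) * adj V)"
      by (rule tr_comm) simp_all
    also have "Q * Q * (Y * adj X) * adj V = Q * (Q * C)"
      unfolding C_def by (simp only: mm_assoc adj_dim index_mult_mat \<open>dim_row Q = d\<close> \<open>dim_col Q = d\<close>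
        \<open>dim_row V = d\<close> \<open>dim_col V = d\<close> \<open>dim_row X = d\<close> \<open>dim_col X = k\<close> \<open>dim_row Y = d\<close> \<open>dim_col Y = k\<close>)
    finally show ?thesis .
  qed
  finally have "cmod (mat_trace (adj M * N)) \<le> sqrt (fro Q) * sqrt (fro (Q * C))"
    using tr_cauchy_schwarz'[of Q "Q * C"] by simp
  also have "\<dots> \<le> sqrt (fro Q) * sqrt (fro Q)"
    by (intro mult_left_mono real_sqrt_le_mono contr_fro_right[OF C psd_carrier[OF Q(1)]]) auto
  also have "\<dots> = fro Q" by simp
  also have "\<dots> = fidelity (M * adj M) (N * adj N)"
    unfolding fidelity_def R_def[symmetric] T_def[symmetric] Q(2)[symmetric]
    by (simp add: fro_trace(2))
  finally show ?thesis .
qed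

lemma fidelity_nonneg:
  assumes "psd_mat d \<rho>" "psd_mat d \<tau>" shows "0 \<le> fidelity \<rho> \<tau>"
proof -
  have Z: "mat_sqrt \<rho> * mat_sqrt \<tau> \<in> carrier_mat d d"
    using psd_carrier[OF psd_mat_sqrt(1)[OF assms(1)]] psd_carrier[OF psd_mat_sqrt(1)[OF assms(2)]] by auto
  show ?thesis unfolding fidelity_def using psd_trace_nonneg polar_abs[OF Z] by metis
qed

subsection \<open>Tensor products and partial traces\<close>

lemma index_lt: "i < a \<Longrightarrow> k < b \<Longrightarrow> i * b + k < a * (b :: nat)"
proof -
  assume "i < a" "k < b"
  then have "i * b + k < Suc i * b" by simp
  also have "\<dots> \<le> a * b" using \<open>i < a\<close> by (intro mult_le_mono1) simp
  finally show ?thesis .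
qed

lemma index_div: "k < b \<Longrightarrow> (i * b + k) div b = (i :: nat)"
  and index_mod: "k < b \<Longrightarrow> (i * b + k) mod b = (k :: nat)"
  by auto

lemma index_div_lt: "i < a * b \<Longrightarrow> i div b < (a :: nat)"
  and index_mod_lt: "i < a * b \<Longrightarrow> i mod b < (b :: nat)"
  by (simp add: less_mult_imp_div_less mult.commute) (cases b; auto)

lemma sum_index: "(\<Sum>i<a * b. f i) = (\<Sum>i<a. \<Sum>k<b. f (i * b + k :: nat))"
proof -
  have "(\<Sum>i<a * b. f i) = (\<Sum>i<a. sum f {i * b..<i * b + b})"
    by (rule sum.nat_group[symmetric])
  also have "\<dots> = (\<Sum>i<a. \<Sum>k<b. f (i * b + k))"
  proof (rule sum.cong[OF refl])
    fix i
    show "sum f {i * b..<i * b + b} = (\<Sum>k<b. f (i * b + k))"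
      by (rule sum.reindex_bij_witness[of _ "\<lambda>k. i * b + k" "\<lambda>j. j - i * b"]) auto
  qed
  finally show ?thesis .
qed

lemma kron_dims [simp]: "dim_row (kron A B) = dim_row A * dim_row B" "dim_col (kron A B) = dim_col A * dim_col B"
  by (auto simp: kron_def)

lemma kron_index:
  "i < dim_row A \<Longrightarrow> j < dim_col A \<Longrightarrow> k < dim_row B \<Longrightarrow> l < dim_col B \<Longrightarrow>
    kron A B $$ (i * dim_row B + k, j * dim_col B + l) = A $$ (i, j) * B $$ (k, l)"
  by (simp add: kron_def index_lt)

text \<open>Every index below \<open>a * b\<close> splits uniquely as \<open>i * b + k\<close>, so
  entries need comparing only at such pairs, where \<open>kron_index\<close> applies.\<close>

lemma eq_mat_prodI:
  assumes "dim_row A = a * b" "dim_col A = c * d" "dim_row B = a * b" "dim_col B = c * d"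
    and "\<And>i j k l. i < a \<Longrightarrow> j < c \<Longrightarrow> k < b \<Longrightarrow> l < d \<Longrightarrow> A $$ (i * b + k, j * d + l) = B $$ (i * b + k, j * d + l)"
  shows "A = B"
proof (rule eq_matI)
  fix p q assume "p < dim_row B" "q < dim_col B"
  then have "p < a * b" "q < c * d" using assms by auto
  then show "A $$ (p, q) = B $$ (p, q)"
    using assms(5)[of "p div b" "q div d" "p mod b" "q mod d"] by (simp add: index_div_lt index_mod_lt)
qed (use assms in auto)

lemma kron_mult:
  assumes "dim_col A = dim_row C" "dim_col B = dim_row D"
  shows "kron A B * kron C D = kron (A * C) (B * D)"
proof (rule eq_mat_prodI[of _ "dim_row A" "dim_row B" "dim_col C" "dim_col D"])
  fix i j k l assume ij: "i < dim_row A" "j < dim_col C" "k < dim_row B" "l < dim_col D"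
  have "(kron A B * kron C D) $$ (i * dim_row B + k, j * dim_col D + l) =
    (\<Sum>p<dim_row C * dim_row D. kron A B $$ (i * dim_row B + k, p) * kron C D $$ (p, j * dim_col D + l))"
    using ij assms by (subst mult_index) (auto simp: index_lt)
  also have "\<dots> = (\<Sum>p<dim_row C. \<Sum>q<dim_row D. (A $$ (i, p) * B $$ (k, q)) * (C $$ (p, j) * D $$ (q, l)))"
    unfolding sum_index using ij kron_index[of i A _ k B] kron_index[of _ C j _ D l] assms
    by (intro sum.cong refl) auto
  also have "\<dots> = (\<Sum>p<dim_row C. A $$ (i, p) * C $$ (p, j)) * (\<Sum>q<dim_row D. B $$ (k, q) * D $$ (q, l))"
    unfolding sum_product by (intro sum.cong refl) (simp add: mult_ac)
  also have "\<dots> = (A * C) $$ (i, j) * (B * D) $$ (k, l)"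
    using ij assms by (simp only: mult_index)
  also have "\<dots> = kron (A * C) (B * D) $$ (i * dim_row B + k, j * dim_col D + l)"
    using kron_index[of i "A * C" j k "B * D" l] ij by (simp del: index_mult_mat(1))
  finally show "(kron A B * kron C D) $$ (i * dim_row B + k, j * dim_col D + l) =
    kron (A * C) (B * D) $$ (i * dim_row B + k, j * dim_col D + l)" .
qed auto

lemma adj_kron: "adj (kron A B) = kron (adj A) (adj B)"
proof (rule eq_mat_prodI[of _ "dim_col A" "dim_col B" "dim_row A" "dim_row B"])
  fix i j k l assume ij: "i < dim_col A" "j < dim_row A" "k < dim_col B" "l < dim_row B"
  then show "adj (kron A B) $$ (i * dim_col B + k, j * dim_row B + l) =
    kron (adj A) (adj B) $$ (i * dim_col B + k, j * dim_row B + l)"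
    using kron_index[of i "adj A" j k "adj B" l] kron_index[of j A i l B k]
    by (simp add: index_lt)
qed auto

lemma kron_one [simp]: "kron (1\<^sub>m a) (1\<^sub>m b) = 1\<^sub>m (a * b)"
proof (rule eq_mat_prodI[of _ a b a b])
  fix i j k l assume ij: "i < a" "j < a" "k < b" "l < b"
  have "i = j \<and> k = l" if "i * b + k = j * b + l"
    using that ij by (metis index_div index_mod)
  then show "kron (1\<^sub>m a) (1\<^sub>m b) $$ (i * b + k, j * b + l) = 1\<^sub>m (a * b) $$ (i * b + k, j * b + l)"
    using kron_index[of i "1\<^sub>m a" j k "1\<^sub>m b" l] ij by (auto simp: index_lt)
qed auto

lemma kron_minus: "dim_row B = dim_row C \<Longrightarrow> dim_col B = dim_col C \<Longrightarrow> kron A (B - C) = kron A B - kron A C"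
  by (rule eq_matI) (auto simp: kron_def index_mod_lt algebra_simps)

lemma kron_add: "dim_row B = dim_row C \<Longrightarrow> dim_col B = dim_col C \<Longrightarrow> kron A (B + C) = kron A B + kron A C"
  by (rule eq_matI) (auto simp: kron_def index_mod_lt algebra_simps)

lemma kron_smult: "kron A (c \<cdot>\<^sub>m B) = c \<cdot>\<^sub>m kron A B"
  by (rule eq_matI) (auto simp: kron_def index_mod_lt)

abbreviation kr :: "nat \<Rightarrow> complex mat \<Rightarrow> complex mat" where "kr a B \<equiv> kron (1\<^sub>m a) B"

lemma kr_mult: "dim_col B = dim_row D \<Longrightarrow> kr a B * kr a D = kr a (B * D)"
  by (simp add: kron_mult mm_one_left)

lemma kr_adj: "adj (kr a B) = kr a (adj B)"
  by (simp add: adj_kron)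

lemma kr_carrier: "B \<in> carrier_mat b c \<Longrightarrow> kr a B \<in> carrier_mat (a * b) (a * c)"
  by (auto intro!: carrier_matI)

lemma psd_kr:
  assumes "psd_mat b B" shows "psd_mat (a * b) (kr a B)"
proof -
  let ?S = "mat_sqrt B"
  note S = psd_mat_sqrt[OF assms]
  have "kr a B = kr a ?S * adj (kr a ?S)"
    using S by (simp add: kr_adj kr_mult psd_adj psd_dims)
  then show ?thesis using psd_mult_adj[OF kr_carrier[OF psd_carrier[OF S(1)]]] by simp
qed

lemma ptrace_first_index:
  "l < b \<Longrightarrow> l' < b \<Longrightarrow> ptrace_mid 1 a b M $$ (l, l') = (\<Sum>k<a. M $$ (k * b + l, k * b + l'))"
  by (simp add: ptrace_mid_def)

lemma ptrace_first_dims [simp]: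
  "dim_row (ptrace_mid 1 a b M) = b" "dim_col (ptrace_mid 1 a b M) = b"
  by (auto simp: ptrace_mid_def)

lemma kr_index:
  "i < a \<Longrightarrow> j < a \<Longrightarrow> k < dim_row B \<Longrightarrow> l < dim_col B \<Longrightarrow>
    kr a B $$ (i * dim_row B + k, j * dim_col B + l) = (if i = j then B $$ (k, l) else 0)"
  using kron_index[of i "1\<^sub>m a" j k B l] by auto

text \<open>The partial trace is the adjoint of the embedding \<open>kr a\<close>. This is how
  operators on B are evaluated in the global state.\<close>

lemma tr_mult_kr:
  assumes M: "M \<in> carrier_mat (a * b) (a * b)" and Q: "Q \<in> carrier_mat b b"
  shows "mat_trace (M * kr a Q) = mat_trace (ptrace_mid 1 a b M * Q)"
proof -
  have "mat_trace (M * kr a Q) = (\<Sum>i<a. \<Sum>k<b. \<Sum>j<a. \<Sum>l<b. M $$ (i * b + k, j * b + l) * kr a Q $$ (j * b + l, i * b + k))"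
    using M Q by (subst tr_mult) (simp_all add: sum_index)
  also have "\<dots> = (\<Sum>i<a. \<Sum>k<b. \<Sum>j<a. if j = i then \<Sum>l<b. M $$ (i * b + k, i * b + l) * Q $$ (l, k) else 0)"
    using kr_index[of _ a _ _ Q] Q by (intro sum.cong refl) (auto intro!: sum.cong)
  also have "\<dots> = (\<Sum>i<a. \<Sum>k<b. \<Sum>l<b. M $$ (i * b + k, i * b + l) * Q $$ (l, k))"
    by (rule sum.cong[OF refl], rule sum.cong[OF refl]) simp
  also have "\<dots> = (\<Sum>k<b. \<Sum>i<a. \<Sum>l<b. M $$ (i * b + k, i * b + l) * Q $$ (l, k))"
    by (rule sum.swap)
  also have "\<dots> = (\<Sum>k<b. \<Sum>l<b. \<Sum>i<a. M $$ (i * b + k, i * b + l) * Q $$ (l, k))"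
    by (rule sum.cong[OF refl], rule sum.swap)
  also have "\<dots> = (\<Sum>k<b. \<Sum>l<b. (\<Sum>i<a. M $$ (i * b + k, i * b + l)) * Q $$ (l, k))"
    by (simp add: sum_distrib_right)
  also have "\<dots> = mat_trace (ptrace_mid 1 a b M * Q)"
    using Q by (subst tr_mult) (auto simp: ptrace_first_index[symmetric] simp del: One_nat_def intro!: sum.cong)
  finally show ?thesis .
qed

text \<open>
  A matrix \<open>N\<close> with rows indexed by \<open>AB\<close> and columns by \<open>C\<close> is read as the vector of \<open>A \<otimes> B \<otimes> C\<close> with
  these coefficients; regrouping them with rows \<open>AC\<close> and columns \<open>B\<close> makes both marginals Gram matrices.
\<close>

definition vec_of :: "nat \<Rightarrow> nat \<Rightarrow> complex mat \<Rightarrow> complex vec" where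
  "vec_of d c N = vec (d * c) (\<lambda>i. N $$ (i div c, i mod c))"

definition reshape :: "nat \<Rightarrow> nat \<Rightarrow> nat \<Rightarrow> complex mat \<Rightarrow> complex mat" where
  "reshape a b c N = mat (a * c) b (\<lambda>(i, l). N $$ ((i div c) * b + l, i mod c))"

lemma reshape_dims [simp]: "dim_row (reshape a b c N) = a * c" "dim_col (reshape a b c N) = b"
  by (auto simp: reshape_def)

lemma reshape_carrier [simp]: "reshape a b c N \<in> carrier_mat (a * c) b"
  by (auto simp: reshape_def)

lemma reshape_index: "i < a \<Longrightarrow> k < c \<Longrightarrow> l < b \<Longrightarrow> reshape a b c N $$ (i * c + k, l) = N $$ (i * b + l, k)"
  by (simp add: reshape_def index_lt)

lemma ptrace_last_vec_of:
  assumes "N \<in> carrier_mat d c"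
  shows "ptrace_mid d c 1 (ket_bra (vec_of d c N)) = N * adj N"
proof (rule eq_matI)
  fix i j assume "i < dim_row (N * adj N)" "j < dim_col (N * adj N)"
  then have ij: "i < d" "j < d" using assms by auto
  have "ptrace_mid d c 1 (ket_bra (vec_of d c N)) $$ (i, j) = (\<Sum>k<c. N $$ (i, k) * cnj (N $$ (j, k)))"
    using ij by (auto simp: ptrace_mid_def ket_bra_def vec_of_def index_lt intro!: sum.cong)
  also have "\<dots> = (N * adj N) $$ (i, j)"
    using ij assms by (subst mult_index) (auto intro!: sum.cong)
  finally show "ptrace_mid d c 1 (ket_bra (vec_of d c N)) $$ (i, j) = (N * adj N) $$ (i, j)" .
qed (use assms in \<open>auto simp: ptrace_mid_def\<close>)

lemma ptrace_mid_vec_of: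
  assumes "N \<in> carrier_mat (a * b) c"
  shows "ptrace_mid a b c (ket_bra (vec_of (a * b) c N)) = reshape a b c N * adj (reshape a b c N)"
proof (rule eq_matI)
  fix i j assume "i < dim_row (reshape a b c N * adj (reshape a b c N))" "j < dim_col (reshape a b c N * adj (reshape a b c N))"
  then have ij: "i < a * c" "j < a * c" by auto
  have lt: "(p * b + k) * c + q < a * b * c" if "p < a" "k < b" "q < c" for p q k
    using index_lt[OF index_lt[OF that(1,2)] that(3)] .
  note c = index_div_lt[OF ij(1)] index_div_lt[OF ij(2)] index_mod_lt[OF ij(1)] index_mod_lt[OF ij(2)]
  have "ptrace_mid a b c (ket_bra (vec_of (a * b) c N)) $$ (i, j) =
      (\<Sum>k<b. N $$ (i div c * b + k, i mod c) * cnj (N $$ (j div c * b + k, j mod c)))"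
    using ij c by (auto simp: ptrace_mid_def ket_bra_def vec_of_def lt intro!: sum.cong)
  also have "\<dots> = (reshape a b c N * adj (reshape a b c N)) $$ (i, j)"
    using ij by (subst mult_index) (auto simp: reshape_def intro!: sum.cong)
  finally show "ptrace_mid a b c (ket_bra (vec_of (a * b) c N)) $$ (i, j) = (reshape a b c N * adj (reshape a b c N)) $$ (i, j)" .
qed (auto simp: ptrace_mid_def)

text \<open>Purifying \<rho> amounts to factoring it as \<open>N * adj N\<close>, the columns of
  \<open>N\<close> being indexed by the purifying system. Square roots and polar factors thus handle
  purifications.\<close>

lemma purifies_vec_of:
  "purifies d c \<psi> \<rho> \<longleftrightarrow> c > 0 \<and> (\<exists>N \<in> carrier_mat d c. \<psi> = vec_of d c N \<and> \<rho> = N * adj N)"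
proof (intro iffI conjI)
  assume p: "purifies d c \<psi> \<rho>"
  then show "c > 0" by (simp add: purifies_def)
  let ?N = "mat d c (\<lambda>(i, k). \<psi> $ (i * c + k))"
  have "\<psi> = vec_of d c ?N"
    using p by (intro eq_vecI) (auto simp: vec_of_def purifies_def index_div_lt index_mod_lt)
  then show "\<exists>N \<in> carrier_mat d c. \<psi> = vec_of d c N \<and> \<rho> = N * adj N"
    using p ptrace_last_vec_of[of ?N d c] by (intro bexI[of _ ?N]) (auto simp: purifies_def)
next
  assume "c > 0 \<and> (\<exists>N \<in> carrier_mat d c. \<psi> = vec_of d c N \<and> \<rho> = N * adj N)"
  then show "purifies d c \<psi> \<rho>"
    using ptrace_last_vec_of[of _ d c] by (auto simp: purifies_def vec_of_def)
qed

text \<open>An operator acting on the column index C becomes one acting on the C part of the row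
  index AC; as it moves from the right side to the left, it is transposed.
  \<open>reshape_mult_left\<close> is the mirror image for B.\<close>

lemma reshape_mult_right:
  assumes "N \<in> carrier_mat (a * b) c" "V \<in> carrier_mat c c'"
  shows "reshape a b c' (N * V) = kr a (transpose_mat V) * reshape a b c N"
proof (rule eq_mat_prodI[of _ a c' 1 b])
  fix i j k l assume ij: "i < a" "j < (1::nat)" "k < c'" "l < b"
  then have j: "j * b + l = l" by simp
  have "(kr a (transpose_mat V) * reshape a b c N) $$ (i * c' + k, l) =
      (\<Sum>p<a. \<Sum>q<c. kr a (transpose_mat V) $$ (i * c' + k, p * c + q) * reshape a b c N $$ (p * c + q, l))"
    using ij assms by (subst mult_index) (auto simp: index_lt sum_index)
  also have "\<dots> = (\<Sum>p<a. if p = i then \<Sum>q<c. V $$ (q, k) * N $$ (i * b + l, q) else 0)"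
    using ij assms kr_index[of i a _ k "transpose_mat V"]
    by (intro sum.cong refl) (auto simp: reshape_index intro!: sum.cong)
  also have "\<dots> = (\<Sum>q<c. N $$ (i * b + l, q) * V $$ (q, k))"
    using ij by (simp add: mult.commute)
  also have "\<dots> = reshape a b c' (N * V) $$ (i * c' + k, l)"
    using ij assms by (subst reshape_index) (auto simp: mult_index index_lt simp del: index_mult_mat(1))
  finally show "reshape a b c' (N * V) $$ (i * c' + k, j * b + l) = (kr a (transpose_mat V) * reshape a b c N) $$ (i * c' + k, j * b + l)"
    by (simp only: j)
qed (use assms in auto)

lemma reshape_mult_left:
  assumes "N \<in> carrier_mat (a * b) c" "Q \<in> carrier_mat b' b"
  shows "reshape a b' c (kr a Q * N) = reshape a b c N * transpose_mat Q"
proof (rule eq_mat_prodI[of _ a c 1 b'])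
  fix i j k l assume ij: "i < a" "j < (1::nat)" "k < c" "l < b'"
  then have j: "j * b' + l = l" by simp
  have "reshape a b' c (kr a Q * N) $$ (i * c + k, l) = (kr a Q * N) $$ (i * b' + l, k)"
    using ij by (subst reshape_index) auto
  also have "\<dots> = (\<Sum>p<a. \<Sum>q<b. kr a Q $$ (i * b' + l, p * b + q) * N $$ (p * b + q, k))"
    using ij assms by (subst mult_index) (auto simp: index_lt sum_index)
  also have "\<dots> = (\<Sum>p<a. if p = i then \<Sum>q<b. Q $$ (l, q) * N $$ (i * b + q, k) else 0)"
    using ij assms kr_index[of i a _ l Q] by (intro sum.cong refl) (auto intro!: sum.cong)
  also have "\<dots> = (\<Sum>q<b. reshape a b c N $$ (i * c + k, q) * transpose_mat Q $$ (q, l))"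
    using ij assms by (auto simp: reshape_index mult.commute intro!: sum.cong)
  also have "\<dots> = (reshape a b c N * transpose_mat Q) $$ (i * c + k, l)"
    using ij assms by (subst mult_index) (auto simp: index_lt)
  finally show "reshape a b' c (kr a Q * N) $$ (i * c + k, j * b' + l) = (reshape a b c N * transpose_mat Q) $$ (i * c + k, j * b' + l)"
    by (simp only: j)
qed (use assms in auto)

text \<open>Both arrangements contain the same coefficients, so the inner product of the underlying
  vectors is the same.\<close>

lemma reshape_inner:
  assumes "L \<in> carrier_mat (a * b) c" "N \<in> carrier_mat (a * b) c"
  shows "mat_trace (adj (reshape a b c L) * reshape a b c N) = mat_trace (adj L * N)"
proof -
  have "mat_trace (adj (reshape a b c L) * reshape a b c N) =
      (\<Sum>l<b. \<Sum>i<a. \<Sum>k<c. cnj (L $$ (i * b + l, k)) * N $$ (i * b + l, k))"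
    by (subst tr_mult) (auto simp: sum_index reshape_index index_lt intro!: sum.cong)
  also have "\<dots> = (\<Sum>i<a. \<Sum>l<b. \<Sum>k<c. cnj (L $$ (i * b + l, k)) * N $$ (i * b + l, k))"
    by (rule sum.swap)
  also have "\<dots> = (\<Sum>i<a. \<Sum>k<c. \<Sum>l<b. cnj (L $$ (i * b + l, k)) * N $$ (i * b + l, k))"
    by (rule sum.cong[OF refl], rule sum.swap)
  also have "\<dots> = (\<Sum>k<c. \<Sum>i<a. \<Sum>l<b. cnj (L $$ (i * b + l, k)) * N $$ (i * b + l, k))"
    by (rule sum.swap)
  also have "\<dots> = mat_trace (adj L * N)"
    using assms by (subst tr_mult) (auto simp: sum_index index_lt intro!: sum.cong)
  finally show ?thesis .
qed

text \<open>The two Gram matrices of one reshaped matrix are the marginal on AC and, transposed, the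
  marginal on B; eigenvalue bounds on B therefore give norm bounds on AC.\<close>

lemma reshape_gram:
  assumes "N \<in> carrier_mat (a * b) c"
  shows "adj (reshape a b c N) * reshape a b c N = transpose_mat (ptrace_mid 1 a b (N * adj N))"
proof (rule eq_matI)
  fix l l' assume "l < dim_row (transpose_mat (ptrace_mid 1 a b (N * adj N)))" "l' < dim_col (transpose_mat (ptrace_mid 1 a b (N * adj N)))"
  then have l: "l < b" "l' < b" by (auto simp del: One_nat_def)
  have "(adj (reshape a b c N) * reshape a b c N) $$ (l, l') =
      (\<Sum>i<a. \<Sum>k<c. cnj (N $$ (i * b + l, k)) * N $$ (i * b + l', k))"
    using l by (subst mult_index) (auto simp: sum_index reshape_index index_lt intro!: sum.cong)
  also have "\<dots> = (\<Sum>i<a. (N * adj N) $$ (i * b + l', i * b + l))"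
    using l assms by (intro sum.cong refl, subst mult_index) (auto simp: index_lt mult.commute intro!: sum.cong)
  also have "\<dots> = transpose_mat (ptrace_mid 1 a b (N * adj N)) $$ (l, l')"
    using l ptrace_first_index[of l' b l a "N * adj N"] by (simp del: One_nat_def)
  finally show "(adj (reshape a b c N) * reshape a b c N) $$ (l, l') = transpose_mat (ptrace_mid 1 a b (N * adj N)) $$ (l, l')" .
qed (auto simp del: One_nat_def)

lemma transpose_mult_mat: "dim_col A = dim_row B \<Longrightarrow> transpose_mat (A * B) = transpose_mat B * transpose_mat (A :: complex mat)"
  by (rule transpose_mult) auto

lemma transpose_minus_mat: "dim_row A = dim_row B \<Longrightarrow> dim_col A = dim_col B \<Longrightarrow>
    transpose_mat (A - B) = transpose_mat A - transpose_mat (B :: complex mat)"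
  by (rule eq_matI) auto

lemma adj_transpose: "adj (transpose_mat A) = transpose_mat (adj A)"
  by (rule eq_matI) auto

lemma tr_transpose: "dim_row A = dim_col A \<Longrightarrow> mat_trace (transpose_mat A) = mat_trace A"
  by (auto simp: mat_trace_def)

lemma fro_transpose: "fro (transpose_mat A) = fro A"
  unfolding fro_def by (subst sum.swap) auto

lemma psd_transpose:
  assumes "psd_mat n A" shows "psd_mat n (transpose_mat A)"
proof -
  let ?S = "mat_sqrt A"
  note S = psd_mat_sqrt[OF assms]
  have "transpose_mat A = transpose_mat ?S * adj (transpose_mat ?S)"
    using S by (simp add: adj_transpose psd_adj[OF S(1)] psd_dims[OF S(1)] flip: transpose_mult_mat)
  then show ?thesis using psd_mult_adj[of "transpose_mat ?S" n n] psd_carrier[OF S(1)] by auto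
qed

subsection \<open>Min- and max-entropy\<close>

text \<open>Here and in \<open>min_entropy_le\<close> the factor \<open>s\<close> stands for 2 to
  the power minus \<lambda>, which keeps exponentials out of the operator inequalities.\<close>

lemma min_entropy_ge:
  assumes "\<sigma> \<in> states b" "0 < s" "psd_mat (a * b) (complex_of_real s \<cdot>\<^sub>m kr a \<sigma> - \<tau>)"
  shows "ereal (- log 2 s) \<le> min_entropy a b \<tau>"
proof -
  have "ereal (- log 2 s) \<le> min_entropy_rel a b \<tau> \<sigma>"
    unfolding min_entropy_rel_def using assms by (intro Sup_upper imageI) simp
  also have "\<dots> \<le> min_entropy a b \<tau>"
    unfolding min_entropy_def using assms(1) by (rule SUP_upper)
  finally show ?thesis .
qed

lemma min_entropy_le:
  assumes "\<And>\<sigma> s. \<sigma> \<in> states b \<Longrightarrow> 0 < s \<Longrightarrow> psd_mat (a * b) (complex_of_real s \<cdot>\<^sub>m kr a \<sigma> - \<tau>) \<Longrightarrow>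
    ereal (- log 2 s) \<le> u"
  shows "min_entropy a b \<tau> \<le> u"
  unfolding min_entropy_def min_entropy_rel_def
proof (intro SUP_least)
  fix \<sigma> l assume "\<sigma> \<in> states b" "l \<in> {l. psd_mat (a * b) (complex_of_real (2 powr - l) \<cdot>\<^sub>m kr a \<sigma> - \<tau>)}"
  then show "ereal l \<le> u" using assms[of \<sigma> "2 powr - l"] by simp
qed


text \<open>Conjugating by the contraction on the conditioning system preserves the operator
  inequality and does not raise the trace of \<sigma>. The lost trace can be put back, which only
  enlarges the upper bound.\<close>

lemma min_entropy_isometry_le:
  assumes N: "N \<in> carrier_mat (a * b) c" and V: "contr c c' V" and c': "c' > 0"
  shows "min_entropy a c (reshape a b c N * adj (reshape a b c N)) \<le>
    min_entropy a c' (reshape a b c' (N * V) * adj (reshape a b c' (N * V)))"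
proof (rule min_entropy_le)
  fix \<sigma> s assume \<sigma>: "\<sigma> \<in> states c" and s: "0 < s"
    and p: "psd_mat (a * c) (complex_of_real s \<cdot>\<^sub>m kr a \<sigma> - reshape a b c N * adj (reshape a b c N))"
  let ?G = "reshape a b c N" and ?G' = "reshape a b c' (N * V)"
  have VC: "V \<in> carrier_mat c c'" using V by (simp add: contr_def)
  define T where "T = transpose_mat V"
  have T [simp]: "T \<in> carrier_mat c' c" "dim_row T = c'" "dim_col T = c" using VC by (auto simp: T_def)
  have sp: "psd_mat c \<sigma>" and tr1: "mat_trace \<sigma> = 1" using \<sigma> by (auto simp: states_def)
  note [simp] = psd_dims[OF sp]
  define \<sigma>1 where "\<sigma>1 = T * \<sigma> * adj T"
  have s1: "psd_mat c' \<sigma>1" unfolding \<sigma>1_def by (rule psd_conj[OF sp T(1)])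
  note [simp] = psd_dims[OF s1]
  define t where "t = Re (mat_trace \<sigma>1)"
  have "psd_mat c (1\<^sub>m c - V * adj V)" using contr_adj[OF V] by (simp add: contr_def)
  then have "psd_mat c (transpose_mat (1\<^sub>m c - V * adj V))" by (rule psd_transpose)
  also have "transpose_mat (1\<^sub>m c - V * adj V) = 1\<^sub>m c - adj T * T"
    using VC by (simp add: transpose_minus_mat transpose_mult_mat T_def adj_transpose)
  finally have "0 \<le> Re (mat_trace (\<sigma> * (1\<^sub>m c - adj T * T)))" by (rule psd_tr_mult[OF sp])
  moreover have "mat_trace (\<sigma> * (1\<^sub>m c - adj T * T)) = mat_trace \<sigma> - mat_trace (\<sigma> * (adj T * T))"
    by (simp add: mm_minus_right tr_minus mm_one_right)
  moreover have "mat_trace (\<sigma> * (adj T * T)) = mat_trace \<sigma>1"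
    unfolding \<sigma>1_def using tr_comm[of "\<sigma> * adj T" T] by (simp add: mm_assoc)
  ultimately have t: "t \<le> 1" by (simp add: t_def tr1)
  \<comment> \<open>The missing trace \<open>1 - t\<close> is placed on the first basis vector,
    which exists because \<open>c' > 0\<close>.\<close>
  define E where "E = mat_diag c' (\<lambda>i. complex_of_real (if i = 0 then 1 - t else 0))"
  have E: "psd_mat c' E" unfolding E_def using t by (intro psd_diag) auto
  note [simp] = psd_dims[OF E]
  have trE: "mat_trace E = complex_of_real (1 - t)" using c' by (simp add: E_def mat_trace_def mat_diag_index if_distrib[of complex_of_real] sum.delta cong: if_cong)
  have st: "\<sigma>1 + E \<in> states c'"
    using psd_add[OF s1 E] psd_trace_real[OF s1] by (simp add: states_def tr_add trE t_def)
  have "psd_mat (a * c') (kr a T * (complex_of_real s \<cdot>\<^sub>m kr a \<sigma> - ?G * adj ?G) * adj (kr a T))"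
    by (rule psd_conj[OF p kr_carrier[OF T(1)]])
  also have "kr a T * (complex_of_real s \<cdot>\<^sub>m kr a \<sigma> - ?G * adj ?G) * adj (kr a T) =
      complex_of_real s \<cdot>\<^sub>m kr a \<sigma>1 - ?G' * adj ?G'"
  proof -
    have "?G' = kr a T * ?G" unfolding T_def by (rule reshape_mult_right[OF N VC])
    then show ?thesis
      by (simp add: mat_alg kr_adj kr_mult \<sigma>1_def)
  qed
  finally have 1: "psd_mat (a * c') (complex_of_real s \<cdot>\<^sub>m kr a \<sigma>1 - ?G' * adj ?G')" .
  have "psd_mat (a * c') (complex_of_real s \<cdot>\<^sub>m kr a E)"
    using s by (intro psd_smult psd_kr E) auto
  then have "psd_mat (a * c') ((complex_of_real s \<cdot>\<^sub>m kr a \<sigma>1 - ?G' * adj ?G') + complex_of_real s \<cdot>\<^sub>m kr a E)"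
    by (rule psd_add[OF 1])
  also have "(complex_of_real s \<cdot>\<^sub>m kr a \<sigma>1 - ?G' * adj ?G') + complex_of_real s \<cdot>\<^sub>m kr a E =
      complex_of_real s \<cdot>\<^sub>m kr a (\<sigma>1 + E) - ?G' * adj ?G'"
    by (subst kron_add, simp, simp, rule eq_matI) (auto simp: algebra_simps simp del: index_mult_mat(1))
  finally show "ereal (- log 2 s) \<le> min_entropy a c' (?G' * adj ?G')"
    by (rule min_entropy_ge[OF st s])
qed

text \<open>Two factors of the same operator share its square root, so each equals the other times a
  contraction built from the polar factors. The preceding lemma in both directions shows that the
  value does not depend on the purification, even for purifying systems of different
  dimension.\<close>

lemma max_entropy_eq:
  assumes N: "N \<in> carrier_mat (a * b) c" and c: "c > 0"
  shows "max_entropy a b (N * adj N) = - min_entropy a c (reshape a b c N * adj (reshape a b c N))"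
  unfolding max_entropy_def
proof (rule the_equality)
  show "\<exists>c' \<psi>. purifies (a * b) c' \<psi> (N * adj N) \<and>
    - min_entropy a c (reshape a b c N * adj (reshape a b c N)) = - min_entropy a c' (ptrace_mid a b c' (ket_bra \<psi>))"
    using N c by (intro exI[of _ c] exI[of _ "vec_of (a * b) c N"]) (auto simp: purifies_vec_of ptrace_mid_vec_of)
next
  fix h assume "\<exists>c' \<psi>. purifies (a * b) c' \<psi> (N * adj N) \<and> h = - min_entropy a c' (ptrace_mid a b c' (ket_bra \<psi>))"
  then obtain c' N' where c': "c' > 0" and N': "N' \<in> carrier_mat (a * b) c'" and eq: "N * adj N = N' * adj N'"
    and h: "h = - min_entropy a c' (ptrace_mid a b c' (ket_bra (vec_of (a * b) c' N')))"
    by (auto simp: purifies_vec_of)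
  obtain X where X: "contr (a * b) c X" "N = mat_sqrt (N * adj N) * X" "mat_sqrt (N * adj N) = N * adj X"
    using polar[OF N] by blast
  obtain X' where X': "contr (a * b) c' X'" "N' = mat_sqrt (N' * adj N') * X'" "mat_sqrt (N' * adj N') = N' * adj X'"
    using polar[OF N'] by blast
  note [simp] = carrier_matD[OF N] carrier_matD[OF N']
  have [simp]: "dim_row X = a * b" "dim_col X = c" "dim_row X' = a * b" "dim_col X' = c'"
    using X(1) X'(1) by (auto simp: contr_def)
  have NN': "N' = N * (adj X * X')" using X(3) X'(2) eq by (simp add: mm_assoc)
  have N'N: "N = N' * (adj X' * X)" using X'(3) X(2) eq by (simp add: mm_assoc)
  have "min_entropy a c (reshape a b c N * adj (reshape a b c N)) = min_entropy a c' (reshape a b c' N' * adj (reshape a b c' N'))"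
  proof (rule order.antisym)
    show "min_entropy a c (reshape a b c N * adj (reshape a b c N)) \<le> min_entropy a c' (reshape a b c' N' * adj (reshape a b c' N'))"
      using min_entropy_isometry_le[OF N contr_mult[OF contr_adj[OF X(1)] X'(1)] c'] NN' by simp
    show "min_entropy a c' (reshape a b c' N' * adj (reshape a b c' N')) \<le> min_entropy a c (reshape a b c N * adj (reshape a b c N))"
      using min_entropy_isometry_le[OF N' contr_mult[OF contr_adj[OF X'(1)] X(1)] c] N'N by simp
  qed
  then show "h = - min_entropy a c (reshape a b c N * adj (reshape a b c N))"
    using h N' by (simp add: ptrace_mid_vec_of)
qed

subsection \<open>One-shot bounds from spectral projections\<close>

lemma psd_scaled_trans:
  assumes "psd_mat d (complex_of_real r \<cdot>\<^sub>m B - A)" "psd_mat d (complex_of_real s \<cdot>\<^sub>m C - B)" "0 \<le> r"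
    "A \<in> carrier_mat d d" "B \<in> carrier_mat d d" "C \<in> carrier_mat d d"
  shows "psd_mat d (complex_of_real (r * s) \<cdot>\<^sub>m C - A)"
proof -
  have "psd_mat d (complex_of_real r \<cdot>\<^sub>m (complex_of_real s \<cdot>\<^sub>m C - B) + (complex_of_real r \<cdot>\<^sub>m B - A))"
    using assms by (intro psd_add psd_smult) auto
  also have "complex_of_real r \<cdot>\<^sub>m (complex_of_real s \<cdot>\<^sub>m C - B) + (complex_of_real r \<cdot>\<^sub>m B - A) =
      complex_of_real (r * s) \<cdot>\<^sub>m C - A"
    using assms(4-6) by (intro eq_matI) (auto simp: algebra_simps)
  finally show ?thesis .
qed

lemma psd_spec_minus_smult:
  assumes "unitary_mat n U" "\<And>i. i < n \<Longrightarrow> y i \<le> r * x i"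
  shows "psd_mat n (complex_of_real r \<cdot>\<^sub>m spec n U x - spec n U y)"
  unfolding spec_smult[OF assms(1)] spec_minus[OF assms(1)]
  using assms by (intro psd_spec) auto

lemma contr_spec_ind:
  assumes "unitary_mat n U" shows "contr n n (spec n U (\<lambda>i. if i \<in> S then 1 else 0))"
  by (rule contr_projection)
    (auto simp: assms spec_carrier spec_mult[OF assms] intro!: spec_cong)

lemma fro_spec:
  assumes "unitary_mat n U" shows "fro (spec n U x) = (\<Sum>i<n. (x i)\<^sup>2)"
  by (simp add: fro_trace(2) assms spec_mult[OF assms] tr_spec[OF assms] power2_eq_square)

text \<open>The one-shot setting: \<open>plo\<close> and \<open>phi\<close> enclose the eigenvalues
  of \<rho> selected by \<open>S\<close>, \<open>qlo\<close> and \<open>qhi\<close> those of its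
  marginal selected by \<open>T\<close>, and \<eta> bounds both discarded weights. The i.i.d.
  structure enters later, only through the values of these five numbers.\<close>

locale typical_projections =
  fixes a b :: nat and \<rho> U V :: "complex mat" and x y :: "nat \<Rightarrow> real" and S T :: "nat set"
    and plo phi qlo qhi \<eta> :: real
  assumes U: "unitary_mat (a * b) U" and \<rho>: "\<rho> = spec (a * b) U x"
    and V: "unitary_mat b V" and \<beta>: "ptrace_mid 1 a b \<rho> = spec b V y"
    and x0: "\<And>i. i < a * b \<Longrightarrow> 0 \<le> x i" and y0: "\<And>i. i < b \<Longrightarrow> 0 \<le> y i"
    and x1: "(\<Sum>i<a * b. x i) = 1" and y1: "(\<Sum>i<b. y i) = 1"
    and S: "\<And>i. i < a * b \<Longrightarrow> i \<in> S \<Longrightarrow> plo \<le> x i" "\<And>i. i < a * b \<Longrightarrow> i \<in> S \<Longrightarrow> x i \<le> phi"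
    and T: "\<And>i. i < b \<Longrightarrow> i \<in> T \<Longrightarrow> qlo \<le> y i" "\<And>i. i < b \<Longrightarrow> i \<in> T \<Longrightarrow> y i \<le> qhi"
    and xS: "(\<Sum>i<a * b. if i \<in> S then 0 else x i) \<le> \<eta>"
    and yT: "(\<Sum>i<b. if i \<in> T then 0 else y i) \<le> \<eta>"
    and plo: "0 < plo" and phi: "0 < phi" and qlo: "0 < qlo" and qhi: "0 < qhi"
begin

definition "P = spec (a * b) U (\<lambda>i. if i \<in> S then 1 else 0)"
definition "Q = spec b V (\<lambda>i. if i \<in> T then 1 else 0)"
definition "R = kr a Q"
definition "r = spec (a * b) U (\<lambda>i. sqrt (x i))"
definition "\<beta>0 = spec b V y"

lemma dims [simp]:
  "dim_row P = a * b" "dim_col P = a * b" "dim_row Q = b" "dim_col Q = b"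
  "dim_row R = a * b" "dim_col R = a * b" "dim_row r = a * b" "dim_col r = a * b"
  "dim_row \<rho> = a * b" "dim_col \<rho> = a * b" "dim_row \<beta>0 = b" "dim_col \<beta>0 = b"
  using U V by (auto simp: P_def Q_def R_def r_def \<rho> \<beta>0_def)

lemma adjs [simp]: "adj P = P" "adj Q = Q" "adj R = R" "adj r = r" "adj \<beta>0 = \<beta>0" "adj \<rho> = \<rho>"
  using U V by (auto simp: P_def Q_def R_def r_def \<beta>0_def kr_adj \<rho>)

lemma carriers [simp]:
  "P \<in> carrier_mat (a * b) (a * b)" "Q \<in> carrier_mat b b" "R \<in> carrier_mat (a * b) (a * b)"
  "r \<in> carrier_mat (a * b) (a * b)" "\<beta>0 \<in> carrier_mat b b" "\<rho> \<in> carrier_mat (a * b) (a * b)"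
  by (auto intro!: carrier_matI)

lemma PP: "P * P = P" and QQ: "Q * Q = Q" and rr: "r * r = \<rho>" and Pr: "P * r = r * P"
  unfolding P_def Q_def r_def \<rho> spec_mult[OF U] spec_mult[OF V] using x0
  by (auto intro!: spec_cong)

lemma RR: "R * R = R" by (simp add: R_def kr_mult QQ)

lemma contr_P: "contr (a * b) (a * b) P" unfolding P_def by (rule contr_spec_ind[OF U])
lemma contr_R: "contr (a * b) (a * b) R" by (rule contr_projection) (auto simp: RR)

lemma psd_\<rho>: "psd_mat (a * b) \<rho>" unfolding \<rho> using x0 by (rule psd_spec[OF U])
lemma psd_\<beta>0: "psd_mat b \<beta>0" unfolding \<beta>0_def using y0 by (rule psd_spec[OF V])
lemma sqrt_\<rho>: "mat_sqrt \<rho> = r" unfolding \<rho> r_def by (rule mat_sqrt_spec[OF U])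
lemma \<beta>0_state: "\<beta>0 \<in> states b"
  using psd_\<beta>0 y1 by (auto simp: states_def \<beta>0_def tr_spec[OF V])
lemma ab_pos: "a * b > 0" using x1 by (rule_tac ccontr) auto

lemma fro_r: "fro r = 1"
  unfolding r_def fro_spec[OF U] using x0 x1 by simp

lemma eta_nonneg: "0 \<le> \<eta>" using xS x0 by (intro order.trans[OF _ xS] sum_nonneg) auto

lemma fro_r_P: "fro (r - r * P) \<le> \<eta>"
proof -
  have "r - r * P = spec (a * b) U (\<lambda>i. if i \<in> S then 0 else sqrt (x i))"
    unfolding r_def P_def spec_mult[OF U] spec_minus[OF U] by (intro spec_cong) auto
  then have "fro (r - r * P) = (\<Sum>i<a * b. if i \<in> S then 0 else x i)"
    unfolding fro_spec[OF U] \<open>r - r * P = _\<close> using x0 by (auto simp: fro_spec[OF U] intro!: sum.cong)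
  then show ?thesis using xS by simp
qed

text \<open>As \<open>R\<close> is a projection, the squared distance is 1 minus the trace of
  \<open>\<rho> * R\<close>, a weight that depends only on the marginal on B.\<close>

lemma fro_r_R: "fro (r - r * R) \<le> \<eta>"
proof -
  have "(r - r * R) * adj (r - r * R) = r * r - r * (R * r) - (r * (R * r) - r * ((R * R) * r))"
    by (simp add: mat_alg)
  also have "\<dots> = r * r - r * (R * r)"
    unfolding RR by (intro eq_matI) (auto simp del: index_mult_mat(1))
  finally have "fro (r - r * R) = Re (mat_trace (r * r - r * (R * r)))"
    by (simp add: fro_trace(2))
  also have "mat_trace (r * r - r * (R * r)) = mat_trace \<rho> - mat_trace (r * (R * r))"
    by (simp add: tr_minus rr)
  also have "mat_trace (r * (R * r)) = mat_trace (R * r * r)" by (rule tr_comm) auto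
  also have "R * r * r = R * \<rho>" by (simp add: mm_assoc rr)
  also have "mat_trace (R * \<rho>) = mat_trace (\<rho> * R)" by (rule tr_comm) auto
  also have "\<dots> = mat_trace (\<beta>0 * Q)" unfolding R_def tr_mult_kr[OF carriers(6) carriers(2)] \<beta> \<beta>0_def ..
  also have "\<beta>0 * Q = spec b V (\<lambda>i. y i - (if i \<in> T then 0 else y i))"
    unfolding \<beta>0_def Q_def spec_mult[OF V] by (intro spec_cong) auto
  also have "mat_trace \<rho> = 1" by (simp add: \<rho> tr_spec[OF U] x1)
  finally have "fro (r - r * R) = (\<Sum>i<b. if i \<in> T then 0 else y i)"
    by (simp add: tr_spec[OF V] sum_subtractf y1)
  then show ?thesis using yT by simp
qed

text \<open>Because \<open>P\<close> commutes with \<open>r\<close>, the difference splits as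
  \<open>(r - r * P) + P * (r - r * R)\<close>, and the contraction \<open>P\<close> does not
  increase the second norm.\<close>

lemma fro_r_PR: "sqrt (fro (r - r * (P * R))) \<le> 2 * sqrt \<eta>"
proof -
  have "r - r * (P * R) = (r - r * P) + P * (r - r * R)"
    by (simp add: mat_alg) (rule eq_matI, auto simp: Pr[symmetric] mm_assoc[symmetric] simp del: index_mult_mat(1))
  then have "sqrt (fro (r - r * (P * R))) \<le> sqrt (fro (r - r * P)) + sqrt (fro (P * (r - r * R)))"
    by (simp add: fro_triangle)
  also have "\<dots> \<le> sqrt \<eta> + sqrt \<eta>"
  proof (intro add_mono real_sqrt_le_mono)
    have "r - r * R \<in> carrier_mat (a * b) (a * b)" by (auto intro!: carrier_matI)
    from contr_fro[OF contr_P this] fro_r_R show "fro (P * (r - r * R)) \<le> \<eta>" by simp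
  qed (rule fro_r_P)
  finally show ?thesis by simp
qed

text \<open>Common start of both converses: in the trace expressing the fidelity, \<open>r\<close>
  is replaced by \<open>r * P * R\<close> at a cost of at most twice the root of \<eta>.\<close>

lemma fidelity_typical_bound:
  assumes "\<tau> \<in> eps_ball (a * b) \<epsilon> \<rho>" "0 < \<epsilon>" "\<epsilon> < 1"
  obtains W where "contr (a * b) (a * b) W"
    "sqrt (1 - \<epsilon>\<^sup>2) - 2 * sqrt \<eta> \<le> cmod (mat_trace (W * r * P * R * mat_sqrt \<tau>))"
proof -
  have t: "psd_mat (a * b) \<tau>" "Re (mat_trace \<tau>) \<le> 1" "C_dist \<rho> \<tau> \<le> \<epsilon>"
    using assms(1) by (auto simp: eps_ball_def substates_def)
  let ?t = "mat_sqrt \<tau>" and ?F = "fidelity \<rho> \<tau>"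
  note t' = psd_mat_sqrt[OF t(1)]
  have [simp]: "dim_row ?t = a * b" "dim_col ?t = a * b" "adj ?t = ?t" 
    using psd_dims[OF t'(1)] psd_adj[OF t'(1)] by auto
  have "1 - ?F\<^sup>2 \<le> \<epsilon>\<^sup>2" using t(3) assms(2) unfolding C_dist_def by (metis real_sqrt_le_iff real_sqrt_abs abs_of_pos)
  then have F: "sqrt (1 - \<epsilon>\<^sup>2) \<le> ?F"
    using fidelity_nonneg[OF psd_\<rho> t(1)] by (intro real_le_lsqrt) auto
  obtain W where W: "contr (a * b) (a * b) W" "complex_of_real ?F = mat_trace (W * r * ?t)"
    using fidelity_attained[OF psd_\<rho> t(1)] unfolding sqrt_\<rho> by blast
  have [simp]: "dim_row W = a * b" "dim_col W = a * b" using W by (auto simp: contr_def)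
  let ?X = "W * (r - r * (P * R))"
  have 1: "mat_trace (W * r * ?t) = mat_trace (?X * ?t) + mat_trace (W * r * P * R * ?t)"
  proof -
    have "W * r * ?t = ?X * ?t + W * r * P * R * ?t"
      by (simp add: mat_alg) (rule eq_matI, auto simp del: index_mult_mat(1))
    then show ?thesis by (simp add: tr_add)
  qed
  have "cmod (mat_trace (?X * ?t)) \<le> sqrt (fro ?X) * sqrt (fro ?t)"
    by (rule tr_cauchy_schwarz') auto
  also have "\<dots> \<le> (2 * sqrt \<eta>) * 1"
  proof (rule mult_mono)
    have "fro ?X \<le> fro (r - r * (P * R))" by (rule contr_fro[OF W(1), of _ "a * b"]) (auto intro!: carrier_matI)
    then show "sqrt (fro ?X) \<le> 2 * sqrt \<eta>" using fro_r_PR real_sqrt_le_mono order.trans by blast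
    have "fro ?t = Re (mat_trace \<tau>)" by (simp add: fro_trace t'(2))
    then show "sqrt (fro ?t) \<le> 1" using t(2) by simp
  qed (use eta_nonneg in auto)
  finally have "cmod (mat_trace (?X * ?t)) \<le> 2 * sqrt \<eta>" by simp
  moreover have "?F \<le> cmod (mat_trace (?X * ?t)) + cmod (mat_trace (W * r * P * R * ?t))"
    using norm_triangle_ineq[of "mat_trace (?X * ?t)" "mat_trace (W * r * P * R * ?t)"]
      arg_cong[OF W(2), of cmod] unfolding 1 by simp
  ultimately show ?thesis using F W(1) that by fastforce
qed

text \<open>Cauchy--Schwarz puts the contraction and \<open>r\<close> into a factor of norm at most
  1, so the squared overlap is at most the trace of \<open>R * P * R * \<tau>\<close>. Three
  operator inequalities follow: \<tau> below its bound \<open>s\<close>, \<open>P\<close> below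
  \<open>\<rho>\<close> divided by \<open>plo\<close>, and the cut-down marginal below
  \<open>qhi\<close>.\<close>

lemma min_converse:
  assumes "\<tau> \<in> eps_ball (a * b) \<epsilon> \<rho>" "0 < \<epsilon>" "\<epsilon> < 1" "2 * sqrt \<eta> < sqrt (1 - \<epsilon>\<^sup>2)"
  shows "min_entropy a b \<tau> \<le> ereal (log 2 (qhi / plo) - 2 * log 2 (sqrt (1 - \<epsilon>\<^sup>2) - 2 * sqrt \<eta>))"
proof (rule min_entropy_le)
  fix \<omega> s assume \<omega>: "\<omega> \<in> states b" and s: "0 < s" and p: "psd_mat (a * b) (complex_of_real s \<cdot>\<^sub>m kr a \<omega> - \<tau>)"
  let ?c = "sqrt (1 - \<epsilon>\<^sup>2) - 2 * sqrt \<eta>" and ?t = "mat_sqrt \<tau>"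
  have c: "0 < ?c" using assms by simp
  have t: "psd_mat (a * b) \<tau>" using assms(1) by (auto simp: eps_ball_def substates_def)
  note t' = psd_mat_sqrt[OF t]
  have [simp]: "dim_row ?t = a * b" "dim_col ?t = a * b" "adj ?t = ?t" "dim_row \<tau> = a * b" "dim_col \<tau> = a * b"
    using psd_dims[OF t'(1)] psd_adj[OF t'(1)] psd_dims[OF t] by auto
  have wp: "psd_mat b \<omega>" and w1: "mat_trace \<omega> = 1" using \<omega> by (auto simp: states_def)
  have [simp]: "dim_row \<omega> = b" "dim_col \<omega> = b" "adj \<omega> = \<omega>" using psd_dims[OF wp] psd_adj[OF wp] by auto
  obtain W where W: "contr (a * b) (a * b) W" "?c \<le> cmod (mat_trace (W * r * P * R * ?t))"
    using fidelity_typical_bound[OF assms(1-3)] by blast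
  have [simp]: "dim_row W = a * b" "dim_col W = a * b" using W by (auto simp: contr_def)
  have "mat_trace (W * r * P * R * ?t) = mat_trace ((W * r) * (P * R * ?t))" by (simp add: mm_assoc)
  also have "cmod \<dots> \<le> sqrt (fro (W * r)) * sqrt (fro (P * R * ?t))"
    by (rule tr_cauchy_schwarz') auto
  also have "\<dots> \<le> 1 * sqrt (fro (P * R * ?t))"
    using contr_fro[OF W(1), of r "a * b"] fro_r by (intro mult_right_mono) auto
  finally have "?c \<le> sqrt (fro (P * R * ?t))" using W(2) by simp
  then have "?c\<^sup>2 \<le> (sqrt (fro (P * R * ?t)))\<^sup>2" using c by (intro power_mono) auto
  then have 1: "?c\<^sup>2 \<le> fro (P * R * ?t)" by simp
  have psdRPR: "psd_mat (a * b) (R * P * R)"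
  proof -
    have "R * P * R = (R * P) * adj (R * P)" by (simp add: mat_alg) (metis PP dims(1,2) mm_assoc dims(5,6) index_mult_mat(2,3))
    then show ?thesis using psd_mult_adj[of "R * P" "a * b" "a * b"] by (simp add: carrier_matI)
  qed
  have "fro (P * R * ?t) = Re (mat_trace (?t * (R * (P * P) * R * ?t)))"
    by (simp add: fro_trace mat_alg)
  also have "mat_trace (?t * (R * (P * P) * R * ?t)) = mat_trace (R * (P * P) * R * ?t * ?t)"
    by (rule tr_comm) auto
  also have "R * (P * P) * R * ?t * ?t = R * P * R * (?t * ?t)"
    unfolding PP by (simp add: mm_assoc)
  also have "\<dots> = R * P * R * \<tau>" by (simp only: t'(2))
  also have "Re (mat_trace (R * P * R * \<tau>)) \<le> Re (mat_trace (R * P * R * (complex_of_real s \<cdot>\<^sub>m kr a \<omega>)))"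
    by (rule tr_mono[OF p psdRPR psd_carrier[OF t]]) (auto intro!: carrier_matI)
  also have "\<dots> = s * Re (mat_trace (R * P * R * kr a \<omega>))"
    by (simp add: mm_smult_right tr_smult)
  \<comment> \<open>\<open>R\<close> must be moved onto \<omega> before \<open>P\<close> is enlarged
    to \<rho>; the trace then reduces to B, with \<open>Q\<close> on both sides of the
    marginal.\<close>
  also have "mat_trace (R * P * R * kr a \<omega>) = mat_trace (kr a (Q * \<omega> * Q) * P)"
  proof -
    have "mat_trace (R * P * R * kr a \<omega>) = mat_trace ((R * P) * (R * kr a \<omega>))" by (simp add: mm_assoc)
    also have "\<dots> = mat_trace ((R * kr a \<omega>) * (R * P))" by (rule tr_comm) auto
    also have "(R * kr a \<omega>) * (R * P) = (R * kr a \<omega> * R) * P" by (simp add: mm_assoc)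
    also have "R * kr a \<omega> * R = kr a (Q * \<omega> * Q)" by (simp add: R_def kr_mult)
    finally show ?thesis .
  qed
  also have "Re \<dots> \<le> Re (mat_trace (kr a (Q * \<omega> * Q) * (complex_of_real (1 / plo) \<cdot>\<^sub>m \<rho>)))"
  proof (rule tr_mono)
    show "psd_mat (a * b) (complex_of_real (1 / plo) \<cdot>\<^sub>m \<rho> - P)"
      unfolding \<rho> P_def using S(1) plo x0 by (intro psd_spec_minus_smult[OF U]) (auto simp: field_simps)
    show "psd_mat (a * b) (kr a (Q * \<omega> * Q))"
      using psd_conj[OF wp, of Q b] by (intro psd_kr) simp
  qed (auto intro!: carrier_matI)
  also have "\<dots> = (1 / plo) * Re (mat_trace (kr a (Q * \<omega> * Q) * \<rho>))"
    by (simp add: mm_smult_right tr_smult)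
  also have "mat_trace (kr a (Q * \<omega> * Q) * \<rho>) = mat_trace (\<rho> * kr a (Q * \<omega> * Q))" by (rule tr_comm) auto
  also have "\<dots> = mat_trace (\<beta>0 * (Q * \<omega> * Q))"
    by (subst tr_mult_kr) (auto simp: \<beta> \<beta>0_def[symmetric] simp del: One_nat_def intro!: carrier_matI)
  also have "\<beta>0 * (Q * \<omega> * Q) = (\<beta>0 * Q) * (\<omega> * Q)" by (simp add: mm_assoc)
  also have "mat_trace \<dots> = mat_trace (\<omega> * Q * (\<beta>0 * Q))" by (rule tr_comm) auto
  also have "\<omega> * Q * (\<beta>0 * Q) = \<omega> * (Q * \<beta>0 * Q)" by (simp add: mm_assoc)
  \<comment> \<open>Without the surrounding \<open>Q\<close> the marginal would be bounded only by
    its largest eigenvalue; with it the bound is \<open>qhi\<close>.\<close>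
  also have "Re (mat_trace \<dots>) \<le> Re (mat_trace (\<omega> * (complex_of_real qhi \<cdot>\<^sub>m 1\<^sub>m b)))"
  proof (rule tr_mono[OF _ wp])
    have "Q * \<beta>0 * Q = spec b V (\<lambda>i. if i \<in> T then y i else 0)"
      unfolding Q_def \<beta>0_def spec_mult[OF V] by (intro spec_cong) auto
    then show "psd_mat b (complex_of_real qhi \<cdot>\<^sub>m 1\<^sub>m b - Q * \<beta>0 * Q)"
      unfolding spec_one[OF V, symmetric] using T qhi
      by (simp only:, intro psd_spec_minus_smult[OF V]) auto
  qed (auto intro!: carrier_matI)
  also have "mat_trace (\<omega> * (complex_of_real qhi \<cdot>\<^sub>m 1\<^sub>m b)) = complex_of_real qhi"
    by (simp add: mm_smult_right mm_one_right tr_smult w1)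
  finally have "?c\<^sup>2 \<le> s * (1 / plo * qhi)" using 1 s plo by (simp add: mult_left_mono divide_right_mono)
  moreover have "0 < ?c\<^sup>2" using c by (simp only: zero_less_power)
  ultimately have "log 2 (?c\<^sup>2) \<le> log 2 (s * (qhi / plo))" by (intro log_mono) auto
  moreover have "log 2 (?c\<^sup>2) = 2 * log 2 ?c" using c by (simp add: log_nat_power)
  moreover have "log 2 (s * (qhi / plo)) = log 2 s + log 2 (qhi / plo)" using s qhi plo by (intro log_mult_pos) auto
  ultimately show "ereal (- log 2 s) \<le> ereal (log 2 (qhi / plo) - 2 * log 2 ?c)" by simp
qed

definition "\<tau>0 = R * (P * \<rho> * P) * R"

text \<open>This factor serves as a purification of \<open>\<tau>0\<close>; its overlap with
  \<open>r\<close> bounds the fidelity from below.\<close>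

lemma \<tau>0_eq: "\<tau>0 = (R * P * r) * adj (R * P * r)"
proof -
  have "(R * P * r) * adj (R * P * r) = R * (P * (r * r) * P) * R" by (simp add: mat_alg)
  then show ?thesis by (simp add: \<tau>0_def rr)
qed

lemma \<tau>0_ball:
  assumes "0 < \<epsilon>" "\<epsilon> < 1" "4 * sqrt \<eta> \<le> \<epsilon>\<^sup>2"
  shows "\<tau>0 \<in> eps_ball (a * b) \<epsilon> \<rho>"
proof -
  let ?K = "R * P * r"
  have K: "?K \<in> carrier_mat (a * b) (a * b)" by (auto intro!: carrier_matI)
  have "fro ?K = fro (R * (P * r))" by (simp add: mm_assoc)
  also have "\<dots> \<le> fro (P * r)" by (rule contr_fro[OF contr_R, of _ "a * b"]) (auto intro!: carrier_matI)
  also have "\<dots> \<le> 1" using contr_fro[OF contr_P, of r "a * b"] fro_r by simp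
  finally have "fro ?K \<le> 1" .
  then have sub: "\<tau>0 \<in> substates (a * b)"
    using psd_mult_adj[OF K] by (simp add: substates_def \<tau>0_eq tr_mult_adj_self)
  have 1: "cmod (mat_trace (adj r * ?K)) \<le> fidelity \<rho> \<tau>0"
    using fidelity_ge[OF carriers(4) K] by (simp add: \<tau>0_eq rr)
  let ?X = "r - r * (P * R)"
  have "adj ?X = r - R * P * r" by (simp add: mat_alg)
  then have "mat_trace (adj r * ?K) = mat_trace (r * r) - mat_trace (r * adj ?X)"
    by (simp add: mm_minus_right tr_minus)
  moreover have "mat_trace (r * r) = 1" using tr_mult_adj_self[of r] fro_r by simp
  ultimately have "1 - cmod (mat_trace (r * adj ?X)) \<le> cmod (mat_trace (adj r * ?K))"
    using norm_triangle_ineq2[of 1 "mat_trace (r * adj ?X)"] by simp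
  moreover have "cmod (mat_trace (r * adj ?X)) \<le> sqrt (fro r) * sqrt (fro (adj ?X))"
    by (rule tr_cauchy_schwarz') auto
  ultimately have F: "1 - 2 * sqrt \<eta> \<le> fidelity \<rho> \<tau>0"
    using 1 fro_r_PR by (simp add: fro_r)
  have "\<epsilon>\<^sup>2 < 1" using assms by (simp add: power_less_one_iff abs_square_less_1)
  \<comment> \<open>Origin of the hypothesis with the constant 4: a fidelity of at least 1 minus
    twice the root of \<eta> has square at least 1 minus four times that root.\<close>
  then have "1 - 4 * sqrt \<eta> \<le> (1 - 2 * sqrt \<eta>)\<^sup>2" "0 \<le> 1 - 2 * sqrt \<eta>"
    using assms eta_nonneg by (auto simp: power2_diff)
  then have "1 - \<epsilon>\<^sup>2 \<le> (fidelity \<rho> \<tau>0)\<^sup>2"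
    using power_mono[OF F, of 2] assms by linarith
  then have "C_dist \<rho> \<tau>0 \<le> \<epsilon>" unfolding C_dist_def using assms by (intro real_le_lsqrt) auto
  then show ?thesis using sub by (simp add: eps_ball_def)
qed

text \<open>The conditioning state is the marginal of \<rho> itself, not that of
  \<open>\<tau>0\<close>: on the range of \<open>Q\<close> its eigenvalues are at least
  \<open>qlo\<close>.\<close>

lemma min_direct: "ereal (- log 2 (phi / qlo)) \<le> min_entropy a b \<tau>0"
proof (rule min_entropy_ge[OF \<beta>0_state])
  show "0 < phi / qlo" using phi qlo by simp
  have "P * \<rho> * P = spec (a * b) U (\<lambda>i. if i \<in> S then x i else 0)"
    unfolding P_def \<rho> spec_mult[OF U] by (intro spec_cong) auto
  then have "psd_mat (a * b) (complex_of_real phi \<cdot>\<^sub>m 1\<^sub>m (a * b) - P * \<rho> * P)"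
    unfolding spec_one[OF U, symmetric] using S phi
    by (simp only:, intro psd_spec_minus_smult[OF U]) auto
  then have "psd_mat (a * b) (R * (complex_of_real phi \<cdot>\<^sub>m 1\<^sub>m (a * b) - P * \<rho> * P) * adj R)"
    by (rule psd_conj) simp
  also have "R * (complex_of_real phi \<cdot>\<^sub>m 1\<^sub>m (a * b) - P * \<rho> * P) * adj R = complex_of_real phi \<cdot>\<^sub>m kr a Q - \<tau>0"
    by (simp add: mat_alg \<tau>0_def RR R_def[symmetric])
  finally have 1: "psd_mat (a * b) (complex_of_real phi \<cdot>\<^sub>m kr a Q - \<tau>0)" .
  have "psd_mat b (complex_of_real (1 / qlo) \<cdot>\<^sub>m \<beta>0 - Q)"
    unfolding \<beta>0_def Q_def using T(1) qlo y0 by (intro psd_spec_minus_smult[OF V]) (auto simp: field_simps)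
  then have "psd_mat (a * b) (kr a (complex_of_real (1 / qlo) \<cdot>\<^sub>m \<beta>0 - Q))" by (rule psd_kr)
  then have 2: "psd_mat (a * b) (complex_of_real (1 / qlo) \<cdot>\<^sub>m kr a \<beta>0 - kr a Q)"
    by (simp add: kron_minus kron_smult)
  have "psd_mat (a * b) (complex_of_real (phi * (1 / qlo)) \<cdot>\<^sub>m kr a \<beta>0 - \<tau>0)"
    using phi by (intro psd_scaled_trans[OF 1 2]) (auto simp: \<tau>0_def intro!: carrier_matI)
  then show "psd_mat (a * b) (complex_of_real (phi / qlo) \<cdot>\<^sub>m kr a \<beta>0 - \<tau>0)" by simp
qed

text \<open>\<open>\<tau>0\<close> is purified with the eigenvalue index of \<rho> as system C.
  There \<open>P\<close> acts as the diagonal projection \<open>?DS\<close>, and the conditioning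
  state is the diagonal matrix of the eigenvalues \<open>x\<close>.\<close>

lemma max_direct: "max_entropy a b \<tau>0 \<le> ereal (log 2 (qhi / plo))"
proof -
  let ?d = "a * b"
  let ?D = "\<lambda>z. mat_diag ?d (\<lambda>i. complex_of_real (z i))"
  let ?DS = "?D (\<lambda>i. if i \<in> S then 1 else 0)" and ?Dx = "?D (\<lambda>i. sqrt (x i))"
  note u = unitary_matD[OF U]
  note [simp] = u(2,3)
  define A where "A = U * ?Dx"
  define L where "L = R * A * ?DS"
  define G where "G = reshape a b ?d L"
  define G0 where "G0 = reshape a b ?d (R * A)"
  have A [simp]: "A \<in> carrier_mat ?d ?d" "dim_row A = ?d" "dim_col A = ?d" by (auto simp: A_def intro!: carrier_matI)
  have AA: "A * adj A = \<rho>"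
  proof -
    have "A * adj A = U * (?Dx * ?Dx) * adj U" by (simp add: A_def mat_alg del: mat_diag_diag)
    also have "\<dots> = spec ?d U (\<lambda>i. sqrt (x i) * sqrt (x i))"
      by (simp only: spec_def mat_diag_diag of_real_mult)
    finally show ?thesis unfolding \<rho> using x0 by (auto intro!: spec_cong)
  qed
  have LL: "L * adj L = \<tau>0"
  proof -
    \<comment> \<open>A projection applied to the purifying index equals \<open>P\<close> applied to
      AB; this rests on \<open>P\<close> and \<rho> being diagonal in the same basis.\<close>
    have *: "A * ?DS = P * r * U"
    proof -
      have "P * r = spec ?d U (\<lambda>i. sqrt (x i) * (if i \<in> S then 1 else 0))"
        unfolding P_def r_def spec_mult[OF U] by (intro spec_cong) auto
      also have "\<dots> = U * (?Dx * ?DS) * adj U" by (simp only: spec_def mat_diag_diag of_real_mult)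
      finally show ?thesis
        by (simp add: A_def mm_assoc u(4) mm_one_right del: mat_diag_diag)
    qed
    have "L * adj L = R * (A * ?DS) * adj (R * (A * ?DS))" by (simp add: L_def mm_assoc)
    also have "\<dots> = R * P * r * (U * adj U) * adj (R * P * r)"
      unfolding * by (simp add: mat_alg)
    also have "\<dots> = \<tau>0" unfolding \<tau>0_eq u(5) by (simp add: mm_one_right)
    finally show ?thesis .
  qed
  have L: "L \<in> carrier_mat ?d ?d" by (auto simp: L_def intro!: carrier_matI)
  have RA: "R * A \<in> carrier_mat ?d ?d" by (auto intro!: carrier_matI)
  have tDS: "transpose_mat ?DS = ?DS" by (rule eq_matI) (auto simp: mat_diag_index)
  have G: "G = kr a ?DS * G0"
    unfolding G_def G0_def L_def using reshape_mult_right[OF RA, of ?DS ?d] by (simp add: tDS)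
  have [simp]: "dim_row G0 = a * ?d" "dim_col G0 = b" by (auto simp: G0_def)
  have "G0 = reshape a b ?d A * transpose_mat Q"
    unfolding G0_def R_def by (rule reshape_mult_left) auto
  then have "adj G0 * G0 = transpose_mat Q * (adj (reshape a b ?d A) * reshape a b ?d A) * transpose_mat Q"
    by (simp add: mat_alg adj_transpose)
  also have "\<dots> = transpose_mat Q * transpose_mat \<beta>0 * transpose_mat Q"
    unfolding reshape_gram[OF A(1)] AA \<beta> \<beta>0_def ..
  also have "\<dots> = transpose_mat (Q * \<beta>0 * Q)" by (simp add: transpose_mult_mat mm_assoc)
  finally have gram: "adj G0 * G0 = transpose_mat (Q * \<beta>0 * Q)" .
  have "Q * \<beta>0 * Q = spec b V (\<lambda>i. if i \<in> T then y i else 0)"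
    unfolding Q_def \<beta>0_def spec_mult[OF V] by (intro spec_cong) auto
  then have "psd_mat b (complex_of_real qhi \<cdot>\<^sub>m 1\<^sub>m b - Q * \<beta>0 * Q)"
    unfolding spec_one[OF V, symmetric] using T qhi
    by (simp only:, intro psd_spec_minus_smult[OF V]) auto
  then have "psd_mat b (transpose_mat (complex_of_real qhi \<cdot>\<^sub>m 1\<^sub>m b - Q * \<beta>0 * Q))" by (rule psd_transpose)
  also have "transpose_mat (complex_of_real qhi \<cdot>\<^sub>m 1\<^sub>m b - Q * \<beta>0 * Q) = complex_of_real qhi \<cdot>\<^sub>m 1\<^sub>m b - adj G0 * G0"
    unfolding gram by (rule eq_matI) (auto simp del: index_mult_mat(1))
  \<comment> \<open>The Gram matrix on B is at most \<open>qhi\<close>, hence so is the operator on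
    AC. \<open>?DS\<close> is applied only afterwards, so that this bound turns into a multiple of
    \<open>kr a ?DS\<close>.\<close>
  finally have "psd_mat (a * ?d) (complex_of_real qhi \<cdot>\<^sub>m 1\<^sub>m (a * ?d) - G0 * adj G0)"
    using qhi by (intro psd_flip[of _ _ b]) (auto intro!: carrier_matI)
  then have "psd_mat (a * ?d) (kr a ?DS * (complex_of_real qhi \<cdot>\<^sub>m 1\<^sub>m (a * ?d) - G0 * adj G0) * adj (kr a ?DS))"
    by (rule psd_conj) (auto intro!: carrier_matI)
  also have "kr a ?DS * (complex_of_real qhi \<cdot>\<^sub>m 1\<^sub>m (a * ?d) - G0 * adj G0) * adj (kr a ?DS) =
      complex_of_real qhi \<cdot>\<^sub>m (kr a ?DS * adj (kr a ?DS)) - G * adj G"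
    unfolding G by (simp add: mat_alg)
  also have "kr a ?DS * adj (kr a ?DS) = kr a ?DS"
  proof -
    have "?DS * ?DS = ?DS" by (rule eq_matI) (auto simp: mat_diag_index)
    then show ?thesis by (simp only: kr_adj adj_mat_diag kr_mult mat_diag_dims)
  qed
  finally have 1: "psd_mat (a * ?d) (complex_of_real qhi \<cdot>\<^sub>m kr a ?DS - G * adj G)" .
  \<comment> \<open>On \<open>S\<close> the eigenvalues are at least \<open>plo\<close>, so the
    projection \<open>?DS\<close> is at most the state divided by \<open>plo\<close>.\<close>
  have "psd_mat ?d (?D (\<lambda>i. (1 / plo) * x i - (if i \<in> S then 1 else 0)))"
    using S(1) x0 plo by (intro psd_diag) (auto simp: field_simps)
  also have "?D (\<lambda>i. (1 / plo) * x i - (if i \<in> S then 1 else 0)) = complex_of_real (1 / plo) \<cdot>\<^sub>m ?D x - ?DS"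
    by (rule eq_matI) (auto simp: mat_diag_index)
  finally have "psd_mat (a * ?d) (kr a (complex_of_real (1 / plo) \<cdot>\<^sub>m ?D x - ?DS))" by (rule psd_kr)
  then have 2: "psd_mat (a * ?d) (complex_of_real (1 / plo) \<cdot>\<^sub>m kr a (?D x) - kr a ?DS)"
    by (simp add: kron_minus kron_smult)
  have 3: "psd_mat (a * ?d) (complex_of_real (qhi / plo) \<cdot>\<^sub>m kr a (?D x) - G * adj G)"
    using psd_scaled_trans[OF 1 2] qhi by (simp add: G_def carrier_matI)
  have "?D x \<in> states ?d"
    using psd_diag[of ?d x] x0 x1 by (auto simp: states_def mat_trace_def mat_diag_index simp flip: of_real_sum)
  from min_entropy_ge[OF this _ 3] have "ereal (- log 2 (qhi / plo)) \<le> min_entropy a ?d (G * adj G)"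
    using qhi plo by simp
  then show ?thesis
    using max_entropy_eq[OF L ab_pos] unfolding LL G_def[symmetric]
    by (simp add: ereal_uminus_le_reorder)
qed

text \<open>The square root of \<tau> serves as purification of \<tau>. Read on AC against B, the
  overlap splits into a Hilbert--Schmidt factor controlled by the bound \<open>s\<close> and the
  factor \<open>Q\<close>, whose squared norm is its rank.\<close>

lemma max_converse:
  assumes "\<tau> \<in> eps_ball (a * b) \<epsilon> \<rho>" "0 < \<epsilon>" "\<epsilon> < 1" "2 * sqrt \<eta> < sqrt (1 - \<epsilon>\<^sup>2)"
  shows "ereal (- log 2 (phi / qlo) + 2 * log 2 (sqrt (1 - \<epsilon>\<^sup>2) - 2 * sqrt \<eta>)) \<le> max_entropy a b \<tau>"
proof -
  let ?c = "sqrt (1 - \<epsilon>\<^sup>2) - 2 * sqrt \<eta>" and ?t = "mat_sqrt \<tau>" and ?d = "a * b"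
  have c: "0 < ?c" using assms by simp
  have t: "psd_mat ?d \<tau>" using assms(1) by (auto simp: eps_ball_def substates_def)
  note t' = psd_mat_sqrt[OF t]
  have tC [simp]: "dim_row ?t = ?d" "dim_col ?t = ?d" "adj ?t = ?t" "?t \<in> carrier_mat ?d ?d"
    using psd_dims[OF t'(1)] psd_adj[OF t'(1)] by (auto intro!: carrier_matI)
  obtain W where W: "contr ?d ?d W" "?c \<le> cmod (mat_trace (W * r * P * R * ?t))"
    using fidelity_typical_bound[OF assms(1-3)] by blast
  have [simp]: "dim_row W = ?d" "dim_col W = ?d" using W by (auto simp: contr_def)
  define L where "L = R * (P * r * adj W)"
  have L [simp]: "L \<in> carrier_mat ?d ?d" "dim_row L = ?d" "dim_col L = ?d" by (auto simp: L_def intro!: carrier_matI)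
  have adjL: "adj L = W * r * P * R" by (simp add: L_def mat_alg)
  let ?G = "reshape a b ?d"
  have "min_entropy a ?d (?G ?t * adj (?G ?t)) \<le> ereal (log 2 (phi / qlo) - 2 * log 2 ?c)"
  proof (rule min_entropy_le)
    fix \<sigma> s assume \<sigma>: "\<sigma> \<in> states ?d" and s: "0 < s"
      and p: "psd_mat (a * ?d) (complex_of_real s \<cdot>\<^sub>m kr a \<sigma> - ?G ?t * adj (?G ?t))"
    have sp: "psd_mat ?d \<sigma>" and s1: "mat_trace \<sigma> = 1" using \<sigma> by (auto simp: states_def)
    have [simp]: "dim_row \<sigma> = ?d" "dim_col \<sigma> = ?d" "\<sigma> \<in> carrier_mat ?d ?d"
      using psd_dims[OF sp] psd_carrier[OF sp] by auto
    \<comment> \<open>The projection is doubled: one copy of \<open>R\<close> remains in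
      \<open>L\<close>, the other becomes the transposed \<open>Q\<close> on the right after
      reshaping.\<close>
    have "W * r * P * R * ?t = adj L * (R * ?t)"
      unfolding adjL using RR by (simp add: mm_assoc) (metis RR dims(5,6) mm_assoc tC(1))
    also have "mat_trace \<dots> = mat_trace (adj (?G L) * ?G (R * ?t))"
      by (rule reshape_inner[symmetric]) (auto intro!: carrier_matI)
    also have "?G (R * ?t) = ?G ?t * transpose_mat Q"
      unfolding R_def by (rule reshape_mult_left) auto
    also have "adj (?G L) * (?G ?t * transpose_mat Q) = (adj (?G L) * ?G ?t) * transpose_mat Q"
      by (simp add: mm_assoc)
    finally have "cmod (mat_trace (W * r * P * R * ?t)) \<le> sqrt (fro (adj (?G L) * ?G ?t)) * sqrt (fro Q)"
      using tr_cauchy_schwarz'[of "adj (?G L) * ?G ?t" "transpose_mat Q"] by (simp add: fro_transpose)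
    then have "?c \<le> sqrt (fro (adj (?G L) * ?G ?t) * fro Q)" using W(2) by (simp add: real_sqrt_mult)
    then have "?c\<^sup>2 \<le> (sqrt (fro (adj (?G L) * ?G ?t) * fro Q))\<^sup>2" using c by (intro power_mono) auto
    then have 1: "?c\<^sup>2 \<le> fro (adj (?G L) * ?G ?t) * fro Q" by simp
    \<comment> \<open>Counting argument: each selected eigenvalue is at least \<open>qlo\<close> and
      they sum to at most 1.\<close>
    have "fro Q * qlo = (\<Sum>i<b. if i \<in> T then qlo else 0)"
      unfolding Q_def fro_spec[OF V] by (auto simp: sum_distrib_right intro!: sum.cong)
    also have "\<dots> \<le> (\<Sum>i<b. y i)" using T(1) y0 by (intro sum_mono) auto
    finally have froQ: "fro Q \<le> 1 / qlo" using qlo by (simp add: y1 field_simps)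
    have "fro (adj (?G L) * ?G ?t) = Re (mat_trace (adj (?G L) * (?G ?t * adj (?G ?t)) * ?G L))"
      by (simp add: fro_trace(2) mat_alg)
    also have "\<dots> \<le> Re (mat_trace (adj (?G L) * (complex_of_real s \<cdot>\<^sub>m kr a \<sigma>) * ?G L))"
      using psd_matD[OF p, of "?G L" b] by (simp add: mat_alg tr_minus)
    also have "\<dots> = s * Re (mat_trace (adj (?G L) * (kr a \<sigma> * ?G L)))"
      by (simp add: mat_alg tr_smult)
    also have "kr a \<sigma> * ?G L = ?G (L * transpose_mat \<sigma>)"
      using reshape_mult_right[OF L(1), of "transpose_mat \<sigma>" ?d] by simp
    also have "mat_trace (adj (?G L) * ?G (L * transpose_mat \<sigma>)) = mat_trace (adj L * (L * transpose_mat \<sigma>))"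
      by (rule reshape_inner) (auto intro!: carrier_matI)
    \<comment> \<open>With \<open>A\<close> the root of the transposed \<sigma>, the trace is the
      squared norm of \<open>R * (P * r * adj W * A)\<close>. \<open>R\<close> and
      \<open>adj W\<close> are contractions, \<open>P * r\<close> contributes at most
      \<open>phi\<close>, and the squared norm of \<open>A\<close> is the trace of \<sigma>.\<close>
    also have "Re \<dots> \<le> phi"
    proof -
      define A where "A = mat_sqrt (transpose_mat \<sigma>)"
      have A: "psd_mat ?d A" "A * A = transpose_mat \<sigma>"
        using psd_mat_sqrt[OF psd_transpose[OF sp]] by (auto simp: A_def)
      have [simp]: "dim_row A = ?d" "dim_col A = ?d" "adj A = A" "A \<in> carrier_mat ?d ?d"
        using psd_dims[OF A(1)] psd_adj[OF A(1)] by (auto intro!: carrier_matI)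
      let ?Y = "adj W * A"
      have Y: "?Y \<in> carrier_mat ?d ?d" by (auto intro!: carrier_matI)
      have "mat_trace (adj L * (L * transpose_mat \<sigma>)) = mat_trace ((adj L * L * A) * A)"
        unfolding A(2)[symmetric] by (simp add: mm_assoc)
      also have "\<dots> = mat_trace (A * (adj L * L * A))" by (rule tr_comm) auto
      also have "\<dots> = mat_trace (adj (L * A) * (L * A))" by (simp add: mat_alg)
      also have "\<dots> = complex_of_real (fro (L * A))" by (rule tr_adj_mult_self)
      also have "L * A = R * (P * r * ?Y)" by (simp add: L_def mm_assoc)
      finally have "Re (mat_trace (adj L * (L * transpose_mat \<sigma>))) = fro (R * (P * r * ?Y))" by simp
      also have "\<dots> \<le> fro (P * r * ?Y)"
        by (rule contr_fro[OF contr_R, of _ ?d]) (auto intro!: carrier_matI)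
      also have "\<dots> \<le> phi * fro ?Y"
      proof -
        have "adj (P * r) * (P * r) = spec ?d U (\<lambda>i. if i \<in> S then x i else 0)"
          unfolding P_def r_def spec_mult[OF U] spec_adj[OF U] using x0 by (intro spec_cong) auto
        then have "psd_mat ?d (complex_of_real phi \<cdot>\<^sub>m 1\<^sub>m ?d - adj (P * r) * (P * r))"
          unfolding spec_one[OF U, symmetric] using S phi
          by (simp only:, intro psd_spec_minus_smult[OF U]) auto
        from psd_matD[OF this Y]
        have "0 \<le> Re (mat_trace (complex_of_real phi \<cdot>\<^sub>m (adj ?Y * ?Y) - adj (P * r * ?Y) * (P * r * ?Y)))"
          by (simp add: mat_alg)
        then show ?thesis by (simp add: tr_minus tr_smult tr_adj_mult_self del: adj_mult)
      qed
      also have "\<dots> \<le> phi * fro A"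
        using contr_fro[OF contr_adj[OF W(1)], of A ?d] phi by (intro mult_left_mono) auto
      also have "fro A = 1"
      proof -
        have "fro A = Re (mat_trace (A * A))" by (simp add: fro_trace)
        then show ?thesis by (simp add: A(2) tr_transpose s1)
      qed
      finally show ?thesis by simp
    qed
    finally have "fro (adj (?G L) * ?G ?t) \<le> s * phi" using s by simp
    then have "?c\<^sup>2 \<le> (s * phi) * (1 / qlo)"
      using 1 froQ s phi by (intro order.trans[OF 1] mult_mono) auto
    moreover have "0 < ?c\<^sup>2" using c by (simp only: zero_less_power)
    ultimately have "log 2 (?c\<^sup>2) \<le> log 2 (s * (phi / qlo))" by (intro log_mono) auto
    moreover have "log 2 (?c\<^sup>2) = 2 * log 2 ?c" using c by (simp add: log_nat_power)
    moreover have "log 2 (s * (phi / qlo)) = log 2 s + log 2 (phi / qlo)" using s phi qlo by (intro log_mult_pos) auto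
    ultimately show "ereal (- log 2 s) \<le> ereal (log 2 (phi / qlo) - 2 * log 2 ?c)" by simp
  qed
  then have "- ereal (log 2 (phi / qlo) - 2 * log 2 ?c) \<le> - min_entropy a ?d (?G ?t * adj (?G ?t))"
    by (simp only: ereal_minus_le_minus)
  also have "\<dots> = max_entropy a b \<tau>"
    using max_entropy_eq[OF tC(4) ab_pos] by (simp add: t'(2))
  finally show ?thesis by simp
qed

theorem smooth_bounds:
  assumes "0 < \<epsilon>" "\<epsilon> < 1" "4 * sqrt \<eta> \<le> \<epsilon>\<^sup>2" "2 * sqrt \<eta> < sqrt (1 - \<epsilon>\<^sup>2)"
  defines "c \<equiv> sqrt (1 - \<epsilon>\<^sup>2) - 2 * sqrt \<eta>"
  shows "ereal (- log 2 (phi / qlo)) \<le> smooth_min_entropy a b \<epsilon> \<rho>"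
    "smooth_min_entropy a b \<epsilon> \<rho> \<le> ereal (log 2 (qhi / plo) - 2 * log 2 c)"
    "ereal (- log 2 (phi / qlo) + 2 * log 2 c) \<le> smooth_max_entropy a b \<epsilon> \<rho>"
    "smooth_max_entropy a b \<epsilon> \<rho> \<le> ereal (log 2 (qhi / plo))"
proof -
  note ball = \<tau>0_ball[OF assms(1-3)]
  show "ereal (- log 2 (phi / qlo)) \<le> smooth_min_entropy a b \<epsilon> \<rho>"
    unfolding smooth_min_entropy_def using min_direct by (rule SUP_upper2[OF ball])
  show "smooth_max_entropy a b \<epsilon> \<rho> \<le> ereal (log 2 (qhi / plo))"
    unfolding smooth_max_entropy_def using max_direct by (rule INF_lower2[OF ball])
  show "smooth_min_entropy a b \<epsilon> \<rho> \<le> ereal (log 2 (qhi / plo) - 2 * log 2 c)"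
    unfolding smooth_min_entropy_def c_def using min_converse assms by (intro SUP_least) auto
  show "ereal (- log 2 (phi / qlo) + 2 * log 2 c) \<le> smooth_max_entropy a b \<epsilon> \<rho>"
    unfolding smooth_max_entropy_def c_def using max_converse assms by (intro INF_greatest) auto
qed

end

subsection \<open>Spectral decomposition of i.i.d. states\<close>

lemma unitary_kron:
  assumes "unitary_mat n U" "unitary_mat m V" shows "unitary_mat (n * m) (kron U V)"
  using unitary_matD[OF assms(1)] unitary_matD[OF assms(2)]
  by (auto simp: unitary_mat_def adj_kron kron_mult intro!: carrier_matI)

lemma kron_spec:
  assumes "unitary_mat n U" "unitary_mat m V"
  shows "kron (spec n U x) (spec m V y) = spec (n * m) (kron U V) (\<lambda>i. x (i div m) * y (i mod m))"
proof -
  let ?D = "\<lambda>n x. mat_diag n (\<lambda>i. complex_of_real (x i))"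
  note u = unitary_matD[OF assms(1)] and v = unitary_matD[OF assms(2)]
  have "kron (?D n x) (?D m y) = ?D (n * m) (\<lambda>i. x (i div m) * y (i mod m))"
  proof (rule eq_mat_prodI[of _ n m n m])
    fix i j k l assume ij: "i < n" "j < n" "k < m" "l < m"
    have "(i * m + k = j * m + l) = (i = j \<and> k = l)"
      using ij by (metis index_div index_mod)
    then show "kron (?D n x) (?D m y) $$ (i * m + k, j * m + l) =
        ?D (n * m) (\<lambda>i. x (i div m) * y (i mod m)) $$ (i * m + k, j * m + l)"
      using kron_index[of i "?D n x" j k "?D m y" l] ij
      by (auto simp: mat_diag_index index_lt)
  qed auto
  then have "spec (n * m) (kron U V) (\<lambda>i. x (i div m) * y (i mod m)) =
      kron U V * kron (?D n x) (?D m y) * kron (adj U) (adj V)"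
    by (simp only: spec_def adj_kron)
  also have "\<dots> = kron (U * ?D n x) (V * ?D m y) * kron (adj U) (adj V)"
    using u(3) v(3) by (subst kron_mult) auto
  also have "\<dots> = kron (spec n U x) (spec m V y)"
    using u(3) v(3) unfolding spec_def by (subst kron_mult) auto
  finally show ?thesis by simp
qed

lemma regroup_index_lt:
  assumes "i < a * a' * (b * b')" shows "regroup_index b a' b' i < a * a' * (b * b')"
proof -
  let ?k = "i div (b * b')" and ?l = "i mod (b * b')"
  have k: "?k < a * a'" using assms by (rule index_div_lt)
  have l: "?l < b * b'" using assms by (rule index_mod_lt)
  have "(?k div a' * b + ?l div b') * (a' * b') + (?k mod a' * b' + ?l mod b') < a * b * (a' * b')"
    by (intro index_lt index_div_lt[OF k] index_div_lt[OF l] index_mod_lt[OF k] index_mod_lt[OF l])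
  then show ?thesis by (simp add: regroup_index_def Let_def mult_ac)
qed

text \<open>Regrouping exchanges the two middle tensor factors, so it is undone by regrouping with
  their dimensions exchanged.\<close>

lemma regroup_index_inverse:
  assumes "i < a * a' * (b * b')" shows "regroup_index a' b b' (regroup_index b a' b' i) = i"
proof -
  let ?k = "i div (b * b')" and ?l = "i mod (b * b')"
  have k: "?k < a * a'" using assms by (rule index_div_lt)
  have l: "?l < b * b'" using assms by (rule index_mod_lt)
  let ?X = "?k div a' * b + ?l div b'" and ?Y = "?k mod a' * b' + ?l mod b'"
  have Y: "?Y < a' * b'" by (intro index_lt index_mod_lt[OF k] index_mod_lt[OF l])
  have "regroup_index b a' b' i = ?X * (a' * b') + ?Y" by (simp add: regroup_index_def Let_def)
  then have "regroup_index a' b b' (regroup_index b a' b' i) =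
      ((?X div b) * a' + ?Y div b') * (b * b') + ((?X mod b) * b' + ?Y mod b')"
    using Y unfolding regroup_index_def[of a'] by (simp only: Let_def index_div index_mod)
  also have "\<dots> = (?k div a' * a' + ?k mod a') * (b * b') + (?l div b' * b' + ?l mod b')"
    using index_div_lt[OF l] index_mod_lt[OF l] by (simp only: index_div index_mod)
  also have "\<dots> = i" by (simp only: div_mult_mod_eq)
  finally show ?thesis .
qed

text \<open>Only the rows of the eigenvector matrix are permuted. Its columns, and with them the
  order of the eigenvalues, stay in place, so the same \<open>x\<close> serves on both
  sides.\<close>

lemma regroup_spec:
  assumes U: "unitary_mat (a * b * (a' * b')) U"
  shows "\<exists>U'. unitary_mat (a * a' * (b * b')) U' \<and>
    regroup a b a' b' (spec (a * b * (a' * b')) U x) = spec (a * a' * (b * b')) U' x"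
proof -
  let ?N = "a * a' * (b * b')" and ?p = "regroup_index b a' b'"
  have N: "a * b * (a' * b') = ?N" by (simp add: mult_ac)
  note u = unitary_matD[OF U, unfolded N]
  note lt = regroup_index_lt[of _ a a' b b']
  have inj: "?p i = ?p j \<longleftrightarrow> i = j" if "i < ?N" "j < ?N" for i j
    using regroup_index_inverse[OF that(1)] regroup_index_inverse[OF that(2)] by metis
  define U' where "U' = mat ?N ?N (\<lambda>(i, j). U $$ (?p i, j))"
  have [simp]: "dim_row U' = ?N" "dim_col U' = ?N" by (auto simp: U'_def)
  have "U' * adj U' = 1\<^sub>m ?N"
  proof (rule eq_matI)
    fix i j assume "i < dim_row (1\<^sub>m ?N)" "j < dim_col (1\<^sub>m ?N)"
    then have ij: "i < ?N" "j < ?N" by auto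
    have "(U' * adj U') $$ (i, j) = (U * adj U) $$ (?p i, ?p j)"
      using ij lt[OF ij(1)] lt[OF ij(2)] u(2,3) by (simp add: mult_index U'_def del: index_mult_mat(1))
    then show "(U' * adj U') $$ (i, j) = 1\<^sub>m ?N $$ (i, j)"
      using ij lt[OF ij(1)] lt[OF ij(2)] inj[OF ij] by (simp add: u(5))
  qed auto
  then have U': "unitary_mat ?N U'"
    using mat_mult_left_right_inverse[of U' ?N "adj U'"] by (auto simp: unitary_mat_def carrier_matI)
  let ?D = "mat_diag ?N (\<lambda>i. complex_of_real (x i))"
  have AD: "(A * ?D) $$ (i, k) = A $$ (i, k) * complex_of_real (x k)" if "dim_row A = ?N" "dim_col A = ?N" "i < ?N" "k < ?N" for A i k
  proof -
    have "A \<in> carrier_mat ?N ?N" using that(1,2) by (rule carrier_matI)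
    then show ?thesis
      using that(3,4) by (subst mat_diag_mult_right[of A ?N ?N]) (simp_all only: index_mat split)
  qed
  have "regroup a b a' b' (spec ?N U x) = spec ?N U' x"
  proof (rule eq_matI)
    fix i j assume "i < dim_row (spec ?N U' x)" "j < dim_col (spec ?N U' x)"
    then have ij: "i < ?N" "j < ?N" using U' by auto
    have "spec ?N U x $$ (?p i, ?p j) = (\<Sum>k<?N. (U * ?D) $$ (?p i, k) * adj U $$ (k, ?p j))"
      unfolding spec_def using lt[OF ij(1)] lt[OF ij(2)] u by (subst mult_index) auto
    also have "\<dots> = (\<Sum>k<?N. (U' * ?D) $$ (i, k) * adj U' $$ (k, j))"
    proof (rule sum.cong[OF refl])
      fix k assume "k \<in> {..<?N}"
      then have k: "k < ?N" by simp
      have "U' $$ (i, k) = U $$ (?p i, k)" "U' $$ (j, k) = U $$ (?p j, k)"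
        using ij k by (simp_all add: U'_def)
      then show "(U * ?D) $$ (?p i, k) * adj U $$ (k, ?p j) = (U' * ?D) $$ (i, k) * adj U' $$ (k, j)"
        using AD[OF u(2,3) lt[OF ij(1)] k] AD[of U', OF _ _ ij(1) k] u(2,3) k ij lt[OF ij(2)]
        by (simp del: index_mult_mat(1))
    qed
    also have "\<dots> = spec ?N U' x $$ (i, j)"
      unfolding spec_def using ij by (subst mult_index) auto
    finally show "regroup a b a' b' (spec ?N U x) $$ (i, j) = spec ?N U' x $$ (i, j)"
      using ij by (simp add: regroup_def)
  qed (use U' in \<open>auto simp: regroup_def\<close>)
  then show ?thesis using U' unfolding N by blast
qed

lemma ptrace_regroup_kron:
  assumes M: "M \<in> carrier_mat (a * b) (a * b)" and N: "N \<in> carrier_mat (a' * b') (a' * b')"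
  shows "ptrace_mid 1 (a * a') (b * b') (regroup a b a' b' (kron M N)) =
    kron (ptrace_mid 1 a b M) (ptrace_mid 1 a' b' N)"
proof (rule eq_mat_prodI[of _ b b' b b'])
  fix i j k l assume ij: "i < b" "j < b" "k < b'" "l < b'"
  have il: "i * b' + k < b * b'" "j * b' + l < b * b'" using ij by (auto intro: index_lt)
  have p: "regroup_index b a' b' ((p * a' + q) * (b * b') + (i * b' + k)) = (p * b + i) * (a' * b') + (q * b' + k)"
    if "q < a'" "i < b" "k < b'" for p q i k
    using index_lt[OF that(2,3)] that by (simp only: regroup_index_def Let_def index_div index_mod)
  have "ptrace_mid 1 (a * a') (b * b') (regroup a b a' b' (kron M N)) $$ (i * b' + k, j * b' + l) =
    (\<Sum>p<a. \<Sum>q<a'. regroup a b a' b' (kron M N) $$ ((p * a' + q) * (b * b') + (i * b' + k), (p * a' + q) * (b * b') + (j * b' + l)))"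
    unfolding ptrace_first_index[OF il] sum_index ..
  also have "\<dots> = (\<Sum>p<a. \<Sum>q<a'. M $$ (p * b + i, p * b + j) * N $$ (q * b' + k, q * b' + l))"
  proof (intro sum.cong refl)
    fix p q assume "p \<in> {..<a}" "q \<in> {..<a'}"
    then have pq: "p < a" "q < a'" by auto
    have lt: "(p * a' + q) * (b * b') + (i * b' + k) < a * a' * (b * b')"
      "(p * a' + q) * (b * b') + (j * b' + l) < a * a' * (b * b')"
      by (intro index_lt pq ij)+
    have "regroup a b a' b' (kron M N) $$ ((p * a' + q) * (b * b') + (i * b' + k), (p * a' + q) * (b * b') + (j * b' + l)) =
      kron M N $$ ((p * b + i) * (a' * b') + (q * b' + k), (p * b + j) * (a' * b') + (q * b' + l))"
      unfolding regroup_def using lt by (simp only: index_mat split p[OF pq(2) ij(1,3)] p[OF pq(2) ij(2,4)])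
    also have "\<dots> = M $$ (p * b + i, p * b + j) * N $$ (q * b' + k, q * b' + l)"
      using kron_index[of "p * b + i" M "p * b + j" "q * b' + k" N "q * b' + l"] M N pq ij
      by (simp add: index_lt)
    finally show "regroup a b a' b' (kron M N) $$ ((p * a' + q) * (b * b') + (i * b' + k), (p * a' + q) * (b * b') + (j * b' + l)) =
      M $$ (p * b + i, p * b + j) * N $$ (q * b' + k, q * b' + l)" .
  qed
  also have "\<dots> = ptrace_mid 1 a b M $$ (i, j) * ptrace_mid 1 a' b' N $$ (k, l)"
    unfolding ptrace_first_index[OF ij(1,2)] ptrace_first_index[OF ij(3,4)] sum_product ..
  also have "\<dots> = kron (ptrace_mid 1 a b M) (ptrace_mid 1 a' b' N) $$ (i * b' + k, j * b' + l)"
    using kron_index[of i "ptrace_mid 1 a b M" j k "ptrace_mid 1 a' b' N" l] ij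
    by (simp del: One_nat_def)
  finally show "ptrace_mid 1 (a * a') (b * b') (regroup a b a' b' (kron M N)) $$ (i * b' + k, j * b' + l) =
    kron (ptrace_mid 1 a b M) (ptrace_mid 1 a' b' N) $$ (i * b' + k, j * b' + l)" .
qed (auto simp del: One_nat_def)

text \<open>A probability distribution whose log-likelihood has mean \<open>m\<close> and variance
  \<open>v\<close>; thus \<open>m\<close> is minus the Shannon entropy. The centred form makes cross
  terms vanish for products.\<close>

definition log_moments :: "nat \<Rightarrow> (nat \<Rightarrow> real) \<Rightarrow> real \<Rightarrow> real \<Rightarrow> bool" where
  "log_moments d x m v \<longleftrightarrow> (\<forall>i<d. 0 \<le> x i) \<and> (\<Sum>i<d. x i) = 1 \<and>
    (\<Sum>i<d. x i * (log 2 (x i) - m)) = 0 \<and> (\<Sum>i<d. x i * (log 2 (x i) - m)\<^sup>2) = v"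

text \<open>Under a product distribution the logarithm is a sum of independent terms, so means and
  variances add.\<close>

lemma log_moments_mult:
  assumes "log_moments n x m v" "log_moments k y m' v'"
  shows "log_moments (n * k) (\<lambda>i. x (i div k) * y (i mod k)) (m + m') (v + v')"
proof -
  note x = assms(1)[unfolded log_moments_def] and y = assms(2)[unfolded log_moments_def]
  have ix: "(\<Sum>i<n * k. f (i div k) (i mod k)) = (\<Sum>i<n. \<Sum>j<k. f i j)" for f :: "nat \<Rightarrow> nat \<Rightarrow> real"
    unfolding sum_index by (intro sum.cong refl) (simp add: index_div index_mod)
  let ?A = "\<lambda>i. log 2 (x i) - m" and ?B = "\<lambda>j. log 2 (y j) - m'"
  \<comment> \<open>The logarithm of a product splits only for positive factors; if a factor is
    zero, the weight in front removes the term.\<close>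
  have l: "x i * y j * g (log 2 (x i * y j) - (m + m')) = x i * y j * g (?A i + ?B j)" if "i < n" "j < k" for i j and g :: "real \<Rightarrow> real"
  proof (cases "x i = 0 \<or> y j = 0")
    case False
    then have "0 < x i" "0 < y j" using x y that by (auto simp: order.order_iff_strict)
    then show ?thesis by (simp add: log_mult_pos algebra_simps)
  qed auto
  have "(\<Sum>i<n * k. x (i div k) * y (i mod k)) = (\<Sum>i<n. x i) * (\<Sum>j<k. y j)"
    unfolding ix[of "\<lambda>i j. x i * y j"] sum_product ..
  moreover have "(\<Sum>i<n * k. x (i div k) * y (i mod k) * (log 2 (x (i div k) * y (i mod k)) - (m + m'))) = 0"
  proof -
    have "(\<Sum>i<n * k. x (i div k) * y (i mod k) * (log 2 (x (i div k) * y (i mod k)) - (m + m'))) =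
        (\<Sum>i<n. \<Sum>j<k. x i * y j * (?A i + ?B j))"
      unfolding ix[of "\<lambda>i j. x i * y j * (log 2 (x i * y j) - (m + m'))"]
      using l[of _ _ "\<lambda>z. z"] by (intro sum.cong refl) auto
    also have "\<dots> = (\<Sum>i<n. \<Sum>j<k. (x i * ?A i) * y j) + (\<Sum>i<n. \<Sum>j<k. x i * (y j * ?B j))"
      unfolding sum.distrib[symmetric] by (intro sum.cong refl) (simp add: algebra_simps)
    also have "\<dots> = (\<Sum>i<n. x i * ?A i) * (\<Sum>j<k. y j) + (\<Sum>i<n. x i) * (\<Sum>j<k. y j * ?B j)"
      unfolding sum_product ..
    finally show ?thesis using x y by simp
  qed
  moreover have "(\<Sum>i<n * k. x (i div k) * y (i mod k) * (log 2 (x (i div k) * y (i mod k)) - (m + m'))\<^sup>2) = v + v'"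
  proof -
    have "(\<Sum>i<n * k. x (i div k) * y (i mod k) * (log 2 (x (i div k) * y (i mod k)) - (m + m'))\<^sup>2) =
        (\<Sum>i<n. \<Sum>j<k. x i * y j * (?A i + ?B j)\<^sup>2)"
      unfolding ix[of "\<lambda>i j. x i * y j * (log 2 (x i * y j) - (m + m'))\<^sup>2"]
      using l[of _ _ "\<lambda>z. z\<^sup>2"] by (intro sum.cong refl) auto
    also have "\<dots> = (\<Sum>i<n. \<Sum>j<k. (x i * (?A i)\<^sup>2) * y j) + (\<Sum>i<n. \<Sum>j<k. x i * (y j * (?B j)\<^sup>2))
        + 2 * (\<Sum>i<n. \<Sum>j<k. (x i * ?A i) * (y j * ?B j))"
      unfolding sum.distrib[symmetric] sum_distrib_left by (intro sum.cong refl) (simp add: algebra_simps power2_eq_square)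
    also have "\<dots> = (\<Sum>i<n. x i * (?A i)\<^sup>2) * (\<Sum>j<k. y j) + (\<Sum>i<n. x i) * (\<Sum>j<k. y j * (?B j)\<^sup>2)
        + 2 * ((\<Sum>i<n. x i * ?A i) * (\<Sum>j<k. y j * ?B j))"
      unfolding sum_product ..
    finally show ?thesis using x y by simp
  qed
  ultimately show ?thesis
    using x y by (auto simp: log_moments_def index_div_lt index_mod_lt)
qed

text \<open>Chebyshev's inequality. The condition \<open>0 < x i\<close> excludes zero eigenvalues,
  whose logarithm is only a default value; they carry no weight, so the bound is unaffected.\<close>

lemma chebyshev:
  assumes "log_moments d x m v" "0 < t"
  shows "(\<Sum>i<d. if 0 < x i \<and> \<bar>log 2 (x i) - m\<bar> \<le> t then 0 else x i) \<le> v / t\<^sup>2"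
proof -
  note x = assms(1)[unfolded log_moments_def]
  have "(\<Sum>i<d. if 0 < x i \<and> \<bar>log 2 (x i) - m\<bar> \<le> t then 0 else x i) * t\<^sup>2 \<le> (\<Sum>i<d. x i * (log 2 (x i) - m)\<^sup>2)"
    unfolding sum_distrib_right
  proof (rule sum_mono)
    fix i assume "i \<in> {..<d}"
    then have x0: "0 \<le> x i" using x by auto
    show "(if 0 < x i \<and> \<bar>log 2 (x i) - m\<bar> \<le> t then 0 else x i) * t\<^sup>2 \<le> x i * (log 2 (x i) - m)\<^sup>2"
    proof (cases "0 < x i \<and> t < \<bar>log 2 (x i) - m\<bar>")
      case True
      then have "t\<^sup>2 \<le> \<bar>log 2 (x i) - m\<bar>\<^sup>2" using assms(2) by (intro power_mono) auto
      then show ?thesis using True by (auto intro: mult_left_mono)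
    qed (use x0 in auto)
  qed
  then show ?thesis using x assms(2) by (simp add: pos_le_divide_eq)
qed

text \<open>The n-fold eigenvalues are asserted only to exist with the right moments; nothing more
  about them is needed. The global state and its marginal are treated in one induction because the
  regrouped product has the product marginal.\<close>

lemma iid_spectral:
  assumes U: "unitary_mat (a * b) U" and V: "unitary_mat b V"
    and \<rho>: "\<rho> = spec (a * b) U x" and \<beta>: "ptrace_mid 1 a b \<rho> = spec b V y"
    and mx: "log_moments (a * b) x m v" and my: "log_moments b y m' v'"
  shows "\<exists>Uk Vk xn yn. unitary_mat (a ^ n * b ^ n) Uk \<and> unitary_mat (b ^ n) Vk \<and>
    iid_state a b \<rho> n = spec (a ^ n * b ^ n) Uk xn \<and>
    ptrace_mid 1 (a ^ n) (b ^ n) (iid_state a b \<rho> n) = spec (b ^ n) Vk yn \<and>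
    log_moments (a ^ n * b ^ n) xn (real n * m) (real n * v) \<and>
    log_moments (b ^ n) yn (real n * m') (real n * v')"
proof (induction n)
  case 0
  have 1: "unitary_mat 1 (1\<^sub>m 1)" by (simp add: unitary_mat_def)
  have 2: "1\<^sub>m 1 = spec 1 (1\<^sub>m 1) (\<lambda>_. 1)" using spec_one[OF 1] by simp
  have 3: "ptrace_mid 1 1 1 (1\<^sub>m 1) = 1\<^sub>m 1" by (rule eq_matI) (auto simp: ptrace_mid_def)
  have 4: "log_moments 1 (\<lambda>_. 1) 0 0" by (simp add: log_moments_def)
  show ?case
    using 1 2 3 4 by (intro exI[of _ "1\<^sub>m 1"] exI[of _ "\<lambda>_. 1"]) simp
next
  case (Suc n)
  then obtain Uk Vk xn yn where IH: "unitary_mat (a ^ n * b ^ n) Uk" "unitary_mat (b ^ n) Vk"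
    "iid_state a b \<rho> n = spec (a ^ n * b ^ n) Uk xn"
    "ptrace_mid 1 (a ^ n) (b ^ n) (iid_state a b \<rho> n) = spec (b ^ n) Vk yn"
    "log_moments (a ^ n * b ^ n) xn (real n * m) (real n * v)"
    "log_moments (b ^ n) yn (real n * m') (real n * v')"
    by blast
  let ?x = "\<lambda>i. x (i div (a ^ n * b ^ n)) * xn (i mod (a ^ n * b ^ n))"
  let ?y = "\<lambda>i. y (i div (b ^ n)) * yn (i mod (b ^ n))"
  have k: "kron \<rho> (iid_state a b \<rho> n) = spec (a * b * (a ^ n * b ^ n)) (kron U Uk) ?x"
    unfolding IH(3) unfolding \<rho> by (rule kron_spec[OF U IH(1)])
  obtain U' where U': "unitary_mat (a * a ^ n * (b * b ^ n)) U'"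
    "regroup a b (a ^ n) (b ^ n) (kron \<rho> (iid_state a b \<rho> n)) = spec (a * a ^ n * (b * b ^ n)) U' ?x"
    unfolding k using regroup_spec[OF unitary_kron[OF U IH(1)]] by blast
  have "ptrace_mid 1 (a * a ^ n) (b * b ^ n) (regroup a b (a ^ n) (b ^ n) (kron \<rho> (iid_state a b \<rho> n))) =
      kron (ptrace_mid 1 a b \<rho>) (ptrace_mid 1 (a ^ n) (b ^ n) (iid_state a b \<rho> n))"
    using spec_carrier[OF U, of x] spec_carrier[OF IH(1), of xn]
    by (intro ptrace_regroup_kron) (simp_all add: \<rho>[symmetric] IH(3)[symmetric])
  also have "\<dots> = spec (b * b ^ n) (kron V Vk) ?y"
    unfolding \<beta> IH(4) by (rule kron_spec[OF V IH(2)])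
  finally have p: "ptrace_mid 1 (a ^ Suc n) (b ^ Suc n) (iid_state a b \<rho> (Suc n)) = spec (b ^ Suc n) (kron V Vk) ?y"
    by simp
  have mx': "log_moments (a ^ Suc n * b ^ Suc n) ?x (real (Suc n) * m) (real (Suc n) * v)"
    using log_moments_mult[OF mx IH(5)] by (simp add: algebra_simps)
  have my': "log_moments (b ^ Suc n) ?y (real (Suc n) * m') (real (Suc n) * v')"
    using log_moments_mult[OF my IH(6)] by (simp add: algebra_simps)
  have "unitary_mat (b ^ Suc n) (kron V Vk)" using unitary_kron[OF V IH(2)] by simp
  moreover have "unitary_mat (a ^ Suc n * b ^ Suc n) U'" "iid_state a b \<rho> (Suc n) = spec (a ^ Suc n * b ^ Suc n) U' ?x"
    using U' by simp_all
  ultimately show ?case using p mx' my' by blast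
qed

subsection \<open>Conditional von Neumann entropy\<close>

text \<open>The squared overlaps of two eigenbases form a doubly stochastic matrix, which reduces
  relative-entropy arguments for non-commuting operators to classical sums.\<close>

lemma tr_spec_mult_spec:
  assumes V: "unitary_mat n V" and W: "unitary_mat n W"
  defines "w \<equiv> \<lambda>j i. (cmod ((adj W * V) $$ (j, i)))\<^sup>2"
  shows "mat_trace (spec n V y * spec n W g) = complex_of_real (\<Sum>i<n. \<Sum>j<n. w j i * (y i * g j))"
    "i < n \<Longrightarrow> (\<Sum>j<n. w j i) = 1" "j < n \<Longrightarrow> (\<Sum>i<n. w j i) = 1"
proof -
  let ?D = "\<lambda>x. mat_diag n (\<lambda>i. complex_of_real (x i))"
  note v = unitary_matD[OF V] and u = unitary_matD[OF W]
  note [simp] = v(2,3) u(2,3)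
  define Z where "Z = adj W * V"
  have Z [simp]: "Z \<in> carrier_mat n n" "dim_row Z = n" "dim_col Z = n" by (auto simp: Z_def intro!: carrier_matI)
  have "unitary_mat n (adj W)" using u by (auto simp: unitary_mat_def)
  then have Zu: "unitary_mat n Z" unfolding Z_def by (rule unitary_mult) (rule V)
  have w: "w j i = (cmod (Z $$ (j, i)))\<^sup>2" for i j by (simp add: w_def Z_def)
  have ww: "complex_of_real (w j i) = Z $$ (j, i) * cnj (Z $$ (j, i))" for i j
    by (simp add: w complex_norm_square del: of_real_power)
  have "mat_trace (spec n V y * spec n W g) = mat_trace (V * (?D y * adj V * spec n W g))"
    using W by (simp add: spec_def mm_assoc)
  also have "\<dots> = mat_trace (?D y * adj V * spec n W g * V)"
    using W by (intro tr_comm) auto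
  also have "?D y * adj V * spec n W g * V = (?D y * adj Z) * (?D g * Z)"
    by (simp add: spec_def Z_def mat_alg)
  also have "mat_trace \<dots> = (\<Sum>i<n. \<Sum>j<n. complex_of_real (y i) * cnj (Z $$ (j, i)) * (complex_of_real (g j) * Z $$ (j, i)))"
    by (subst tr_mult) (auto simp: mat_diag_mult_left[of _ n n] intro!: sum.cong)
  also have "\<dots> = complex_of_real (\<Sum>i<n. \<Sum>j<n. w j i * (y i * g j))"
    by (simp add: ww mult_ac)
  finally show "mat_trace (spec n V y * spec n W g) = complex_of_real (\<Sum>i<n. \<Sum>j<n. w j i * (y i * g j))" .
  show "(\<Sum>j<n. w j i) = 1" if i: "i < n" for i
  proof -
    have "complex_of_real (\<Sum>j<n. w j i) = (\<Sum>j<n. adj Z $$ (i, j) * Z $$ (j, i))"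
      using i by (simp add: ww mult.commute)
    also have "\<dots> = (adj Z * Z) $$ (i, i)" using i by (subst mult_index) auto
    also have "\<dots> = 1" using i by (simp add: unitary_matD[OF Zu])
    finally show ?thesis by (simp only: of_real_eq_1_iff)
  qed
  show "(\<Sum>i<n. w j i) = 1" if j: "j < n" for j
  proof -
    have "complex_of_real (\<Sum>i<n. w j i) = (\<Sum>i<n. Z $$ (j, i) * adj Z $$ (i, j))"
      using j by (simp add: ww)
    also have "\<dots> = (Z * adj Z) $$ (j, j)" using j by (subst mult_index) auto
    also have "\<dots> = 1" using j by (simp add: unitary_matD[OF Zu])
    finally show ?thesis by (simp only: of_real_eq_1_iff)
  qed
qed

text \<open>Averages the pointwise bound from \<open>ln t \<le> t - 1\<close> at
  \<open>t = q j / y i\<close> with doubly stochastic weights. The total of \<open>q\<close> is left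
  free because it is applied to eigenvalues shifted by \<xi>.\<close>

lemma klein_inequality:
  fixes w :: "nat \<Rightarrow> nat \<Rightarrow> real"
  assumes w: "\<And>i j. 0 \<le> w j i" "\<And>i. i < n \<Longrightarrow> (\<Sum>j<n. w j i) = 1" "\<And>j. j < n \<Longrightarrow> (\<Sum>i<n. w j i) = 1"
    and y: "\<And>i. i < n \<Longrightarrow> 0 \<le> y i" and q: "\<And>j. j < n \<Longrightarrow> 0 < q j"
  shows "(\<Sum>i<n. \<Sum>j<n. w j i * (y i * log 2 (q j))) \<le>
    (\<Sum>i<n. y i * log 2 (y i)) + ((\<Sum>j<n. q j) - (\<Sum>i<n. y i)) / ln 2"
proof -
  have pw: "y i * log 2 (q j) \<le> y i * log 2 (y i) + (q j - y i) / ln 2" if "i < n" "j < n" for i j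
  proof (cases "y i = 0")
    case False
    then have yi: "0 < y i" using y[OF that(1)] by simp
    have qj: "0 < q j" by (rule q[OF that(2)])
    have "ln (q j / y i) \<le> q j / y i - 1" using yi qj by (intro ln_le_minus_one) simp
    then have "ln (q j) \<le> ln (y i) + (q j / y i - 1)" using yi qj by (simp add: ln_div)
    then have "y i * ln (q j) \<le> y i * (ln (y i) + (q j / y i - 1))" using yi by (intro mult_left_mono) auto
    also have "\<dots> = y i * ln (y i) + (q j - y i)" using yi by (simp add: field_simps)
    finally have "y i * ln (q j) / ln 2 \<le> (y i * ln (y i) + (q j - y i)) / ln 2"
      by (intro divide_right_mono) auto
    then show ?thesis by (simp add: log_def add_divide_distrib)
  qed (use q[OF that(2)] in \<open>simp add: order.strict_implies_order\<close>)
  have "(\<Sum>i<n. \<Sum>j<n. w j i * (y i * log 2 (q j))) \<le>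
      (\<Sum>i<n. \<Sum>j<n. w j i * (y i * log 2 (y i) + (q j - y i) / ln 2))"
    using w(1) pw by (intro sum_mono mult_left_mono) auto
  also have "\<dots> = (\<Sum>i<n. \<Sum>j<n. w j i * (y i * log 2 (y i) - y i / ln 2)) + (\<Sum>i<n. \<Sum>j<n. w j i * (q j / ln 2))"
    unfolding sum.distrib[symmetric] by (intro sum.cong refl) (simp add: algebra_simps diff_divide_distrib)
  also have "(\<Sum>i<n. \<Sum>j<n. w j i * (y i * log 2 (y i) - y i / ln 2)) = (\<Sum>i<n. y i * log 2 (y i) - y i / ln 2)"
    using w(2) by (simp add: sum_distrib_right[symmetric])
  also have "(\<Sum>i<n. \<Sum>j<n. w j i * (q j / ln 2)) = (\<Sum>j<n. (\<Sum>i<n. w j i) * (q j / ln 2))"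
    unfolding sum_distrib_right by (rule sum.swap)
  also have "\<dots> = (\<Sum>j<n. q j / ln 2)"
    using w(3) by simp
  finally show ?thesis by (simp add: sum_subtractf sum_divide_distrib diff_divide_distrib)
qed

lemma mono_tendsto_at_right_INF:
  fixes F :: "real \<Rightarrow> ereal"
  assumes "\<And>s t. 0 < s \<Longrightarrow> s \<le> t \<Longrightarrow> F s \<le> F t"
  shows "(F \<longlongrightarrow> (INF t\<in>{0<..}. F t)) (at_right 0)"
proof (rule order_tendstoI)
  fix c assume c: "c < (INF t\<in>{0<..}. F t)"
  have "c < F t" if "0 < t" for t
    using c INF_lower[of t "{0<..}" F] that by (auto intro: less_le_trans)
  then show "\<forall>\<^sub>F t in at_right 0. c < F t"
    by (auto simp: eventually_at_right_field intro: exI[of _ 1])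
next
  fix c assume "(INF t\<in>{0<..}. F t) < c"
  then obtain t where t: "0 < t" "F t < c" by (auto simp: INF_less_iff)
  then have "F s < c" if "0 < s" "s < t" for s
    using assms[of s t] that by (auto intro: le_less_trans)
  then show "\<forall>\<^sub>F s in at_right 0. F s < c"
    using t(1) by (auto simp: eventually_at_right_field)
qed

lemma mat_log_spec:
  "unitary_mat n U \<Longrightarrow> mat_log (spec n U x) = spec n U (\<lambda>i. if x i > 0 then log 2 (x i) else 0)"
  by (simp add: mat_log_def mat_fun_spec)

text \<open>The expression is monotone in \<xi>, so its limit is an infimum: a single \<xi> gives an
  upper bound, while lower bounds are checked for every \<xi>. The value minus infinity needs no
  separate case.\<close>

lemma cond_entropy_rel_spec:
  assumes U: "unitary_mat (a * b) U" and V: "unitary_mat b V" and W: "unitary_mat b W"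
    and \<rho>: "\<rho> = spec (a * b) U x" and \<beta>: "ptrace_mid 1 a b \<rho> = spec b V y"
    and x: "\<And>i. i < a * b \<Longrightarrow> 0 \<le> x i" and y: "\<And>i. i < b \<Longrightarrow> 0 \<le> y i" and s: "\<And>i. i < b \<Longrightarrow> 0 \<le> s i"
  shows "cond_entropy_rel a b \<rho> (spec b W s) = (INF \<xi>\<in>{0<..}. ereal
    ((\<Sum>i<b. \<Sum>j<b. (cmod ((adj W * V) $$ (j, i)))\<^sup>2 * (y i * log 2 (s j + \<xi>))) - (\<Sum>i<a * b. x i * log 2 (x i))))"
proof -
  let ?w = "\<lambda>j i. (cmod ((adj W * V) $$ (j, i)))\<^sup>2"
  let ?f = "\<lambda>\<xi>. (\<Sum>i<b. \<Sum>j<b. ?w j i * (y i * log 2 (s j + \<xi>))) - (\<Sum>i<a * b. x i * log 2 (x i))"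
  let ?g = "\<lambda>\<xi>::real. ereal (Re (mat_trace
     (\<rho> * (kron (1\<^sub>m a) (mat_log (spec b W s + complex_of_real \<xi> \<cdot>\<^sub>m 1\<^sub>m b)) - mat_log \<rho>))))"
  have eq: "?g \<xi> = ereal (?f \<xi>)" if "0 < \<xi>" for \<xi>
  proof -
    have "spec b W s + complex_of_real \<xi> \<cdot>\<^sub>m 1\<^sub>m b = spec b W s - complex_of_real (- \<xi>) \<cdot>\<^sub>m 1\<^sub>m b"
      using W by (intro eq_matI) auto
    also have "\<dots> = spec b W (\<lambda>i. s i + \<xi>)"
      unfolding spec_one[OF W, symmetric] spec_smult[OF W] spec_minus[OF W] by (intro spec_cong) auto
    finally have "mat_log (spec b W s + complex_of_real \<xi> \<cdot>\<^sub>m 1\<^sub>m b) = spec b W (\<lambda>i. log 2 (s i + \<xi>))"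
      using s that by (auto simp: mat_log_spec[OF W] add_nonneg_pos intro!: spec_cong)
    moreover have "\<rho> * (kr a (spec b W (\<lambda>i. log 2 (s i + \<xi>))) - mat_log \<rho>) =
        \<rho> * kr a (spec b W (\<lambda>i. log 2 (s i + \<xi>))) - \<rho> * mat_log \<rho>"
      using U W by (intro mm_minus_right) (auto simp: \<rho> mat_log_spec)
    moreover have "mat_trace (\<rho> * kr a (spec b W (\<lambda>i. log 2 (s i + \<xi>))) - \<rho> * mat_log \<rho>) =
        mat_trace (\<rho> * kr a (spec b W (\<lambda>i. log 2 (s i + \<xi>)))) - mat_trace (\<rho> * mat_log \<rho>)"
      using U W by (intro tr_minus) (auto simp: \<rho> mat_log_spec)
    moreover have "mat_trace (\<rho> * kr a (spec b W (\<lambda>i. log 2 (s i + \<xi>)))) =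
        complex_of_real (\<Sum>i<b. \<Sum>j<b. ?w j i * (y i * log 2 (s j + \<xi>)))"
      using spec_carrier[OF U] spec_carrier[OF W]
      by (subst tr_mult_kr) (auto simp: \<rho> \<beta>[unfolded \<rho>] tr_spec_mult_spec[OF V W] simp del: One_nat_def)
    moreover have "mat_trace (\<rho> * mat_log \<rho>) = complex_of_real (\<Sum>i<a * b. x i * log 2 (x i))"
    proof -
      have "\<rho> * mat_log \<rho> = spec (a * b) U (\<lambda>i. x i * log 2 (x i))"
        unfolding \<rho> mat_log_spec[OF U] spec_mult[OF U]
      proof (rule spec_cong)
        fix i assume "i < a * b"
        then show "x i * (if 0 < x i then log 2 (x i) else 0) = x i * log 2 (x i)"
          using x[of i] by (cases "x i = 0") auto
      qed
      then show ?thesis by (simp add: tr_spec[OF U])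
    qed
    ultimately show ?thesis by simp
  qed
  have "((\<lambda>\<xi>. ereal (?f \<xi>)) \<longlongrightarrow> (INF \<xi>\<in>{0<..}. ereal (?f \<xi>))) (at_right 0)"
  proof (rule mono_tendsto_at_right_INF)
    fix \<xi> \<zeta> :: real assume *: "0 < \<xi>" "\<xi> \<le> \<zeta>"
    have "(\<Sum>i<b. \<Sum>j<b. ?w j i * (y i * log 2 (s j + \<xi>))) \<le> (\<Sum>i<b. \<Sum>j<b. ?w j i * (y i * log 2 (s j + \<zeta>)))"
      using * y s by (intro sum_mono mult_left_mono log_mono) (auto intro: add_nonneg_pos)
    then show "ereal (?f \<xi>) \<le> ereal (?f \<zeta>)" by simp
  qed
  moreover have "\<forall>\<^sub>F \<xi> in at_right 0. ?g \<xi> = ereal (?f \<xi>)"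
    using eq by (auto simp: eventually_at_right_field intro!: exI[of _ "1::real"])
  ultimately have "(?g \<longlongrightarrow> (INF \<xi>\<in>{0<..}. ereal (?f \<xi>))) (at_right 0)"
    by (rule tendsto_cong[THEN iffD2, rotated])
  then show ?thesis unfolding cond_entropy_rel_def by (intro tendsto_Lim) simp_all
qed

text \<open>The value is H(AB) - H(B). Klein's inequality shows that no conditioning state exceeds
  it, and the marginal attains it.\<close>

lemma cond_entropy_spec:
  assumes U: "unitary_mat (a * b) U" and V: "unitary_mat b V"
    and \<rho>: "\<rho> = spec (a * b) U x" and \<beta>: "ptrace_mid 1 a b \<rho> = spec b V y"
    and x: "\<And>i. i < a * b \<Longrightarrow> 0 \<le> x i" and y: "\<And>i. i < b \<Longrightarrow> 0 \<le> y i" and y1: "(\<Sum>i<b. y i) = 1"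
  shows "cond_entropy a b \<rho> = ereal ((\<Sum>i<b. y i * log 2 (y i)) - (\<Sum>i<a * b. x i * log 2 (x i)))"
proof (rule order.antisym)
  let ?H = "(\<Sum>i<b. y i * log 2 (y i)) - (\<Sum>i<a * b. x i * log 2 (x i))"
  show "cond_entropy a b \<rho> \<le> ereal ?H"
    unfolding cond_entropy_def
  proof (rule SUP_least)
    fix \<sigma> assume "\<sigma> \<in> states b"
    then have sp: "psd_mat b \<sigma>" and tr: "mat_trace \<sigma> = 1" by (auto simp: states_def)
    obtain W s where W: "unitary_mat b W" and \<sigma>: "\<sigma> = spec b W s" and s: "\<And>i. i < b \<Longrightarrow> 0 \<le> s i"
      using psd_spectral[OF sp] by blast
    have s1: "(\<Sum>i<b. s i) = 1" using tr unfolding \<sigma> tr_spec[OF W] by (simp only: of_real_eq_1_iff)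
    let ?w = "\<lambda>j i. (cmod ((adj W * V) $$ (j, i)))\<^sup>2"
    have le: "cond_entropy_rel a b \<rho> \<sigma> \<le> ereal (?H + e)" if "0 < e" for e
    proof -
      \<comment> \<open>Shifting by \<xi> raises the trace by \<open>b * \<xi>\<close>, which
        Klein's inequality charges with the factor \<open>1 / ln 2\<close>; this choice keeps the
        excess below \<open>e\<close>.\<close>
      define \<xi> where "\<xi> = e * ln 2 / (real b + 1)"
      have \<xi>: "0 < \<xi>" using that by (simp add: \<xi>_def)
      have "cond_entropy_rel a b \<rho> (spec b W s) = (INF \<xi>\<in>{0<..}. ereal
          ((\<Sum>i<b. \<Sum>j<b. ?w j i * (y i * log 2 (s j + \<xi>))) - (\<Sum>i<a * b. x i * log 2 (x i))))"
        using x y s by (rule cond_entropy_rel_spec[OF U V W \<rho> \<beta>])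
      then have "cond_entropy_rel a b \<rho> \<sigma> \<le> ereal ((\<Sum>i<b. \<Sum>j<b. ?w j i * (y i * log 2 (s j + \<xi>))) - (\<Sum>i<a * b. x i * log 2 (x i)))"
        unfolding \<sigma> using \<xi> by (simp only:, intro INF_lower) auto
      moreover have "(\<Sum>i<b. \<Sum>j<b. ?w j i * (y i * log 2 (s j + \<xi>))) \<le>
          (\<Sum>i<b. y i * log 2 (y i)) + ((\<Sum>j<b. s j + \<xi>) - (\<Sum>i<b. y i)) / ln 2"
        using tr_spec_mult_spec(2,3)[OF V W] y s \<xi>
        by (intro klein_inequality) (auto intro: add_nonneg_pos)
      moreover have "((\<Sum>j<b. s j + \<xi>) - (\<Sum>i<b. y i)) / ln 2 = e * (real b / (real b + 1))"
      proof -
        have "(\<Sum>j<b. s j + \<xi>) - (\<Sum>i<b. y i) = real b * \<xi>" by (simp add: sum.distrib s1 y1)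
        then show ?thesis by (simp add: \<xi>_def)
      qed
      moreover have "e * (real b / (real b + 1)) \<le> e" using that by (simp add: field_simps)
      ultimately show ?thesis by (auto elim!: order.trans)
    qed
    show "cond_entropy_rel a b \<rho> \<sigma> \<le> ereal ?H"
    proof (rule ereal_le_epsilon2)
      fix e :: real assume "0 < e"
      then show "cond_entropy_rel a b \<rho> \<sigma> \<le> ereal ?H + ereal e"
        using le[of e] by (simp only: plus_ereal.simps)
    qed
  qed
  have "spec b V y \<in> states b"
    using psd_spec[OF V y] by (simp add: states_def tr_spec[OF V] y1)
  have rel: "cond_entropy_rel a b \<rho> (spec b V y) = (INF \<xi>\<in>{0<..}. ereal
      ((\<Sum>i<b. \<Sum>j<b. (cmod ((adj V * V) $$ (j, i)))\<^sup>2 * (y i * log 2 (y j + \<xi>))) - (\<Sum>i<a * b. x i * log 2 (x i))))"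
    using x y y by (rule cond_entropy_rel_spec[OF U V V \<rho> \<beta>])
  have "ereal ?H \<le> cond_entropy_rel a b \<rho> (spec b V y)"
    unfolding rel
  proof (rule INF_greatest)
    fix \<xi> :: real assume "\<xi> \<in> {0<..}"
    then have \<xi>: "0 < \<xi>" by simp
    \<comment> \<open>For the marginal the two eigenbases coincide, so the overlap matrix is the
      identity and only diagonal terms survive.\<close>
    have "(\<Sum>i<b. \<Sum>j<b. (cmod ((adj V * V) $$ (j, i)))\<^sup>2 * (y i * log 2 (y j + \<xi>))) =
        (\<Sum>i<b. \<Sum>j<b. if j = i then y i * log 2 (y i + \<xi>) else 0)"
      unfolding unitary_matD(4)[OF V] by (intro sum.cong refl) auto
    also have "\<dots> = (\<Sum>i<b. y i * log 2 (y i + \<xi>))" by simp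
    also have "\<dots> \<ge> (\<Sum>i<b. y i * log 2 (y i))"
    proof (rule sum_mono)
      fix i assume "i \<in> {..<b}"
      then have "0 \<le> y i" using y by auto
      then show "y i * log 2 (y i) \<le> y i * log 2 (y i + \<xi>)"
        using \<xi> by (cases "y i = 0") (auto intro!: mult_left_mono log_mono)
    qed
    finally show "ereal ?H \<le> ereal ((\<Sum>i<b. \<Sum>j<b. (cmod ((adj V * V) $$ (j, i)))\<^sup>2 * (y i * log 2 (y j + \<xi>))) - (\<Sum>i<a * b. x i * log 2 (x i)))"
      by simp
  qed
  with \<open>spec b V y \<in> states b\<close> show "ereal ?H \<le> cond_entropy a b \<rho>"
    unfolding cond_entropy_def by (rule SUP_upper2)
qed

subsection \<open>The asymptotic equipartition property\<close>

lemma tendsto_ereal_epsI: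
  fixes f :: "nat \<Rightarrow> ereal"
  assumes "\<And>\<delta>. 0 < \<delta> \<Longrightarrow> \<forall>\<^sub>F n in sequentially. ereal (h - \<delta>) \<le> f n \<and> f n \<le> ereal (h + \<delta>)"
  shows "f \<longlonglongrightarrow> ereal h"
proof (rule order_tendstoI)
  fix c assume "c < ereal h"
  then obtain r where r: "c < ereal r" "ereal r < ereal h" using ereal_dense2 by blast
  then have "\<forall>\<^sub>F n in sequentially. ereal (h - (h - r)) \<le> f n \<and> f n \<le> ereal (h + (h - r))"
    by (intro assms) simp
  then show "\<forall>\<^sub>F n in sequentially. c < f n"
    by eventually_elim (use r in \<open>auto intro: less_le_trans\<close>)
next
  fix c assume "ereal h < c"
  then obtain r where r: "ereal h < ereal r" "ereal r < c" using ereal_dense2 by blast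
  then have "\<forall>\<^sub>F n in sequentially. ereal (h - (r - h)) \<le> f n \<and> f n \<le> ereal (h + (r - h))"
    by (intro assms) simp
  then show "\<forall>\<^sub>F n in sequentially. f n < c"
    by eventually_elim (use r in \<open>auto intro: le_less_trans\<close>)
qed

lemma ereal_rate_bounds:
  fixes n :: nat
  assumes "0 < n"
  shows "ereal (real n * r) \<le> z \<Longrightarrow> ereal r \<le> ereal (1 / real n) * z"
    "z \<le> ereal (real n * r) \<Longrightarrow> ereal (1 / real n) * z \<le> ereal r"
proof -
  have e: "ereal (1 / real n) * ereal (real n * r) = ereal r" using assms by simp
  have p: "0 \<le> ereal (1 / real n)" by simp
  show "ereal (real n * r) \<le> z \<Longrightarrow> ereal r \<le> ereal (1 / real n) * z"
    using ereal_mult_left_mono[OF _ p, of "ereal (real n * r)" z] unfolding e by simp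
  show "z \<le> ereal (real n * r) \<Longrightarrow> ereal (1 / real n) * z \<le> ereal r"
    using ereal_mult_left_mono[OF _ p, of z "ereal (real n * r)"] unfolding e by simp
qed

lemma iid_rate_bounds:
  assumes U: "unitary_mat (a * b) U" and V: "unitary_mat b V"
    and \<rho>: "\<rho> = spec (a * b) U x" and \<beta>: "ptrace_mid 1 a b \<rho> = spec b V y"
    and mx: "log_moments (a * b) x m v" and my: "log_moments b y m' v'"
    and \<epsilon>: "0 < \<epsilon>" "\<epsilon> < 1" and \<delta>: "0 < \<delta>"
  shows "\<forall>\<^sub>F n in sequentially.
    ereal (m' - m - \<delta>) \<le> ereal (1 / real n) * smooth_min_entropy (a ^ n) (b ^ n) \<epsilon> (iid_state a b \<rho> n) \<and>
    ereal (1 / real n) * smooth_min_entropy (a ^ n) (b ^ n) \<epsilon> (iid_state a b \<rho> n) \<le> ereal (m' - m + \<delta>) \<and>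
    ereal (m' - m - \<delta>) \<le> ereal (1 / real n) * smooth_max_entropy (a ^ n) (b ^ n) \<epsilon> (iid_state a b \<rho> n) \<and>
    ereal (1 / real n) * smooth_max_entropy (a ^ n) (b ^ n) \<epsilon> (iid_state a b \<rho> n) \<le> ereal (m' - m + \<delta>)"
proof -
  \<comment> \<open>Two thirds of \<delta> pay for the two eigenvalue windows, the last third for
    the logarithm of the overlap constant.\<close>
  define d where "d = \<delta> / 3"
  have d: "0 < d" using \<delta> by (simp add: d_def)
  \<comment> \<open>Chebyshev's bound for variance \<open>n * v\<close> and deviation
    \<open>n * d\<close>, with one value serving both spectra.\<close>
  define \<eta> where "\<eta> n = (\<bar>v\<bar> + \<bar>v'\<bar>) / d\<^sup>2 / real n" for n
  define e where "e = sqrt (1 - \<epsilon>\<^sup>2)"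
  have "\<epsilon>\<^sup>2 < 1" using \<epsilon> by (simp add: power_less_one_iff abs_square_less_1)
  then have e: "0 < e" by (simp add: e_def)
  have "\<eta> \<longlonglongrightarrow> 0" unfolding \<eta>_def by (rule lim_const_over_n)
  then have "(\<lambda>n. sqrt (\<eta> n)) \<longlonglongrightarrow> sqrt 0" by (rule tendsto_real_sqrt)
  then have lim: "(\<lambda>n. sqrt (\<eta> n)) \<longlonglongrightarrow> 0" by simp
  have ev1: "\<forall>\<^sub>F n in sequentially. sqrt (\<eta> n) < \<epsilon>\<^sup>2 / 4"
    by (rule order_tendstoD(2)[OF lim]) (use \<epsilon> in simp)
  \<comment> \<open>Below \<open>e / 4\<close> the overlap constant stays at least
    \<open>e / 2\<close>, so its logarithm is bounded independently of \<open>n\<close>.\<close>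
  have ev2: "\<forall>\<^sub>F n in sequentially. sqrt (\<eta> n) < e / 4"
    by (rule order_tendstoD(2)[OF lim]) (use e in simp)
  have "(\<lambda>n. 2 * \<bar>log 2 (e / 2)\<bar> / real n) \<longlonglongrightarrow> 0" by (rule lim_const_over_n)
  then have ev3: "\<forall>\<^sub>F n in sequentially. 2 * \<bar>log 2 (e / 2)\<bar> / real n < d"
    by (rule order_tendstoD(2)) (rule d)
  show ?thesis
    using ev1 ev2 ev3 eventually_gt_at_top[of 0]
  proof eventually_elim
    fix n :: nat
    assume n1: "sqrt (\<eta> n) < \<epsilon>\<^sup>2 / 4" and n2: "sqrt (\<eta> n) < e / 4"
      and n3: "2 * \<bar>log 2 (e / 2)\<bar> / real n < d" and n: "0 < n"
    obtain Uk Vk xn yn where iid: "unitary_mat (a ^ n * b ^ n) Uk" "unitary_mat (b ^ n) Vk"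
      "iid_state a b \<rho> n = spec (a ^ n * b ^ n) Uk xn"
      "ptrace_mid 1 (a ^ n) (b ^ n) (iid_state a b \<rho> n) = spec (b ^ n) Vk yn"
      "log_moments (a ^ n * b ^ n) xn (real n * m) (real n * v)"
      "log_moments (b ^ n) yn (real n * m') (real n * v')"
      using iid_spectral[OF U V \<rho> \<beta> mx my] by blast
    let ?t = "real n * d"
    have t: "0 < ?t" using n d by simp
    define S where "S = {i. 0 < xn i \<and> \<bar>log 2 (xn i) - real n * m\<bar> \<le> ?t}"
    define T where "T = {i. 0 < yn i \<and> \<bar>log 2 (yn i) - real n * m'\<bar> \<le> ?t}"
    have b: "2 powr (l - ?t) \<le> z \<and> z \<le> 2 powr (l + ?t)" if "0 < z" "\<bar>log 2 z - l\<bar> \<le> ?t" for z l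
    proof -
      have "l - ?t \<le> log 2 z" "log 2 z \<le> l + ?t"
        using that(2) by (simp_all add: abs_le_iff)
      then show ?thesis using that(1) by (simp add: le_log_iff log_le_iff)
    qed
    have \<eta>: "real n * w / ?t\<^sup>2 \<le> \<eta> n" if "w \<le> \<bar>v\<bar> + \<bar>v'\<bar>" for w
    proof -
      have "real n * w / ?t\<^sup>2 = w / d\<^sup>2 / real n" using n by (simp add: power2_eq_square field_simps)
      also have "\<dots> \<le> \<eta> n" unfolding \<eta>_def using that by (intro divide_right_mono) auto
      finally show ?thesis .
    qed
    interpret typical_projections "a ^ n" "b ^ n" "iid_state a b \<rho> n" Uk Vk xn yn S T
      "2 powr (real n * m - ?t)" "2 powr (real n * m + ?t)" "2 powr (real n * m' - ?t)" "2 powr (real n * m' + ?t)" "\<eta> n"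
    proof
      show "(\<Sum>i<a ^ n * b ^ n. if i \<in> S then 0 else xn i) \<le> \<eta> n"
        using order.trans[OF chebyshev[OF iid(5) t] \<eta>[of v]] by (simp add: S_def)
      show "(\<Sum>i<b ^ n. if i \<in> T then 0 else yn i) \<le> \<eta> n"
        using order.trans[OF chebyshev[OF iid(6) t] \<eta>[of v']] by (simp add: T_def)
    qed (use iid b in \<open>auto simp: log_moments_def S_def T_def\<close>)
    have c: "e / 2 \<le> e - 2 * sqrt (\<eta> n)" using n2 by simp
    have "2 * sqrt (\<eta> n) < e" using n2 e by linarith
    then have "4 * sqrt (\<eta> n) \<le> \<epsilon>\<^sup>2" "2 * sqrt (\<eta> n) < sqrt (1 - \<epsilon>\<^sup>2)"
      using n1 by (auto simp: e_def)
    note bounds = smooth_bounds[OF \<epsilon> this, folded e_def]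
    have l1: "log 2 (2 powr (real n * m + ?t) / 2 powr (real n * m' - ?t)) = real n * (m - m' + 2 * d)"
      by (simp add: powr_diff[symmetric] algebra_simps)
    have l2: "log 2 (2 powr (real n * m' + ?t) / 2 powr (real n * m - ?t)) = real n * (m' - m + 2 * d)"
      by (simp add: powr_diff[symmetric] algebra_simps)
    have "log 2 (e / 2) \<le> log 2 (e - 2 * sqrt (\<eta> n))" using c e by (intro log_mono) auto
    moreover have "2 * \<bar>log 2 (e / 2)\<bar> < real n * d" using n3 n by (simp add: field_simps)
    ultimately have l3: "- 2 * log 2 (e - 2 * sqrt (\<eta> n)) \<le> real n * d" by linarith
    have nd: "real n * \<delta> = 3 * (real n * d)" by (simp add: d_def)
    have n\<delta>: "real n * (m' - m - \<delta>) = real n * (m' - m) - 3 * (real n * d)"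
      "real n * (m' - m + \<delta>) = real n * (m' - m) + 3 * (real n * d)"
      unfolding nd[symmetric] by (simp_all add: algebra_simps)
    have nd2: "real n * (m - m' + 2 * d) = 2 * (real n * d) - real n * (m' - m)"
      "real n * (m' - m + 2 * d) = 2 * (real n * d) + real n * (m' - m)"
      by (simp_all add: algebra_simps)
    have nd0: "0 \<le> real n * d" using t by simp
    show "ereal (m' - m - \<delta>) \<le> ereal (1 / real n) * smooth_min_entropy (a ^ n) (b ^ n) \<epsilon> (iid_state a b \<rho> n) \<and>
      ereal (1 / real n) * smooth_min_entropy (a ^ n) (b ^ n) \<epsilon> (iid_state a b \<rho> n) \<le> ereal (m' - m + \<delta>) \<and>
      ereal (m' - m - \<delta>) \<le> ereal (1 / real n) * smooth_max_entropy (a ^ n) (b ^ n) \<epsilon> (iid_state a b \<rho> n) \<and>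
      ereal (1 / real n) * smooth_max_entropy (a ^ n) (b ^ n) \<epsilon> (iid_state a b \<rho> n) \<le> ereal (m' - m + \<delta>)"
    proof (intro conjI ereal_rate_bounds[OF n])
      show "ereal (real n * (m' - m - \<delta>)) \<le> smooth_min_entropy (a ^ n) (b ^ n) \<epsilon> (iid_state a b \<rho> n)"
        using bounds(1) unfolding l1 by (rule order.trans[rotated]) (unfold ereal_less_eq n\<delta> nd2, use nd0 in linarith)
      show "smooth_min_entropy (a ^ n) (b ^ n) \<epsilon> (iid_state a b \<rho> n) \<le> ereal (real n * (m' - m + \<delta>))"
        using bounds(2) unfolding l2 by (rule order.trans) (unfold ereal_less_eq n\<delta> nd2, use nd0 l3 in linarith)
      show "ereal (real n * (m' - m - \<delta>)) \<le> smooth_max_entropy (a ^ n) (b ^ n) \<epsilon> (iid_state a b \<rho> n)"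
        using bounds(3) unfolding l1 by (rule order.trans[rotated]) (unfold ereal_less_eq n\<delta> nd2, use nd0 l3 in linarith)
      show "smooth_max_entropy (a ^ n) (b ^ n) \<epsilon> (iid_state a b \<rho> n) \<le> ereal (real n * (m' - m + \<delta>))"
        using bounds(4) unfolding l2 by (rule order.trans) (unfold ereal_less_eq n\<delta> nd2, use nd0 in linarith)
    qed
  qed
qed

text \<open>Up to transposition the marginal is the Gram matrix of the reshaped square root.\<close>

lemma psd_ptrace_first:
  assumes "psd_mat (a * b) \<rho>" shows "psd_mat b (ptrace_mid 1 a b \<rho>)"
proof -
  let ?S = "mat_sqrt \<rho>"
  note S = psd_mat_sqrt[OF assms]
  let ?G = "reshape a b (a * b) ?S"
  have "adj ?G * ?G = transpose_mat (ptrace_mid 1 a b \<rho>)"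
    using reshape_gram[OF psd_carrier[OF S(1)]] by (simp add: S psd_adj[OF S(1)] del: One_nat_def)
  then have "ptrace_mid 1 a b \<rho> = transpose_mat (adj ?G * ?G)" by (simp del: One_nat_def)
  then show ?thesis
    using psd_transpose[OF psd_adj_mult[OF reshape_carrier]] by metis
qed

text \<open>The variance may be any finite number, as it enters only a bound that tends to
  zero.\<close>

lemma log_moments_exists:
  assumes "\<And>i. i < d \<Longrightarrow> 0 \<le> x i" "(\<Sum>i<d. x i) = 1"
  obtains v where "log_moments d x (\<Sum>i<d. x i * log 2 (x i)) v"
proof -
  let ?m = "\<Sum>i<d. x i * log 2 (x i)"
  have "(\<Sum>i<d. x i * (log 2 (x i) - ?m)) = ?m - (\<Sum>i<d. x i) * ?m"
    unfolding sum_distrib_right sum_subtractf[symmetric] by (simp add: algebra_simps)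
  then show ?thesis using that assms by (auto simp: log_moments_def)
qed

theorem theorem1:
  fixes dA dB :: nat and \<rho> :: "complex mat"
  assumes "\<rho> \<in> states (dA * dB)"
  shows
    "(\<exists>L :: real \<Rightarrow> ereal.
        (\<forall>\<^sub>F \<epsilon> in at_right 0.
           (\<lambda>n. ereal (1 / real n) * smooth_min_entropy (dA ^ n) (dB ^ n) \<epsilon> (iid_state dA dB \<rho> n))
             \<longlonglongrightarrow> L \<epsilon>) \<and>
        (L \<longlongrightarrow> cond_entropy dA dB \<rho>) (at_right 0)) \<and>
     (\<exists>L :: real \<Rightarrow> ereal.
        (\<forall>\<^sub>F \<epsilon> in at_right 0.
           (\<lambda>n. ereal (1 / real n) * smooth_max_entropy (dA ^ n) (dB ^ n) \<epsilon> (iid_state dA dB \<rho> n))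
             \<longlonglongrightarrow> L \<epsilon>) \<and>
        (L \<longlongrightarrow> cond_entropy dA dB \<rho>) (at_right 0))"
proof -
  have psd: "psd_mat (dA * dB) \<rho>" and tr: "mat_trace \<rho> = 1" using assms by (auto simp: states_def)
  obtain U x where U: "unitary_mat (dA * dB) U" and \<rho>: "\<rho> = spec (dA * dB) U x"
    and x: "\<And>i. i < dA * dB \<Longrightarrow> 0 \<le> x i"
    using psd_spectral[OF psd] by blast
  obtain V y where V: "unitary_mat dB V" and \<beta>: "ptrace_mid 1 dA dB \<rho> = spec dB V y"
    and y: "\<And>i. i < dB \<Longrightarrow> 0 \<le> y i"
    using psd_spectral[OF psd_ptrace_first[OF psd]] by blast
  have x1: "(\<Sum>i<dA * dB. x i) = 1" using tr unfolding \<rho> tr_spec[OF U] by (simp only: of_real_eq_1_iff)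
  have "mat_trace (ptrace_mid 1 dA dB \<rho> * 1\<^sub>m dB) = mat_trace (\<rho> * kr dA (1\<^sub>m dB))"
    using psd_carrier[OF psd] by (intro tr_mult_kr[symmetric]) auto
  then have "mat_trace (spec dB V y) = 1"
    using psd_dims[OF psd] V unfolding \<beta> by (simp add: mm_one_right tr)
  then have y1: "(\<Sum>i<dB. y i) = 1" unfolding tr_spec[OF V] by (simp only: of_real_eq_1_iff)
  obtain v where mx: "log_moments (dA * dB) x (\<Sum>i<dA * dB. x i * log 2 (x i)) v"
    using log_moments_exists x x1 by blast
  obtain v' where my: "log_moments dB y (\<Sum>i<dB. y i * log 2 (y i)) v'"
    using log_moments_exists y y1 by blast
  note bounds = iid_rate_bounds[OF U V \<rho> \<beta> mx my]
  have H: "cond_entropy dA dB \<rho> = ereal ((\<Sum>i<dB. y i * log 2 (y i)) - (\<Sum>i<dA * dB. x i * log 2 (x i)))"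
    using x y y1 by (rule cond_entropy_spec[OF U V \<rho> \<beta>])
  \<comment> \<open>The inner limits are available for all \<epsilon> strictly between 0 and 1, a
    right neighbourhood of 0.\<close>
  have ev: "\<forall>\<^sub>F \<epsilon> in at_right 0. P \<epsilon>" if "\<And>\<epsilon>::real. 0 < \<epsilon> \<Longrightarrow> \<epsilon> < 1 \<Longrightarrow> P \<epsilon>" for P
    using that by (auto simp: eventually_at_right_field intro!: exI[of _ "1::real"])
  have "(\<lambda>n. ereal (1 / real n) * smooth_min_entropy (dA ^ n) (dB ^ n) \<epsilon> (iid_state dA dB \<rho> n))
      \<longlonglongrightarrow> cond_entropy dA dB \<rho>" if "0 < \<epsilon>" "\<epsilon> < 1" for \<epsilon>
    unfolding H by (rule tendsto_ereal_epsI) (rule eventually_mono[OF bounds[OF that]], auto)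
  moreover have "(\<lambda>n. ereal (1 / real n) * smooth_max_entropy (dA ^ n) (dB ^ n) \<epsilon> (iid_state dA dB \<rho> n))
      \<longlonglongrightarrow> cond_entropy dA dB \<rho>" if "0 < \<epsilon>" "\<epsilon> < 1" for \<epsilon>
    unfolding H by (rule tendsto_ereal_epsI) (rule eventually_mono[OF bounds[OF that]], auto)
  ultimately show ?thesis
    \<comment> \<open>The limit over n is the same for every such \<epsilon>, so a constant function
      is the witness and the outer limit is immediate.\<close>
    by (intro conjI exI[of _ "\<lambda>_. cond_entropy dA dB \<rho>"] ev tendsto_const) auto
qed

end
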